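(* Let $\mathbf u\in L^2(\mathbb R^d)$ with $\|\mathbf u\|=1$, and for $j\in\mathbb Z$ put $$\mathbf H_E^{j}=\mathcal P^{-1}\left(\int_{2^{-j}E}^{\oplus}\left(L^2(\mathbb R^d)\otimes \mathbf u\right)|\det B(\lambda)|\,d\lambda\right),\qquad \mathbf H_E=\mathbf H_E^0.$$ Let $f$ be such that $\{L(\gamma)f:\gamma\in\Gamma\}$ is a Parseval frame for $\mathbf H_E$. Then the system $\{D_{A^j}L(\gamma)f:\gamma\in\Gamma,\ j\in\mathbb Z\}$ is a Parseval frame for the multiplicity-free space $$\bigoplus_{j\in\mathbb Z}\mathbf H_E^j=\mathcal P^{-1}\left(\int_\Sigma^\oplus\left(L^2(\mathbb R^d)\otimes\mathbf u\right)|\det B(\lambda)|\,d\lambda\right).$$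
   Context: Setting. $N$ is a simply connected, connected, non-commutative nilpotent Lie group with Lie algebra $\mathfrak n$ of dimension $n$ over $\mathbb R$, with a rational structure (i.e. $\mathfrak n$ has a basis with rational structure constants), and $J=\{B_1,\dots,B_n\}=\{Z_1,\dots,Z_{n-2d},Y_1,\dots,Y_d,X_1,\dots,X_d\}$ is a fixed ordered Jordan-Hölder basis (each span of an initial segment is an ideal) such that: (C1) $\mathfrak n=\mathfrak z(\mathfrak n)\oplus\mathfrak a\oplus\mathfrak b$ with $\mathfrak z(\mathfrak n)=\mathrm{span}_{\mathbb R}\{Z_i\}$ the center, $\mathfrak a=\mathrm{span}_{\mathbb R}\{Y_i\}$, $\mathfrak b=\mathrm{span}_{\mathbb R}\{X_i\}$; (C2) $\mathfrak z(\mathfrak n)\oplus\mathfrak a$ is a commutative ideal, $\mathfrak b$ is a commutative subalgebra (not an ideal), and $[\mathfrak a,\mathfrak b]\subseteq\mathfrak z(\mathfrak n)$; (C3) with $V=([X_i,Y_j])_{1\le i,j\le d}$, whose entries are regarded as linear functions on $[\mathfrak n,\mathfrak n]^*$, $\det V$ is a nonzero polynomial with rational coefficients; the only possibly nonzero brackets of basis elements are $[X_i,Y_j]=-[Y_j,X_i]$. For $\lambda\in\mathfrak n^*$ let $B(\lambda)=(\lambda[X_i,Y_j])_{1\le i,j\le d}$. Let $\Sigma=\{\lambda\in\mathfrak n^*:\det B(\lambda)\ne0,\ \lambda(X_i)=\lambda(Y_i)=0,\ 1\le i\le d\}$, identified with an open subset of $\mathbb R^{n-2d}$ via $\lambda\mapsto(\lambda(Z_1),\dots,\lambda(Z_{n-2d}))$;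 $d\lambda$ is Lebesgue measure. Let $E=\left([-1/2,1/2]^{n-2d}\setminus[-1/4,1/4]^{n-2d}\right)\cap\Sigma$, and $2^{-j}E=\{2^{-j}\lambda:\lambda\in E\}$. For $\lambda\in\Sigma$, $\pi_\lambda$ is the irreducible unitary representation of $N$ on $L^2(\mathbb R^d)$ with $\pi_\lambda(\exp\sum z_lZ_l)\phi(t)=e^{2\pi i\langle\lambda,z\rangle}\phi(t)$, $\pi_\lambda(\exp\sum y_kY_k)\phi(t)=e^{-2\pi i\langle t,B(\lambda)y\rangle}\phi(t)$, $\pi_\lambda(\exp\sum x_kX_k)\phi(t)=\phi(t-x)$. $N$ carries the Haar measure which is Lebesgue measure in the coordinates $(z,y,x)\mapsto\exp(\sum z_lZ_l)\exp(\sum y_kY_k)\exp(\sum x_kX_k)$. The Fourier transform is $\mathcal Ff(\lambda)=\int_Nf(m)\pi_\lambda(m)\,dm$ on $L^1\cap L^2$ (weakly defined), and the Plancherel transform $\mathcal P$ is its unitary extension $\mathcal P:L^2(N)\to\int_\Sigma^\oplus L^2(\mathbb R^d)\otimes L^2(\mathbb R^d)\,|\det B(\lambda)|\,d\lambda$, where $L^2(\mathbb R^d)\otimes L^2(\mathbb R^d)$ is the space of Hilbert-Schmidt operators, $\phi\otimes\mathbf u$ is the rank-one operator $v\mapsto\langle v,\mathbf u\rangle\phi$, and $L^2(\mathbb R^d)\otimes\mathbf u=\{\phi\otimes\mathbf u:\phi\in L^2(\mathbb R^d)\}$. A direct integral over a subset of $\Sigma$ is viewed as the subspace of fields vanishing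 outside that subset. A left-invariant closed subspace of $L^2(N)$ is multiplicity-free if its image under $\mathcal P$ is $\int_\Sigma^\oplus L^2(\mathbb R^d)\otimes P_\lambda(L^2(\mathbb R^d))\,|\det B(\lambda)|\,d\lambda$ for a field of projections $P_\lambda$ of rank one for a.e. $\lambda$. $L$ is the left regular representation of $N$ on $L^2(N)$. $\Gamma=\exp(\sum_l\mathbb ZZ_l)\exp(\sum_i\mathbb ZY_i)\exp(\sum_k\mathbb ZX_k)\subset N$ (the set of such products). $A$ is the automorphism of $N$ given by $A\big(\exp(\sum z_lZ_l)\exp(\sum y_kY_k)\exp(\sum x_kX_k)\big)=\exp(\sum 2z_lZ_l)\exp(\sum 2y_kY_k)\exp(\sum x_kX_k)$, and $(D_{A^j}f)(x)=2^{-j(n-d)/2}f(A^{-j}(x))$ for $j\in\mathbb Z$, a unitary operator on $L^2(N)$. A countable family $\{f_i\}$ in a Hilbert space $H$ is a Parseval frame for $H$ if $\sum_i|\langle f,f_i\rangle|^2=\|f\|^2$ for all $f\in H$. Direct sums are orthogonal Hilbert-space direct sums inside $L^2(N)$. *)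

theory Defs
  imports "HOL-Analysis.Analysis" "HOL-Algebra.Group"
begin

locale lie_algebra =
  fixes br :: "'g::real_vector \<Rightarrow> 'g \<Rightarrow> 'g"
  assumes bilinear: "bilinear br"
    and alternating: "br x x = 0"
    and jacobi: "br x (br y z) + br y (br z x) + br z (br x y) = 0"

definition lie_ideal :: "('g::real_vector \<Rightarrow> 'g \<Rightarrow> 'g) \<Rightarrow> 'g set \<Rightarrow> bool" where
  "lie_ideal br I \<longleftrightarrow> subspace I \<and> (\<forall>x. \<forall>y\<in>I. br x y \<in> I)"

definition lie_subalgebra :: "('g::real_vector \<Rightarrow> 'g \<Rightarrow> 'g) \<Rightarrow> 'g set \<Rightarrow> bool" where
  "lie_subalgebra br S \<longleftrightarrow> subspace S \<and> (\<forall>x\<in>S. \<forall>y\<in>S. br x y \<in> S)"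

definition lie_commutative_on :: "('g::real_vector \<Rightarrow> 'g \<Rightarrow> 'g) \<Rightarrow> 'g set \<Rightarrow> bool" where
  "lie_commutative_on br S \<longleftrightarrow> (\<forall>x\<in>S. \<forall>y\<in>S. br x y = 0)"

definition lie_center :: "('g::real_vector \<Rightarrow> 'g \<Rightarrow> 'g) \<Rightarrow> 'g set" where
  "lie_center br = {c. \<forall>x. br c x = 0}"

primrec lower_central :: "('g::real_vector \<Rightarrow> 'g \<Rightarrow> 'g) \<Rightarrow> nat \<Rightarrow> 'g set" where
  "lower_central br 0 = UNIV"
| "lower_central br (Suc k) = span {br x y | x y. y \<in> lower_central br k}"

definition lie_nilpotent :: "('g::real_vector \<Rightarrow> 'g \<Rightarrow> 'g) \<Rightarrow> bool" where
  "lie_nilpotent br \<longleftrightarrow> (\<exists>k. lower_central br k = {0})"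

definition has_rational_structure :: "('g::real_vector \<Rightarrow> 'g \<Rightarrow> 'g) \<Rightarrow> bool" where
  "has_rational_structure br \<longleftrightarrow>
     (\<exists>S. independent S \<and> span S = UNIV \<and>
          (\<forall>x\<in>S. \<forall>y\<in>S. \<forall>s\<in>S. representation S (br x y) s \<in> \<rat>))"

definition rational_polynomial :: "(real^'z::finite \<Rightarrow> real) \<Rightarrow> bool" where
  "rational_polynomial p \<longleftrightarrow>
     (\<exists>(S :: ('z \<Rightarrow> nat) set) c. finite S \<and> (\<forall>a\<in>S. c a \<in> \<rat>) \<and>
        (\<forall>l. p l = (\<Sum>a\<in>S. c a * (\<Prod>k\<in>UNIV. (l $ k) ^ a k))))"

text \<open>The group, its Lie algebra, and the distinguished basis. The index types carry linear
  orders because the basis is ordered: first the \<open>Z\<close>, then the \<open>Y\<close>, then the \<open>X\<close>.\<close>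

record ('n, 'g, 'z, 'd) nil_group = "'n monoid" +
  bracket :: "'g \<Rightarrow> 'g \<Rightarrow> 'g"
  expo :: "'g \<Rightarrow> 'n"
  Zvec :: "'z \<Rightarrow> 'g"
  Yvec :: "'d \<Rightarrow> 'g"
  Xvec :: "'d \<Rightarrow> 'g"

definition basis_vec :: "('n, 'g, 'z, 'd) nil_group \<Rightarrow> 'z + 'd + 'd \<Rightarrow> 'g" where
  "basis_vec G = case_sum (Zvec G) (case_sum (Yvec G) (Xvec G))"

text \<open>The functional on the Lie algebra with coordinates \<open>l\<close> along the \<open>Z\<close> that
  vanishes on all \<open>Y\<close> and \<open>X\<close>. Through it the dual of the center, and with it
  \<open>Sigma_set\<close> below, is identified with a subset of \<open>real^'z\<close>.\<close>

definition functional ::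
  "('n, 'g::euclidean_space, 'z::finite, 'd) nil_group \<Rightarrow> real^'z \<Rightarrow> 'g \<Rightarrow> real" where
  "functional G l = (THE h. linear h \<and> (\<forall>k. h (Zvec G k) = l $ k) \<and>
                            (\<forall>i. h (Yvec G i) = 0) \<and> (\<forall>i. h (Xvec G i) = 0))"

definition Bmat ::
  "('n, 'g::euclidean_space, 'z::finite, 'd::finite) nil_group \<Rightarrow> real^'z \<Rightarrow> real^'d^'d" where
  "Bmat G l = (\<chi> i j. functional G l (bracket G (Xvec G i) (Yvec G j)))"

text \<open>The library has no Lie groups. A connected, simply connected nilpotent Lie group is
  given, up to isomorphism, by its exponential map, which is a homeomorphism (even a
  diffeomorphism) from the Lie algebra and transports the product to the
  Baker-Campbell-Hausdorff product. The bracket assumptions below make the Lie algebra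
  two-step nilpotent, so the Baker-Campbell-Hausdorff series stops after the first bracket.
  The inner product of the Euclidean space \<open>'g\<close> plays no role.\<close>

locale nil_setting = group G
  for G :: "('n::t2_space, 'g::euclidean_space, 'z::{finite,linorder}, 'd::{finite,linorder}) nil_group"
    (structure) +
  assumes lie: "lie_algebra (bracket G)"
    and nilpotent: "lie_nilpotent (bracket G)"
    and noncommutative: "\<exists>x y. bracket G x y \<noteq> 0"
    and rational: "has_rational_structure (bracket G)"
    and carrier_UNIV: "carrier G = UNIV"
    and expo_homeomorphism: "\<exists>lg. homeomorphism UNIV UNIV (expo G) lg"
    and BCH: "expo G a \<otimes> expo G b = expo G (a + b + (1/2) *\<^sub>R bracket G a b)"
    and basis_inj: "inj (basis_vec G)"
    and basis_independent: "independent (range (basis_vec G))"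
    and basis_span: "span (range (basis_vec G)) = UNIV"
    and JH_Z: "lie_ideal (bracket G) (span (Zvec G ` {..k}))"
    and JH_Y: "lie_ideal (bracket G) (span (range (Zvec G) \<union> Yvec G ` {..i}))"
    and JH_X: "lie_ideal (bracket G) (span (range (Zvec G) \<union> range (Yvec G) \<union> Xvec G ` {..i}))"
    and center: "lie_center (bracket G) = span (range (Zvec G))"
    and za_ideal: "lie_ideal (bracket G) (span (range (Zvec G) \<union> range (Yvec G)))"
    and za_commutative: "lie_commutative_on (bracket G) (span (range (Zvec G) \<union> range (Yvec G)))"
    and b_subalgebra: "lie_subalgebra (bracket G) (span (range (Xvec G)))"
    and b_commutative: "lie_commutative_on (bracket G) (span (range (Xvec G)))"
    and b_not_ideal: "\<not> lie_ideal (bracket G) (span (range (Xvec G)))"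
    and ab_central: "\<lbrakk>a \<in> span (range (Yvec G)); b \<in> span (range (Xvec G))\<rbrakk>
                       \<Longrightarrow> bracket G a b \<in> lie_center (bracket G)"
    and det_nonzero: "\<exists>l. det (Bmat G l) \<noteq> 0"
    and det_rational: "rational_polynomial (\<lambda>l. det (Bmat G l))"

definition Sigma_set :: "('n, 'g::euclidean_space, 'z::finite, 'd::finite) nil_group \<Rightarrow> (real^'z) set" where
  "Sigma_set G = {l. det (Bmat G l) \<noteq> 0}"

definition E_set :: "('n, 'g::euclidean_space, 'z::finite, 'd::finite) nil_group \<Rightarrow> (real^'z) set" where
  "E_set G = (cbox (vec (-1/2)) (vec (1/2)) - cbox (vec (-1/4)) (vec (1/4))) \<inter> Sigma_set G"

definition coord_map ::
  "('n, 'g::euclidean_space, 'z::finite, 'd::finite) nil_group \<Rightarrow> (real^'z) \<times> (real^'d) \<times> (real^'d) \<Rightarrow> 'n" where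
  "coord_map G = (\<lambda>(z, y, x).
     expo G (\<Sum>l\<in>UNIV. z $ l *\<^sub>R Zvec G l) \<otimes>\<^bsub>G\<^esub>
     expo G (\<Sum>k\<in>UNIV. y $ k *\<^sub>R Yvec G k) \<otimes>\<^bsub>G\<^esub>
     expo G (\<Sum>k\<in>UNIV. x $ k *\<^sub>R Xvec G k))"

definition coords ::
  "('n, 'g::euclidean_space, 'z::finite, 'd::finite) nil_group \<Rightarrow> 'n \<Rightarrow> (real^'z) \<times> (real^'d) \<times> (real^'d)" where
  "coords G = inv_into UNIV (coord_map G)"

definition haar ::
  "('n::t2_space, 'g::euclidean_space, 'z::finite, 'd::finite) nil_group \<Rightarrow> 'n measure" where
  "haar G = distr lborel borel (coord_map G)"

definition Gamma_set :: "('n, 'g::euclidean_space, 'z::finite, 'd::finite) nil_group \<Rightarrow> 'n set" where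
  "Gamma_set G = coord_map G `
     {(z, y, x). (\<forall>l. z $ l \<in> \<int>) \<and> (\<forall>k. y $ k \<in> \<int>) \<and> (\<forall>k. x $ k \<in> \<int>)}"

definition left_transl :: "('n, 'g, 'z, 'd) nil_group \<Rightarrow> 'n \<Rightarrow> ('n \<Rightarrow> complex) \<Rightarrow> 'n \<Rightarrow> complex" where
  "left_transl G m f = (\<lambda>x. f (inv\<^bsub>G\<^esub> m \<otimes>\<^bsub>G\<^esub> x))"

definition dil :: "('n, 'g::euclidean_space, 'z::finite, 'd::finite) nil_group \<Rightarrow> 'n \<Rightarrow> 'n" where
  "dil G m = (case coords G m of (z, y, x) \<Rightarrow> coord_map G (2 *\<^sub>R z, 2 *\<^sub>R y, x))"

definition int_iterate :: "('n \<Rightarrow> 'n) \<Rightarrow> int \<Rightarrow> 'n \<Rightarrow> 'n" where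
  "int_iterate F j = (if 0 \<le> j then F ^^ nat j else (inv_into UNIV F) ^^ nat (- j))"

definition dil_op ::
  "('n, 'g::euclidean_space, 'z::finite, 'd::finite) nil_group \<Rightarrow> int \<Rightarrow> ('n \<Rightarrow> complex) \<Rightarrow> 'n \<Rightarrow> complex" where
  "dil_op G j f = (\<lambda>x. complex_of_real (2 powr (- real_of_int j * (real DIM('g) - real CARD('d)) / 2))
                        * f (int_iterate (dil G) (- j) x))"

text \<open>Elements of \<open>L\<^sup>2\<close> are represented by functions; equality
  in \<open>L\<^sup>2\<close> is equality almost everywhere.\<close>

definition L2 :: "'a measure \<Rightarrow> ('a \<Rightarrow> complex) set" where
  "L2 M = {f \<in> borel_measurable M. integrable M (\<lambda>x. (cmod (f x))\<^sup>2)}"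

definition L2_inner :: "'a measure \<Rightarrow> ('a \<Rightarrow> complex) \<Rightarrow> ('a \<Rightarrow> complex) \<Rightarrow> complex" where
  "L2_inner M f g = (LINT x|M. f x * cnj (g x))"

definition L2_norm :: "'a measure \<Rightarrow> ('a \<Rightarrow> complex) \<Rightarrow> real" where
  "L2_norm M f = sqrt (LINT x|M. (cmod (f x))\<^sup>2)"

definition L2_closed_subspace :: "'a measure \<Rightarrow> ('a \<Rightarrow> complex) set \<Rightarrow> bool" where
  "L2_closed_subspace M H \<longleftrightarrow>
     H \<subseteq> L2 M \<and> (\<lambda>x. 0) \<in> H \<and>
     (\<forall>f\<in>H. \<forall>g\<in>H. (\<lambda>x. f x + g x) \<in> H) \<and> (\<forall>c. \<forall>f\<in>H. (\<lambda>x. c * f x) \<in> H) \<and>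
     (\<forall>s. \<forall>f\<in>L2 M. (\<forall>k. s k \<in> H) \<longrightarrow> (\<lambda>k. L2_norm M (\<lambda>x. s k x - f x)) \<longlonglongrightarrow> 0 \<longrightarrow> f \<in> H)"

definition L2_orthogonal_family :: "'a measure \<Rightarrow> ('i \<Rightarrow> ('a \<Rightarrow> complex) set) \<Rightarrow> bool" where
  "L2_orthogonal_family M H \<longleftrightarrow>
     (\<forall>i. L2_closed_subspace M (H i)) \<and>
     (\<forall>i j. i \<noteq> j \<longrightarrow> (\<forall>f\<in>H i. \<forall>g\<in>H j. L2_inner M f g = 0))"

definition L2_direct_sum :: "'a measure \<Rightarrow> ('i \<Rightarrow> ('a \<Rightarrow> complex) set) \<Rightarrow> ('a \<Rightarrow> complex) set" where
  "L2_direct_sum M H =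
     {f \<in> L2 M. \<exists>g. (\<forall>i. g i \<in> H i) \<and>
        ((\<lambda>F. L2_norm M (\<lambda>x. f x - (\<Sum>i\<in>F. g i x))) \<longlongrightarrow> 0) (finite_subsets_at_top UNIV)}"

definition parseval_frame ::
  "'a measure \<Rightarrow> ('a \<Rightarrow> complex) set \<Rightarrow> 'i set \<Rightarrow> ('i \<Rightarrow> 'a \<Rightarrow> complex) \<Rightarrow> bool" where
  "parseval_frame M H I F \<longleftrightarrow> countable I \<and> (\<forall>i\<in>I. F i \<in> H) \<and>
     (\<forall>h\<in>H. ((\<lambda>i. (cmod (L2_inner M h (F i)))\<^sup>2) has_sum (L2_norm M h)\<^sup>2) I)"

type_synonym 'a oper = "('a \<Rightarrow> complex) \<Rightarrow> ('a \<Rightarrow> complex)"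

definition L2_linear :: "'a::euclidean_space oper \<Rightarrow> bool" where
  "L2_linear T \<longleftrightarrow>
     (\<forall>f\<in>L2 lborel. T f \<in> L2 lborel) \<and>
     (\<forall>f\<in>L2 lborel. \<forall>g\<in>L2 lborel. (AE t in lborel. f t = g t) \<longrightarrow> (AE t in lborel. T f t = T g t)) \<and>
     (\<forall>f\<in>L2 lborel. \<forall>g\<in>L2 lborel. \<forall>a b.
        AE t in lborel. T (\<lambda>s. a * f s + b * g s) t = a * T f t + b * T g t)"

definition oper_eq :: "'a::euclidean_space oper \<Rightarrow> 'a oper \<Rightarrow> bool" where
  "oper_eq S T \<longleftrightarrow> (\<forall>f\<in>L2 lborel. AE t in lborel. S f t = T f t)"

definition orthonormal_set :: "('a::euclidean_space \<Rightarrow> complex) set \<Rightarrow> bool" where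
  "orthonormal_set F \<longleftrightarrow> F \<subseteq> L2 lborel \<and>
     (\<forall>e\<in>F. \<forall>e'\<in>F. L2_inner lborel e e' = (if e = e' then 1 else 0))"

text \<open>The square of the Hilbert-Schmidt norm: the sum of \<open>\<parallel>T e\<parallel>\<^sup>2\<close> over an orthonormal basis
  is the supremum of the sums over finite orthonormal sets.\<close>

definition hs_norm2 :: "'a::euclidean_space oper \<Rightarrow> ennreal" where
  "hs_norm2 T = (SUP F\<in>{F. finite F \<and> orthonormal_set F}. \<Sum>e\<in>F. ennreal ((L2_norm lborel (T e))\<^sup>2))"

definition hilbert_schmidt :: "'a::euclidean_space oper \<Rightarrow> bool" where
  "hilbert_schmidt T \<longleftrightarrow> L2_linear T \<and> hs_norm2 T < \<infinity>"

definition rank_one_oper ::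
  "('a::euclidean_space \<Rightarrow> complex) \<Rightarrow> ('a \<Rightarrow> complex) \<Rightarrow> 'a oper" where
  "rank_one_oper \<phi> u = (\<lambda>v t. L2_inner lborel v u * \<phi> t)"

definition tensor_vec :: "('a::euclidean_space \<Rightarrow> complex) \<Rightarrow> 'a oper set" where
  "tensor_vec u = {T. L2_linear T \<and> (\<exists>\<phi>\<in>L2 lborel. oper_eq T (rank_one_oper \<phi> u))}"

text \<open>The Hilbert space tensor product of \<open>L\<^sup>2\<close> with a subspace \<open>W\<close>: the closed span, in the
  Hilbert-Schmidt norm, of the operators \<open>\<phi> \<otimes> w\<close> with \<open>w\<close> in \<open>W\<close>.\<close>

definition tensor_space :: "('a::euclidean_space \<Rightarrow> complex) set \<Rightarrow> 'a oper set" where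
  "tensor_space W = {T. hilbert_schmidt T \<and>
     (\<forall>\<epsilon>>0. \<exists>(n::nat) \<phi> w. (\<forall>i<n. \<phi> i \<in> L2 lborel \<and> w i \<in> W) \<and>
        hs_norm2 (\<lambda>v t. T v t - (\<Sum>i<n. rank_one_oper (\<phi> i) (w i) v t)) < ennreal \<epsilon>)}"

definition L2_projection :: "'a::euclidean_space oper \<Rightarrow> bool" where
  "L2_projection Q \<longleftrightarrow> L2_linear Q \<and> oper_eq (\<lambda>f. Q (Q f)) Q \<and>
     (\<forall>f\<in>L2 lborel. \<forall>g\<in>L2 lborel. L2_inner lborel (Q f) g = L2_inner lborel f (Q g))"

definition has_rank_one :: "'a::euclidean_space oper \<Rightarrow> bool" where
  "has_rank_one Q \<longleftrightarrow> (\<exists>w\<in>Q ` L2 lborel. \<not> (AE t in lborel. w t = 0) \<and>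
     (\<forall>f\<in>L2 lborel. \<exists>c. AE t in lborel. Q f t = c * w t))"

definition rep_Z :: "real^'z::finite \<Rightarrow> real^'z \<Rightarrow> (real^'d::finite) oper" where
  "rep_Z l z \<phi> = (\<lambda>t. cis (2 * pi * (l \<bullet> z)) * \<phi> t)"

definition rep_Y ::
  "('n, 'g::euclidean_space, 'z::finite, 'd::finite) nil_group \<Rightarrow> real^'z \<Rightarrow> real^'d \<Rightarrow> (real^'d) oper" where
  "rep_Y G l y \<phi> = (\<lambda>t. cis (- 2 * pi * (t \<bullet> (Bmat G l *v y))) * \<phi> t)"

definition rep_X :: "real^'d::finite \<Rightarrow> (real^'d) oper" where
  "rep_X x \<phi> = (\<lambda>t. \<phi> (t - x))"

definition rep ::
  "('n, 'g::euclidean_space, 'z::finite, 'd::finite) nil_group \<Rightarrow> real^'z \<Rightarrow> 'n \<Rightarrow> (real^'d) oper" where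
  "rep G l m \<phi> = (case coords G m of (z, y, x) \<Rightarrow> rep_Z l z (rep_Y G l y (rep_X x \<phi>)))"

text \<open>The density vanishes off \<open>Sigma_set G\<close>, so almost everywhere
  for this measure means almost everywhere on \<open>Sigma_set G\<close>.\<close>

definition plancherel_measure ::
  "('n, 'g::euclidean_space, 'z::finite, 'd::finite) nil_group \<Rightarrow> (real^'z) measure" where
  "plancherel_measure G = density lborel (\<lambda>l. ennreal \<bar>det (Bmat G l)\<bar>)"

text \<open>Measurability of the Hilbert-Schmidt norm follows from the weak measurability of the
  field, since \<open>L\<^sup>2\<close> is separable; it is included for convenience.\<close>

definition direct_integral ::
  "('n, 'g::euclidean_space, 'z::finite, 'd::finite) nil_group \<Rightarrow> (real^'z \<Rightarrow> (real^'d) oper) set" where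
  "direct_integral G = {T. (\<forall>l. hilbert_schmidt (T l)) \<and>
     (\<forall>f\<in>L2 lborel. \<forall>g\<in>L2 lborel. (\<lambda>l. L2_inner lborel (T l f) g) \<in> borel_measurable borel) \<and>
     (\<lambda>l. hs_norm2 (T l)) \<in> borel_measurable borel \<and>
     (\<integral>\<^sup>+l. hs_norm2 (T l) \<partial>plancherel_measure G) < \<infinity>}"

definition field_eq ::
  "('n, 'g::euclidean_space, 'z::finite, 'd::finite) nil_group
     \<Rightarrow> (real^'z \<Rightarrow> (real^'d) oper) \<Rightarrow> (real^'z \<Rightarrow> (real^'d) oper) \<Rightarrow> bool" where
  "field_eq G S T \<longleftrightarrow> (AE l in plancherel_measure G. oper_eq (S l) (T l))"

definition direct_integral_on ::
  "('n, 'g::euclidean_space, 'z::finite, 'd::finite) nil_group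
     \<Rightarrow> (real^'z) set \<Rightarrow> (real^'z \<Rightarrow> (real^'d) oper set) \<Rightarrow> (real^'z \<Rightarrow> (real^'d) oper) set" where
  "direct_integral_on G S W = {T \<in> direct_integral G. AE l in plancherel_measure G.
     (if l \<in> S then T l \<in> W l else oper_eq (T l) (\<lambda>v t. 0))}"

definition is_fourier ::
  "('n::t2_space, 'g::euclidean_space, 'z::finite, 'd::finite) nil_group
     \<Rightarrow> ('n \<Rightarrow> complex) \<Rightarrow> real^'z \<Rightarrow> (real^'d) oper \<Rightarrow> bool" where
  "is_fourier G f l T \<longleftrightarrow> L2_linear T \<and> (\<forall>\<phi>\<in>L2 lborel. \<forall>\<psi>\<in>L2 lborel.
     L2_inner lborel (T \<phi>) \<psi> = (LINT m|haar G. f m * L2_inner lborel (rep G l m \<phi>) \<psi>))"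

text \<open>\<open>P\<close> is the Plancherel transform: a surjective linear isometry from \<open>L\<^sup>2\<close> of the group to
  the direct integral that agrees with the Fourier transform on integrable functions.
  These properties determine it up to equality almost everywhere.\<close>

definition plancherel_transform ::
  "('n::t2_space, 'g::euclidean_space, 'z::finite, 'd::finite) nil_group
     \<Rightarrow> (('n \<Rightarrow> complex) \<Rightarrow> real^'z \<Rightarrow> (real^'d) oper) \<Rightarrow> bool" where
  "plancherel_transform G P \<longleftrightarrow>
     (\<forall>f\<in>L2 (haar G). P f \<in> direct_integral G) \<and>
     (\<forall>f\<in>L2 (haar G). \<forall>g\<in>L2 (haar G). \<forall>a b.
        field_eq G (P (\<lambda>x. a * f x + b * g x)) (\<lambda>l v t. a * P f l v t + b * P g l v t)) \<and>
     (\<forall>f\<in>L2 (haar G).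
        (\<integral>\<^sup>+l. hs_norm2 (P f l) \<partial>plancherel_measure G) = ennreal ((L2_norm (haar G) f)\<^sup>2)) \<and>
     (\<forall>T\<in>direct_integral G. \<exists>f\<in>L2 (haar G). field_eq G (P f) T) \<and>
     (\<forall>f\<in>L2 (haar G). integrable (haar G) f \<longrightarrow>
        (AE l in plancherel_measure G. is_fourier G f l (P f l)))"

definition plancherel_preimage ::
  "('n::t2_space, 'g::euclidean_space, 'z::finite, 'd::finite) nil_group
     \<Rightarrow> (('n \<Rightarrow> complex) \<Rightarrow> real^'z \<Rightarrow> (real^'d) oper)
     \<Rightarrow> (real^'z \<Rightarrow> (real^'d) oper) set \<Rightarrow> ('n \<Rightarrow> complex) set" where
  "plancherel_preimage G P D = {f \<in> L2 (haar G). P f \<in> D}"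

definition plancherel_image ::
  "('n::t2_space, 'g::euclidean_space, 'z::finite, 'd::finite) nil_group
     \<Rightarrow> (('n \<Rightarrow> complex) \<Rightarrow> real^'z \<Rightarrow> (real^'d) oper)
     \<Rightarrow> ('n \<Rightarrow> complex) set \<Rightarrow> (real^'z \<Rightarrow> (real^'d) oper) set" where
  "plancherel_image G P H = {T \<in> direct_integral G. \<exists>f\<in>H. field_eq G (P f) T}"

definition multiplicity_free ::
  "('n::t2_space, 'g::euclidean_space, 'z::finite, 'd::finite) nil_group
     \<Rightarrow> (('n \<Rightarrow> complex) \<Rightarrow> real^'z \<Rightarrow> (real^'d) oper) \<Rightarrow> ('n \<Rightarrow> complex) set \<Rightarrow> bool" where
  "multiplicity_free G P H \<longleftrightarrow>
     L2_closed_subspace (haar G) H \<and>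
     (\<forall>m\<in>carrier G. \<forall>f\<in>H. left_transl G m f \<in> H) \<and>
     (\<exists>Q. (\<forall>f\<in>L2 lborel. \<forall>g\<in>L2 lborel. (\<lambda>l. L2_inner lborel (Q l f) g) \<in> borel_measurable borel) \<and>
          (AE l in plancherel_measure G. L2_projection (Q l) \<and> has_rank_one (Q l)) \<and>
          plancherel_image G P H =
            direct_integral_on G (Sigma_set G) (\<lambda>l. tensor_space (Q l ` L2 lborel)))"

definition H_E ::
  "('n::t2_space, 'g::euclidean_space, 'z::finite, 'd::finite) nil_group
     \<Rightarrow> (('n \<Rightarrow> complex) \<Rightarrow> real^'z \<Rightarrow> (real^'d) oper)
     \<Rightarrow> (real^'d \<Rightarrow> complex) \<Rightarrow> int \<Rightarrow> ('n \<Rightarrow> complex) set" where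
  "H_E G P u j = plancherel_preimage G P
     (direct_integral_on G ((\<lambda>l. (2 powi (- j)) *\<^sub>R l) ` E_set G) (\<lambda>l. tensor_vec u))"

end

(* A dilation by 2 of the central and the Y coordinates changes the parameter of the
   representation from l to 2 l. Hence D_{A^j} maps fields supported on E unitarily onto fields
   supported on 2^(-j) E, and the sets 2^(-j) E tile Sigma, so the frame identity on H_E can be
   transported to every summand and added up by orthogonality. The covariance of the Plancherel
   transform under dilations and left translations is computed on integrable functions and
   extended by density. *)

theory Submission
  imports Defs
begin

section \<open>Square-integrable functions\<close>

text \<open>Functions stand for classes modulo null sets and operators are maps on functions, so
  identities hold almost everywhere in two senses: in the variable of the function and in the
  parameter l. Statements about \<open>P\<close> are reduced to a single l, outside a countable
  union of null sets.

  \<open>P\<close> is an isometry for norms, with a formula only on integrable functions. L2 limits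
  reach a single l because integrals of \<open>hs_norm2\<close> that tend to 0 force, at almost
  every l, errors of arbitrarily small Hilbert-Schmidt norm. Such limits preserve the vanishing of
  an operator on a fixed vector. Membership in L2 tensor u is a condition of this kind, and it is
  also stable under unitary operators acting from the left.

  For fixed h, the density \<open>hs_norm2 (P h l)\<close> defines a finite measure whose mass on S
  is the squared norm of the part of h over S. Its countable additivity turns the tiling into a
  convergent orthogonal expansion, without any handling of infinite sums of operators.\<close>

lemma L2_measurable [measurable_dest]: "f \<in> L2 M \<Longrightarrow> f \<in> borel_measurable M"
  by (simp add: L2_def)

lemma L2_lborel_measurable: "f \<in> L2 lborel \<Longrightarrow> f \<in> borel_measurable borel"
  by (simp add: L2_def)

lemma L2_integrable: "f \<in> L2 M \<Longrightarrow> integrable M (\<lambda>x. (cmod (f x))\<^sup>2)"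
  by (simp add: L2_def)

lemma L2_bounded_by:
  assumes [measurable]: "f \<in> borel_measurable M" and "integrable M g"
    and "AE x in M. (cmod (f x))\<^sup>2 \<le> g x"
  shows "f \<in> L2 M"
proof -
  have "integrable M (\<lambda>x. (cmod (f x))\<^sup>2)"
    by (rule Bochner_Integration.integrable_bound[OF assms(2)]) (use assms(3) in auto)
  then show ?thesis by (simp add: L2_def)
qed

lemma cmod_add_square_le: "(cmod (a + b))\<^sup>2 \<le> 2 * (cmod a)\<^sup>2 + 2 * (cmod b)\<^sup>2"
proof -
  have "(cmod (a + b))\<^sup>2 \<le> (cmod a + cmod b)\<^sup>2"
    by (intro power_mono norm_triangle_ineq) auto
  also have "\<dots> \<le> 2 * (cmod a)\<^sup>2 + 2 * (cmod b)\<^sup>2"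
    using sum_squares_bound[of "cmod a" "cmod b"] by (simp add: power2_sum)
  finally show ?thesis .
qed

lemma L2_zero [simp]: "(\<lambda>x. 0) \<in> L2 M"
  by (simp add: L2_def)

lemma L2_add: "f \<in> L2 M \<Longrightarrow> g \<in> L2 M \<Longrightarrow> (\<lambda>x. f x + g x) \<in> L2 M"
  by (rule L2_bounded_by[where g = "\<lambda>x. 2 * (cmod (f x))\<^sup>2 + 2 * (cmod (g x))\<^sup>2"])
     (auto simp: L2_integrable cmod_add_square_le intro: L2_measurable)

lemma L2_scale: "f \<in> L2 M \<Longrightarrow> (\<lambda>x. c * f x) \<in> L2 M"
  by (auto simp: L2_def norm_mult power_mult_distrib)

lemma L2_diff: "f \<in> L2 M \<Longrightarrow> g \<in> L2 M \<Longrightarrow> (\<lambda>x. f x - g x) \<in> L2 M"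
  using L2_add[of f M "\<lambda>x. (-1) * g x"] L2_scale[of g M "-1"] by simp

lemma L2_lincomb: "f \<in> L2 M \<Longrightarrow> g \<in> L2 M \<Longrightarrow> (\<lambda>x. a * f x + b * g x) \<in> L2 M"
  by (intro L2_add L2_scale)

lemma L2_sum: "(\<And>i. i \<in> A \<Longrightarrow> f i \<in> L2 M) \<Longrightarrow> (\<lambda>x. \<Sum>i\<in>A. f i x) \<in> L2 M"
  by (induction A rule: infinite_finite_induct) (auto intro: L2_add)

lemma L2_norm_nonneg [simp]: "L2_norm M f \<ge> 0"
  by (simp add: L2_norm_def)

lemma L2_norm_square: "(L2_norm M f)\<^sup>2 = (LINT x|M. (cmod (f x))\<^sup>2)"
  by (simp add: L2_norm_def)

lemma L2_norm_cong_AE: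
  assumes [measurable]: "f \<in> borel_measurable M" "g \<in> borel_measurable M"
    and "AE x in M. f x = g x"
  shows "L2_norm M f = L2_norm M g"
  unfolding L2_norm_def by (intro arg_cong[where f = sqrt] integral_cong_AE) (use assms(3) in auto)

lemma L2_norm_scale: "L2_norm M (\<lambda>x. c * f x) = cmod c * L2_norm M f"
  unfolding L2_norm_def by (simp add: norm_mult power_mult_distrib real_sqrt_mult)

lemma L2_norm_add_square_le:
  assumes "f \<in> L2 M" "g \<in> L2 M"
  shows "(L2_norm M (\<lambda>x. f x + g x))\<^sup>2 \<le> 2 * (L2_norm M f)\<^sup>2 + 2 * (L2_norm M g)\<^sup>2"
proof -
  have "(LINT x|M. (cmod (f x + g x))\<^sup>2) \<le> (LINT x|M. 2 * (cmod (f x))\<^sup>2 + 2 * (cmod (g x))\<^sup>2)"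
    by (intro integral_mono) (auto intro!: L2_integrable L2_add assms cmod_add_square_le)
  also have "\<dots> = 2 * (LINT x|M. (cmod (f x))\<^sup>2) + 2 * (LINT x|M. (cmod (g x))\<^sup>2)"
    using L2_integrable[OF assms(1)] L2_integrable[OF assms(2)] by simp
  finally show ?thesis by (simp add: L2_norm_square)
qed

lemma L2_norm_zero_AE:
  assumes "f \<in> L2 M" "L2_norm M f = 0"
  shows "AE x in M. f x = 0"
proof -
  have "(LINT x|M. (cmod (f x))\<^sup>2) = 0"
    using assms(2) L2_norm_square[of M f] by simp
  then have "AE x in M. (cmod (f x))\<^sup>2 = 0"
    by (subst (asm) integral_nonneg_eq_0_iff_AE) (auto simp: L2_integrable assms(1))
  then show ?thesis by auto
qed

lemma L2_norm_eq_0_AE: "AE x in M. f x = 0 \<Longrightarrow> L2_norm M f = 0"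
proof -
  assume "AE x in M. f x = 0"
  then have "(LINT x|M. (cmod (f x))\<^sup>2) = 0"
    by (intro integral_eq_zero_AE) auto
  then show ?thesis by (simp add: L2_norm_def)
qed

lemma L2_inner_integrable:
  assumes "f \<in> L2 M" "g \<in> L2 M"
  shows "integrable M (\<lambda>x. f x * cnj (g x))"
proof (rule Bochner_Integration.integrable_bound)
  show "integrable M (\<lambda>x. (cmod (f x))\<^sup>2 + (cmod (g x))\<^sup>2)"
    using assms by (auto intro: L2_integrable)
  have [measurable]: "f \<in> borel_measurable M" "g \<in> borel_measurable M"
    using assms by (auto intro: L2_measurable)
  show "(\<lambda>x. f x * cnj (g x)) \<in> borel_measurable M"
    by (intro borel_measurable_times measurable_compose[of g M borel cnj] borel_measurable_continuous_onI)
       (auto intro: continuous_intros)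
  have "cmod (f x) * cmod (g x) \<le> (cmod (f x))\<^sup>2 + (cmod (g x))\<^sup>2" for x
  proof -
    have "2 * cmod (f x) * cmod (g x) \<le> (cmod (f x))\<^sup>2 + (cmod (g x))\<^sup>2"
      by (rule sum_squares_bound)
    moreover have "0 \<le> cmod (f x) * cmod (g x)" by simp
    ultimately show ?thesis by linarith
  qed
  then show "AE x in M. norm (f x * cnj (g x)) \<le> norm ((cmod (f x))\<^sup>2 + (cmod (g x))\<^sup>2)"
    by (auto simp: norm_mult)
qed

lemma L2_inner_add_left:
  "f \<in> L2 M \<Longrightarrow> g \<in> L2 M \<Longrightarrow> h \<in> L2 M \<Longrightarrow>
    L2_inner M (\<lambda>x. f x + g x) h = L2_inner M f h + L2_inner M g h"
  unfolding L2_inner_def by (simp add: distrib_right L2_inner_integrable)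

lemma L2_inner_diff_left:
  "f \<in> L2 M \<Longrightarrow> g \<in> L2 M \<Longrightarrow> h \<in> L2 M \<Longrightarrow>
    L2_inner M (\<lambda>x. f x - g x) h = L2_inner M f h - L2_inner M g h"
  unfolding L2_inner_def by (simp add: left_diff_distrib L2_inner_integrable)

lemma L2_inner_scale_left: "L2_inner M (\<lambda>x. c * f x) h = c * L2_inner M f h"
  unfolding L2_inner_def by (simp add: mult.assoc)

lemma L2_inner_scale_right: "L2_inner M f (\<lambda>x. c * h x) = cnj c * L2_inner M f h"
  unfolding L2_inner_def by (simp add: mult.left_commute)

lemma L2_inner_lincomb_left:
  "f \<in> L2 M \<Longrightarrow> g \<in> L2 M \<Longrightarrow> h \<in> L2 M \<Longrightarrow>
    L2_inner M (\<lambda>x. a * f x + b * g x) h = a * L2_inner M f h + b * L2_inner M g h"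
  by (simp add: L2_inner_add_left L2_inner_scale_left L2_scale)

lemma L2_inner_commute: "L2_inner M g f = cnj (L2_inner M f g)"
proof -
  have "cnj (L2_inner M f g) = (LINT x|M. cnj (f x * cnj (g x)))"
    unfolding L2_inner_def by (rule Bochner_Integration.integral_cnj[symmetric])
  then show ?thesis by (simp add: L2_inner_def mult.commute)
qed

lemma L2_inner_cong_left:
  assumes "f \<in> L2 M" "f' \<in> L2 M" "g \<in> L2 M" "AE x in M. f x = f' x"
  shows "L2_inner M f g = L2_inner M f' g"
  unfolding L2_inner_def
  by (rule integral_cong_AE)
     (use assms in \<open>auto intro!: borel_measurable_integrable L2_inner_integrable\<close>)

lemma L2_inner_self: "L2_inner M f f = complex_of_real ((L2_norm M f)\<^sup>2)"
  unfolding L2_inner_def L2_norm_square by (simp only: complex_norm_square[symmetric] integral_complex_of_real)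

lemma L2_norm_add_square:
  assumes "f \<in> L2 M" "g \<in> L2 M"
  shows "(L2_norm M (\<lambda>x. f x + g x))\<^sup>2
    = (L2_norm M f)\<^sup>2 + (L2_norm M g)\<^sup>2 + 2 * Re (L2_inner M f g)"
proof -
  have pt: "(cmod (f x + g x))\<^sup>2 = (cmod (f x))\<^sup>2 + (cmod (g x))\<^sup>2 + 2 * Re (f x * cnj (g x))" for x
    unfolding cmod_power2 by (simp add: power2_eq_square algebra_simps)
  have "integrable M (\<lambda>x. Re (f x * cnj (g x)))"
    by (intro integrable_Re L2_inner_integrable assms)
  then have "(LINT x|M. (cmod (f x + g x))\<^sup>2) = (LINT x|M. (cmod (f x))\<^sup>2) + (LINT x|M. (cmod (g x))\<^sup>2)
      + 2 * (LINT x|M. Re (f x * cnj (g x)))"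
    unfolding pt using L2_integrable[OF assms(1)] L2_integrable[OF assms(2)]
    by (simp del: complex_cnj_cnj times_complex.sel)
  then show ?thesis
    by (simp only: L2_norm_square L2_inner_def integral_Re[OF L2_inner_integrable[OF assms]])
qed

text \<open>Taking c = 1 makes the real part of the inner product vanish, and c = \<i> the imaginary
  part. This yields orthogonality from norms alone, which are what the Plancherel transform
  controls.\<close>

lemma L2_orthogonal_if_pythagoras:
  assumes "f \<in> L2 M" "g \<in> L2 M"
    and "\<And>c. cmod c = 1 \<Longrightarrow> (L2_norm M (\<lambda>x. f x + c * g x))\<^sup>2 = (L2_norm M f)\<^sup>2 + (L2_norm M g)\<^sup>2"
  shows "L2_inner M f g = 0"
proof -
  have "Re (cnj c * L2_inner M f g) = 0" if "cmod c = 1" for c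
    using L2_norm_add_square[OF assms(1) L2_scale[OF assms(2), of c]] assms(3)[OF that] that
    by (simp add: L2_inner_scale_right L2_norm_scale)
  from this[of 1] this[of \<i>] show ?thesis
    by (simp add: complex_eq_iff)
qed

section \<open>Operators and their Hilbert-Schmidt norm\<close>

lemma oper_eq_refl [simp]: "oper_eq T T"
  by (simp add: oper_eq_def)

lemma oper_eq_sym: "oper_eq S T \<Longrightarrow> oper_eq T S"
  unfolding oper_eq_def by (metis (mono_tags, lifting) AE_mp AE_I2)

lemma oper_eq_trans [trans]: "oper_eq R S \<Longrightarrow> oper_eq S T \<Longrightarrow> oper_eq R T"
  unfolding oper_eq_def by (auto elim!: eventually_elim2 dest!: bspec)

lemma L2_linear_closed: "L2_linear T \<Longrightarrow> f \<in> L2 lborel \<Longrightarrow> T f \<in> L2 lborel"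
  by (simp add: L2_linear_def)

lemma L2_linear_cong:
  "L2_linear T \<Longrightarrow> f \<in> L2 lborel \<Longrightarrow> g \<in> L2 lborel \<Longrightarrow> AE t in lborel. f t = g t
    \<Longrightarrow> AE t in lborel. T f t = T g t"
  by (simp add: L2_linear_def)

lemma L2_linear_lincomb:
  "L2_linear T \<Longrightarrow> f \<in> L2 lborel \<Longrightarrow> g \<in> L2 lborel \<Longrightarrow>
     AE t in lborel. T (\<lambda>s. a * f s + b * g s) t = a * T f t + b * T g t"
  by (simp add: L2_linear_def)

lemma L2_linear_scale:
  assumes "L2_linear T" "f \<in> L2 lborel"
  shows "AE t in lborel. T (\<lambda>s. a * f s) t = a * T f t"
  using L2_linear_lincomb[OF assms assms(2), of a 0] by simp

lemma L2_linear_zero [simp]: "L2_linear (\<lambda>v t. 0)"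
  by (simp add: L2_linear_def)

lemma L2_linear_combination:
  assumes "L2_linear S" "L2_linear T"
  shows "L2_linear (\<lambda>v t. a * S v t + b * T v t)"
  unfolding L2_linear_def
proof (intro conjI ballI allI impI)
  fix f g :: "'a \<Rightarrow> complex"
  assume f: "f \<in> L2 lborel" and g: "g \<in> L2 lborel"
  show "(\<lambda>t. a * S f t + b * T f t) \<in> L2 lborel"
    by (intro L2_lincomb L2_linear_closed[OF assms(1) f] L2_linear_closed[OF assms(2) f])
  show "AE t in lborel. a * S f t + b * T f t = a * S g t + b * T g t" if "AE t in lborel. f t = g t"
    using L2_linear_cong[OF assms(1) f g that] L2_linear_cong[OF assms(2) f g that]
    by eventually_elim simp
  fix c e
  show "AE t in lborel. a * S (\<lambda>s. c * f s + e * g s) t + b * T (\<lambda>s. c * f s + e * g s) t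
      = c * (a * S f t + b * T f t) + e * (a * S g t + b * T g t)"
    using L2_linear_lincomb[OF assms(1) f g, of c e] L2_linear_lincomb[OF assms(2) f g, of c e]
    by eventually_elim (simp add: algebra_simps)
qed

lemma L2_linear_compose: "L2_linear S \<Longrightarrow> L2_linear T \<Longrightarrow> L2_linear (\<lambda>v. S (T v))"
  unfolding L2_linear_def
proof (intro conjI ballI allI impI, goal_cases)
  case (3 f g a b)
  then have "AE t in lborel. S (T (\<lambda>s. a * f s + b * g s)) t = S (\<lambda>s. a * T f s + b * T g s) t"
    by (simp add: L2_lincomb)
  moreover have "AE t in lborel. S (\<lambda>s. a * T f s + b * T g s) t = a * S (T f) t + b * S (T g) t"
    using 3 by simp
  ultimately show ?case by eventually_elim simp
qed simp_all

lemma orthonormal_set_L2: "orthonormal_set F \<Longrightarrow> e \<in> F \<Longrightarrow> e \<in> L2 lborel"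
  by (auto simp: orthonormal_set_def)

lemma hs_norm2_mono:
  assumes "\<And>v. v \<in> L2 lborel \<Longrightarrow> L2_norm lborel (S v) \<le> L2_norm lborel (T v)"
  shows "hs_norm2 S \<le> hs_norm2 T"
  unfolding hs_norm2_def
proof (rule SUP_mono)
  fix F :: "('a \<Rightarrow> complex) set" assume "F \<in> {F. finite F \<and> orthonormal_set F}"
  then show "\<exists>F'\<in>{F. finite F \<and> orthonormal_set F}.
      (\<Sum>e\<in>F. ennreal ((L2_norm lborel (S e))\<^sup>2)) \<le> (\<Sum>e\<in>F'. ennreal ((L2_norm lborel (T e))\<^sup>2))"
    by (intro bexI[of _ F] sum_mono ennreal_leI power_mono assms)
       (auto intro: orthonormal_set_L2)
qed

text \<open>Only the norms of the values enter \<open>hs_norm2\<close>, so an isometry applied after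
  the operator does not change it.\<close>

lemma hs_norm2_cong_norm:
  assumes "\<And>v. v \<in> L2 lborel \<Longrightarrow> L2_norm lborel (S v) = L2_norm lborel (T v)"
  shows "hs_norm2 S = hs_norm2 T"
  by (intro antisym hs_norm2_mono) (simp_all add: assms)

lemma hs_norm2_cong:
  assumes "oper_eq S T" and "\<And>v. v \<in> L2 lborel \<Longrightarrow> S v \<in> L2 lborel"
    and "\<And>v. v \<in> L2 lborel \<Longrightarrow> T v \<in> L2 lborel"
  shows "hs_norm2 S = hs_norm2 T"
  by (intro hs_norm2_cong_norm L2_norm_cong_AE)
     (use assms in \<open>auto simp: oper_eq_def intro: L2_lborel_measurable\<close>)

lemma hs_norm2_scale: "hs_norm2 (\<lambda>v t. c * T v t) = ennreal ((cmod c)\<^sup>2) * hs_norm2 T"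
proof -
  have "{F. finite F \<and> orthonormal_set F} \<noteq> {}"
    by (auto intro!: exI[of _ "{}"] simp: orthonormal_set_def)
  then show ?thesis
    unfolding hs_norm2_def
    by (simp add: L2_norm_scale power_mult_distrib ennreal_mult sum_distrib_left[symmetric]
        SUP_mult_left_ennreal)
qed

lemma hs_norm2_zero [simp]: "hs_norm2 (\<lambda>v t. 0) = 0"
  using hs_norm2_scale[of 0 "\<lambda>v t. 0"] by simp

text \<open>The factor 2 comes from |a + b|^2 \<le> 2|a|^2 + 2|b|^2, summed over an orthonormal set.
  The bound serves only to show that errors are small, so this simple form of the triangle
  inequality is enough.\<close>

lemma hs_norm2_add_le:
  assumes "\<And>v. v \<in> L2 lborel \<Longrightarrow> S v \<in> L2 lborel" "\<And>v. v \<in> L2 lborel \<Longrightarrow> T v \<in> L2 lborel"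
  shows "hs_norm2 (\<lambda>v t. S v t + T v t) \<le> 2 * hs_norm2 S + 2 * hs_norm2 T"
  unfolding hs_norm2_def[of "\<lambda>v t. S v t + T v t"]
proof (rule SUP_least, clarify)
  fix F :: "('a \<Rightarrow> complex) set"
  assume F: "finite F" "orthonormal_set F"
  have "(\<Sum>e\<in>F. ennreal ((L2_norm lborel (\<lambda>t. S e t + T e t))\<^sup>2))
     \<le> (\<Sum>e\<in>F. 2 * ennreal ((L2_norm lborel (S e))\<^sup>2) + 2 * ennreal ((L2_norm lborel (T e))\<^sup>2))"
  proof (rule sum_mono)
    fix e assume "e \<in> F"
    then have "e \<in> L2 lborel" using F by (auto intro: orthonormal_set_L2)
    then have "ennreal ((L2_norm lborel (\<lambda>t. S e t + T e t))\<^sup>2)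
      \<le> ennreal (2 * (L2_norm lborel (S e))\<^sup>2 + 2 * (L2_norm lborel (T e))\<^sup>2)"
      by (intro ennreal_leI L2_norm_add_square_le assms)
    then show "ennreal ((L2_norm lborel (\<lambda>t. S e t + T e t))\<^sup>2)
      \<le> 2 * ennreal ((L2_norm lborel (S e))\<^sup>2) + 2 * ennreal ((L2_norm lborel (T e))\<^sup>2)"
      by (simp add: ennreal_plus ennreal_mult)
  qed
  also have "\<dots> = 2 * (\<Sum>e\<in>F. ennreal ((L2_norm lborel (S e))\<^sup>2))
      + 2 * (\<Sum>e\<in>F. ennreal ((L2_norm lborel (T e))\<^sup>2))"
    by (simp only: sum.distrib sum_distrib_left)
  also have "\<dots> \<le> 2 * hs_norm2 S + 2 * hs_norm2 T"
    unfolding hs_norm2_def using F by (intro add_mono mult_left_mono SUP_upper) auto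
  finally show "(\<Sum>e\<in>F. ennreal ((L2_norm lborel (\<lambda>t. S e t + T e t))\<^sup>2))
      \<le> 2 * hs_norm2 S + 2 * hs_norm2 T" .
qed

lemma hs_norm2_ge_unit:
  assumes "e \<in> L2 lborel" "L2_norm lborel e = 1"
  shows "ennreal ((L2_norm lborel (T e))\<^sup>2) \<le> hs_norm2 T"
proof -
  have "orthonormal_set {e}"
    using assms by (simp add: orthonormal_set_def L2_inner_self)
  then show ?thesis
    unfolding hs_norm2_def by (intro SUP_upper2[of "{e}"]) auto
qed

lemma normalized_unit:
  assumes "v \<in> L2 lborel" "L2_norm lborel v \<noteq> 0"
  shows "L2_norm lborel (\<lambda>t. complex_of_real (1 / L2_norm lborel v) * v t) = 1"
  using assms unfolding L2_norm_scale by (simp add: norm_divide)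

text \<open>The operator norm is at most the Hilbert-Schmidt norm, because v divided by its norm is
  by itself an orthonormal set. A null v cannot be normalised; there \<open>T v\<close> is null
  since \<open>T\<close> respects equality almost everywhere.\<close>

lemma L2_linear_hs_bound:
  assumes T: "L2_linear T" and v: "v \<in> L2 lborel"
  shows "ennreal ((L2_norm lborel (T v))\<^sup>2) \<le> ennreal ((L2_norm lborel v)\<^sup>2) * hs_norm2 T"
proof (cases "L2_norm lborel v = 0")
  case True
  have "AE t in lborel. T v t = 0"
    using L2_linear_cong[OF T v L2_zero L2_norm_zero_AE[OF v True]]
      L2_linear_scale[OF T v, of 0] L2_linear_scale[OF T L2_zero, of 0] by auto
  then show ?thesis by (simp add: L2_norm_eq_0_AE)
next
  case False
  define r where "r = L2_norm lborel v"
  define e where "e = (\<lambda>t. complex_of_real (1 / r) * v t)"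
  have r: "r > 0" using False L2_norm_nonneg[of lborel v] unfolding r_def by linarith
  have e: "e \<in> L2 lborel" "L2_norm lborel e = 1"
    unfolding e_def r_def by (auto simp only: intro!: L2_scale v normalized_unit False)
  have ve: "v = (\<lambda>t. complex_of_real r * e t)" using r by (auto simp: e_def)
  have "L2_norm lborel (T v) = L2_norm lborel (\<lambda>t. complex_of_real r * T e t)"
  proof (rule L2_norm_cong_AE)
    show "AE t in lborel. T v t = complex_of_real r * T e t"
      using L2_linear_scale[OF T e(1), of "complex_of_real r"] unfolding ve[symmetric] .
  qed (intro L2_measurable L2_linear_closed[OF T v] L2_linear_closed[OF T e(1)] L2_scale)+
  then have "(L2_norm lborel (T v))\<^sup>2 = r\<^sup>2 * (L2_norm lborel (T e))\<^sup>2"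
    by (simp add: L2_norm_scale power_mult_distrib)
  then have "ennreal ((L2_norm lborel (T v))\<^sup>2) = ennreal (r\<^sup>2) * ennreal ((L2_norm lborel (T e))\<^sup>2)"
    by (simp add: ennreal_mult)
  also have "\<dots> \<le> ennreal (r\<^sup>2) * hs_norm2 T"
    by (intro mult_left_mono hs_norm2_ge_unit e) auto
  finally show ?thesis by (simp add: r_def)
qed

text \<open>If S annihilates v, then \<open>T v\<close> equals (T - S) v, whose norm is controlled
  by the Hilbert-Schmidt norm of T - S. All passages to Hilbert-Schmidt limits below rest on
  this.\<close>

lemma L2_linear_approx_zero:
  assumes T: "L2_linear T" and v: "v \<in> L2 lborel"
    and small: "\<And>\<epsilon>::real. \<epsilon> > 0 \<Longrightarrow> \<exists>S. L2_linear S \<and> (AE t in lborel. S v t = 0) \<and>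
        hs_norm2 (\<lambda>w t. T w t - S w t) < ennreal \<epsilon>"
  shows "AE t in lborel. T v t = 0"
proof -
  have le: "ennreal ((L2_norm lborel (T v))\<^sup>2) \<le> ennreal 0 + ennreal \<delta>" if "\<delta> > 0" for \<delta>
  proof -
    \<comment> \<open>The summand 1 keeps the quotient meaningful when v has norm 0.\<close>
    define \<epsilon> where "\<epsilon> = \<delta> / (1 + (L2_norm lborel v)\<^sup>2)"
    have pos: "1 + (L2_norm lborel v)\<^sup>2 > 0" by (rule add_pos_nonneg) auto
    then have \<epsilon>: "\<epsilon> > 0" "(L2_norm lborel v)\<^sup>2 * \<epsilon> \<le> \<delta>"
      using that by (auto simp: \<epsilon>_def field_simps)
    obtain S where S: "L2_linear S" "AE t in lborel. S v t = 0"
        "hs_norm2 (\<lambda>w t. T w t - S w t) < ennreal \<epsilon>"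
      using small[OF \<epsilon>(1)] by blast
    have lin: "L2_linear (\<lambda>w t. T w t - S w t)"
      using L2_linear_combination[OF T S(1), of 1 "-1"] by simp
    have "L2_norm lborel (T v) = L2_norm lborel (\<lambda>t. T v t - S v t)"
      using S(2) by (intro L2_norm_cong_AE)
        (auto intro!: L2_lborel_measurable L2_linear_closed[OF T v] L2_linear_closed[OF S(1) v] L2_diff)
    then have "ennreal ((L2_norm lborel (T v))\<^sup>2)
        \<le> ennreal ((L2_norm lborel v)\<^sup>2) * hs_norm2 (\<lambda>w t. T w t - S w t)"
      using L2_linear_hs_bound[OF lin v] by simp
    also have "\<dots> \<le> ennreal ((L2_norm lborel v)\<^sup>2) * ennreal \<epsilon>"
      using S(3) by (intro mult_left_mono) auto
    also have "\<dots> = ennreal ((L2_norm lborel v)\<^sup>2 * \<epsilon>)"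
      using \<epsilon>(1) by (simp add: ennreal_mult)
    also have "\<dots> \<le> ennreal \<delta>" using \<epsilon>(2) by (rule ennreal_leI)
    finally show ?thesis by simp
  qed
  have "ennreal ((L2_norm lborel (T v))\<^sup>2) \<le> ennreal 0"
    by (rule ennreal_le_epsilon) (rule le)
  then have "L2_norm lborel (T v) = 0"
    by (simp add: ennreal_eq_0_iff)
  with L2_linear_closed[OF T v] show ?thesis by (rule L2_norm_zero_AE)
qed

lemma rank_one_linear:
  assumes "\<phi> \<in> L2 lborel" "w \<in> L2 lborel"
  shows "L2_linear (rank_one_oper \<phi> w)"
  unfolding L2_linear_def rank_one_oper_def
proof (intro conjI ballI allI impI)
  fix f g :: "'a \<Rightarrow> complex"
  assume f: "f \<in> L2 lborel" and g: "g \<in> L2 lborel"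
  show "(\<lambda>t. L2_inner lborel f w * \<phi> t) \<in> L2 lborel" by (intro L2_scale assms)
  show "AE t in lborel. L2_inner lborel f w * \<phi> t = L2_inner lborel g w * \<phi> t"
    if "AE t in lborel. f t = g t"
    using L2_inner_cong_left[OF f g assms(2) that] by simp
  fix a b
  have "L2_inner lborel (\<lambda>s. a * f s + b * g s) w = a * L2_inner lborel f w + b * L2_inner lborel g w"
    by (rule L2_inner_lincomb_left[OF f g assms(2)])
  then show "AE t in lborel. L2_inner lborel (\<lambda>s. a * f s + b * g s) w * \<phi> t
      = a * (L2_inner lborel f w * \<phi> t) + b * (L2_inner lborel g w * \<phi> t)"
    by (simp add: algebra_simps)
qed

text \<open>For a unit vector \<open>u\<close> the operators \<open>\<phi> \<otimes> u\<close> are those that annihilate the orthogonal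
  complement of \<open>u\<close>, a condition that evidently survives Hilbert-Schmidt limits.\<close>

lemma tensor_vec_iff:
  assumes u: "u \<in> L2 lborel" "L2_norm lborel u = 1" and T: "L2_linear T"
  shows "T \<in> tensor_vec u \<longleftrightarrow> (\<forall>v\<in>L2 lborel. L2_inner lborel v u = 0 \<longrightarrow> (AE t in lborel. T v t = 0))"
proof
  assume "T \<in> tensor_vec u"
  then obtain \<phi> where "\<phi> \<in> L2 lborel" "oper_eq T (rank_one_oper \<phi> u)"
    by (auto simp: tensor_vec_def)
  then show "\<forall>v\<in>L2 lborel. L2_inner lborel v u = 0 \<longrightarrow> (AE t in lborel. T v t = 0)"
    by (metis (mono_tags, lifting) AE_cong mult_zero_left oper_eq_def rank_one_oper_def)
next
  assume kill: "\<forall>v\<in>L2 lborel. L2_inner lborel v u = 0 \<longrightarrow> (AE t in lborel. T v t = 0)"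
  have uu: "L2_inner lborel u u = 1" using u by (simp add: L2_inner_self)
  have "oper_eq T (rank_one_oper (T u) u)"
    unfolding oper_eq_def rank_one_oper_def
  proof
    fix v :: "'a \<Rightarrow> complex" assume v: "v \<in> L2 lborel"
    let ?c = "L2_inner lborel v u"
    \<comment> \<open>The component of v orthogonal to u. As T annihilates it, \<open>T v\<close> is
      \<open>?c\<close> times \<open>T u\<close>, so \<phi> is \<open>T u\<close>.\<close>
    define w where "w = (\<lambda>t. 1 * v t + (- ?c) * u t)"
    have w: "w \<in> L2 lborel" unfolding w_def by (intro L2_lincomb v u)
    have "L2_inner lborel w u = 0"
      unfolding w_def L2_inner_lincomb_left[OF v u(1) u(1)] uu by simp
    then have "AE t in lborel. T w t = 0" using kill w by blast
    moreover have "AE t in lborel. T w t = 1 * T v t + (- ?c) * T u t"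
      unfolding w_def by (intro L2_linear_lincomb T v u)
    ultimately show "AE t in lborel. T v t = ?c * T u t"
      by eventually_elim simp
  qed
  then show "T \<in> tensor_vec u"
    using T L2_linear_closed[OF T u(1)] by (auto simp: tensor_vec_def)
qed

lemma tensor_vec_cong:
  assumes "T \<in> tensor_vec u" "oper_eq S T" "L2_linear S"
  shows "S \<in> tensor_vec u"
proof -
  obtain \<phi> where "\<phi> \<in> L2 lborel" "oper_eq T (rank_one_oper \<phi> u)"
    using assms(1) by (auto simp: tensor_vec_def)
  with oper_eq_trans[OF assms(2)] assms(3) show ?thesis by (auto simp: tensor_vec_def)
qed

lemma tensor_vec_zero [simp]: "(\<lambda>v t. 0) \<in> tensor_vec u"
proof -
  have "oper_eq (\<lambda>v t. 0) (rank_one_oper (\<lambda>t. 0) u)"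
    by (simp add: rank_one_oper_def)
  then show ?thesis
    unfolding tensor_vec_def using L2_zero[of "lborel :: 'a measure"] L2_linear_zero by blast
qed

text \<open>Vanishing is tested on one vector of the complement of u at a time, and all approximants
  vanish there.\<close>

lemma tensor_vec_approx:
  assumes u: "u \<in> L2 lborel" "L2_norm lborel u = 1" and T: "L2_linear T"
    and small: "\<And>\<epsilon>::real. \<epsilon> > 0 \<Longrightarrow> \<exists>S\<in>tensor_vec u. hs_norm2 (\<lambda>w t. T w t - S w t) < ennreal \<epsilon>"
  shows "T \<in> tensor_vec u"
  unfolding tensor_vec_iff[OF u T]
proof (intro ballI impI L2_linear_approx_zero[OF T])
  fix v :: "'a \<Rightarrow> complex" and \<epsilon> :: real
  assume v: "v \<in> L2 lborel" "L2_inner lborel v u = 0" and "\<epsilon> > 0"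
  then obtain S where S: "S \<in> tensor_vec u" "hs_norm2 (\<lambda>w t. T w t - S w t) < ennreal \<epsilon>"
    using small by blast
  moreover have "L2_linear S" using S(1) by (simp add: tensor_vec_def)
  ultimately show "\<exists>S. L2_linear S \<and> (AE t in lborel. S v t = 0) \<and>
      hs_norm2 (\<lambda>w t. T w t - S w t) < ennreal \<epsilon>"
    using v tensor_vec_iff[OF u] by blast
qed

lemma oper_eq_approx:
  assumes S: "L2_linear S" and T: "L2_linear T"
    and small: "\<And>\<epsilon>::real. \<epsilon> > 0 \<Longrightarrow> hs_norm2 (\<lambda>w t. S w t - T w t) < ennreal \<epsilon>"
  shows "oper_eq S T"
  unfolding oper_eq_def
proof
  fix v :: "'a \<Rightarrow> complex" assume v: "v \<in> L2 lborel"
  have lin: "L2_linear (\<lambda>w t. S w t - T w t)"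
    using L2_linear_combination[OF S T, of 1 "-1"] by simp
  have "AE t in lborel. S v t - T v t = 0"
    \<comment> \<open>The zero operator serves as the approximant of the difference.\<close>
    by (rule L2_linear_approx_zero[OF lin v]) (auto intro!: exI[of _ "\<lambda>v t. 0"] small)
  then show "AE t in lborel. S v t = T v t" by simp
qed

text \<open>Over the line through u, a finite sum of elementary tensors collapses to a single \<phi>
  tensor u, and these operators are closed under Hilbert-Schmidt limits. The closed span therefore
  contains nothing new.\<close>

lemma tensor_space_line:
  assumes u: "u \<in> L2 lborel" "L2_norm lborel u = 1" and T: "hilbert_schmidt T"
    and W: "u \<in> W" "\<And>w. w \<in> W \<Longrightarrow> \<exists>c. w = (\<lambda>t. c * u t)"
  shows "T \<in> tensor_space W \<longleftrightarrow> T \<in> tensor_vec u"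
proof
  have lin: "L2_linear T" using T by (simp add: hilbert_schmidt_def)
  assume T': "T \<in> tensor_vec u"
  then obtain \<phi> where \<phi>: "\<phi> \<in> L2 lborel" "oper_eq T (rank_one_oper \<phi> u)"
    by (auto simp: tensor_vec_def)
  have "hs_norm2 (\<lambda>v t. T v t - (\<Sum>i<(1::nat). rank_one_oper \<phi> u v t)) = hs_norm2 (\<lambda>(v::'a \<Rightarrow> complex) (t::'a). 0)"
  proof (intro hs_norm2_cong)
    show "oper_eq (\<lambda>v t. T v t - (\<Sum>i<(1::nat). rank_one_oper \<phi> u v t)) (\<lambda>v t. 0)"
      using \<phi>(2) by (simp add: oper_eq_def)
  qed (auto intro!: L2_diff L2_linear_closed[OF lin] L2_linear_closed[OF rank_one_linear[OF \<phi>(1) u(1)]])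
  then have "\<exists>(n::nat) \<phi> w. (\<forall>i<n. \<phi> i \<in> L2 lborel \<and> w i \<in> W) \<and>
        hs_norm2 (\<lambda>v t. T v t - (\<Sum>i<n. rank_one_oper (\<phi> i) (w i) v t)) < ennreal \<epsilon>" if "\<epsilon> > 0" for \<epsilon>
    using W(1) \<phi>(1) that
    by (intro exI[of _ "1::nat"] exI[of _ "\<lambda>_. \<phi>"] exI[of _ "\<lambda>_. u"]) simp
  then show "T \<in> tensor_space W"
    unfolding tensor_space_def using T by blast
next
  have lin: "L2_linear T" using T by (simp add: hilbert_schmidt_def)
  assume T': "T \<in> tensor_space W"
  show "T \<in> tensor_vec u"
  proof (rule tensor_vec_approx[OF u lin])
    fix \<epsilon> :: real assume "\<epsilon> > 0"
    have "\<forall>\<epsilon>>0. \<exists>(n::nat) \<phi> w. (\<forall>i<n. \<phi> i \<in> L2 lborel \<and> w i \<in> W) \<and>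
        hs_norm2 (\<lambda>v t. T v t - (\<Sum>i<n. rank_one_oper (\<phi> i) (w i) v t)) < ennreal \<epsilon>"
      using T' by (simp add: tensor_space_def)
    from this[rule_format, OF \<open>\<epsilon> > 0\<close>] obtain n :: nat and \<phi> w
      where nw: "\<forall>i<n. \<phi> i \<in> L2 lborel \<and> w i \<in> W"
        "hs_norm2 (\<lambda>v t. T v t - (\<Sum>i<n. rank_one_oper (\<phi> i) (w i) v t)) < ennreal \<epsilon>"
      by (elim exE conjE) (rule that)
    note * = nw(1)[rule_format, THEN conjunct1] nw(1)[rule_format, THEN conjunct2] nw(2)
    have "\<forall>i\<in>{..<n}. \<exists>c. w i = (\<lambda>t. c * u t)" using W(2)[OF *(2)] by simp
    from bchoice[OF this] obtain c where c: "\<And>i. i < n \<Longrightarrow> w i = (\<lambda>t. c i * u t)"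
      by auto
    \<comment> \<open>The scalars are conjugated because the tensor is antilinear in its second
      factor.\<close>
    let ?\<psi> = "\<lambda>t. \<Sum>i<n. cnj (c i) * \<phi> i t"
    have "(\<lambda>v t. \<Sum>i<n. rank_one_oper (\<phi> i) (w i) v t) = rank_one_oper ?\<psi> u"
      using c by (intro ext) (simp add: rank_one_oper_def L2_inner_scale_right sum_distrib_left mult_ac)
    moreover have \<psi>: "?\<psi> \<in> L2 lborel" by (intro L2_sum L2_scale) (use *(1) in simp)
    ultimately have "(\<lambda>v t. \<Sum>i<n. rank_one_oper (\<phi> i) (w i) v t) \<in> tensor_vec u"
      unfolding tensor_vec_def using rank_one_linear[OF \<psi> u(1)]
      by (simp del: split_paired_Ex) (use \<psi> oper_eq_refl in blast)
    then show "\<exists>S\<in>tensor_vec u. hs_norm2 (\<lambda>w t. T w t - S w t) < ennreal \<epsilon>"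
      by (rule bexI[where x = "\<lambda>v t. \<Sum>i<n. rank_one_oper (\<phi> i) (w i) v t", rotated]) (fact *(3))
  qed
qed

section \<open>Transformations that multiply a measure by a constant\<close>

text \<open>A bimeasurable bijection with constant Jacobian: c is the factor by which \<tau>
  enlarges sets, so the integral of f is c times that of f o \<tau>, and f \<mapsto> sqrt c (f o
  \<tau>) is unitary on L2. Translations, shears and dilations, on Euclidean space, on the group and
  on the parameters, are all treated through this one notion.\<close>

definition scales :: "'a measure \<Rightarrow> ('a \<Rightarrow> 'a) \<Rightarrow> real \<Rightarrow> bool" where
  "scales M \<tau> c \<longleftrightarrow> c > 0 \<and> \<tau> \<in> measurable M M \<and>
     (\<exists>\<rho>\<in>measurable M M. \<forall>x. \<tau> (\<rho> x) = x \<and> \<rho> (\<tau> x) = x) \<and>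
     (\<forall>A\<in>sets M. emeasure M A = ennreal c * emeasure M (\<tau> -` A \<inter> space M))"

lemma scales_measurable: "scales M \<tau> c \<Longrightarrow> \<tau> \<in> measurable M M"
  by (simp add: scales_def)

lemma scales_pos: "scales M \<tau> c \<Longrightarrow> c > 0"
  by (simp add: scales_def)

lemma scalesI:
  assumes "c > 0" "\<tau> \<in> measurable M M" "\<rho> \<in> measurable M M" "\<And>x. \<tau> (\<rho> x) = x" "\<And>x. \<rho> (\<tau> x) = x"
    and "\<And>A. A \<in> sets M \<Longrightarrow> emeasure M A = ennreal c * emeasure M (\<tau> -` A \<inter> space M)"
  shows "scales M \<tau> c"
  unfolding scales_def using assms(1-5) by (intro conjI ballI assms(6)) auto

lemma scalesE:
  assumes "scales M \<tau> c"
  obtains \<rho> where "\<rho> \<in> measurable M M" "\<And>x. \<tau> (\<rho> x) = x" "\<And>x. \<rho> (\<tau> x) = x"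
  using assms unfolding scales_def by blast

lemma scales_emeasure:
  "scales M \<tau> c \<Longrightarrow> A \<in> sets M \<Longrightarrow> emeasure M A = ennreal c * emeasure M (\<tau> -` A \<inter> space M)"
  unfolding scales_def by blast

text \<open>Restates the scaling as an equality of measures, which opens the change of variables to
  the rules for \<open>density\<close> and \<open>distr\<close>.\<close>

lemma scales_density:
  assumes "scales M \<tau> c"
  shows "M = density (distr M M \<tau>) (\<lambda>_. ennreal c)"
proof (rule measure_eqI)
  fix A assume A: "A \<in> sets M"
  then show "emeasure M A = emeasure (density (distr M M \<tau>) (\<lambda>_. ennreal c)) A"
    using scales_emeasure[OF assms A] scales_measurable[OF assms]
    by (simp add: emeasure_density_const emeasure_distr)
qed simp

lemma scales_AE:
  assumes "scales M \<tau> c" "AE x in M. P x"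
  shows "AE x in M. P (\<tau> x)"
proof -
  from assms(2) have "AE x in density (distr M M \<tau>) (\<lambda>_. ennreal c). P x"
    using scales_density[OF assms(1)] by metis
  then have "AE x in distr M M \<tau>. P x"
    using scales_pos[OF assms(1)] by (simp add: AE_density)
  then show ?thesis
    by (rule AE_distrD[OF scales_measurable[OF assms(1)]])
qed

lemma scales_nn_integral:
  assumes "scales M \<tau> c" and [measurable]: "f \<in> borel_measurable M"
  shows "(\<integral>\<^sup>+x. f x \<partial>M) = ennreal c * (\<integral>\<^sup>+x. f (\<tau> x) \<partial>M)"
proof -
  note [measurable] = scales_measurable[OF assms(1)]
  have "(\<integral>\<^sup>+x. f x \<partial>M) = (\<integral>\<^sup>+x. f x \<partial>density (distr M M \<tau>) (\<lambda>_. ennreal c))"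
    using scales_density[OF assms(1)] by simp
  then show ?thesis
    by (simp add: nn_integral_density nn_integral_distr nn_integral_cmult)
qed

text \<open>The measurable inverse \<rho> is what recovers measurability of f from that of f o
  \<tau>.\<close>

lemma scales_borel_measurable_iff:
  assumes "scales M \<tau> c"
  shows "(\<lambda>x. f (\<tau> x)) \<in> measurable M N \<longleftrightarrow> f \<in> measurable M N"
proof
  obtain \<rho> where \<rho>: "\<rho> \<in> measurable M M" "\<And>x. \<tau> (\<rho> x) = x" "\<And>x. \<rho> (\<tau> x) = x"
    by (rule scalesE[OF assms]) (rule that)
  show "f \<in> measurable M N" if "(\<lambda>x. f (\<tau> x)) \<in> measurable M N"
    using measurable_compose[OF \<rho>(1) that] \<rho>(2) by simp
  show "(\<lambda>x. f (\<tau> x)) \<in> measurable M N" if "f \<in> measurable M N"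
    using measurable_compose[OF scales_measurable[OF assms] that] .
qed

lemma scales_integrable_iff:
  fixes f :: "'a \<Rightarrow> 'b :: {banach, second_countable_topology}"
  assumes "scales M \<tau> c"
  shows "integrable M (\<lambda>x. f (\<tau> x)) \<longleftrightarrow> integrable M f"
proof (cases "f \<in> borel_measurable M")
  case [measurable]: True
  have "(\<integral>\<^sup>+x. ennreal (norm (f x)) \<partial>M) = ennreal c * (\<integral>\<^sup>+x. ennreal (norm (f (\<tau> x))) \<partial>M)"
    by (rule scales_nn_integral[OF assms]) simp
  moreover have "(\<lambda>x. f (\<tau> x)) \<in> borel_measurable M"
    using True scales_borel_measurable_iff[OF assms] by blast
  ultimately show ?thesis
    using scales_pos[OF assms] True
    by (auto simp: integrable_iff_bounded ennreal_mult_less_top)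
next
  case False
  then show ?thesis
    using scales_borel_measurable_iff[OF assms, of f borel] by (auto dest: borel_measurable_integrable)
qed

text \<open>Holds for arbitrary f: if f is not measurable, then neither f nor f o \<tau> is
  integrable, and both integrals have the default value 0.\<close>

lemma scales_integral:
  fixes f :: "'a \<Rightarrow> 'b :: {banach, second_countable_topology}"
  assumes "scales M \<tau> c"
  shows "(LINT x|M. f x) = c *\<^sub>R (LINT x|M. f (\<tau> x))"
proof (cases "f \<in> borel_measurable M")
  case [measurable]: True
  note [measurable] = scales_measurable[OF assms]
  have "(LINT x|M. f x) = (LINT x|density (distr M M \<tau>) (\<lambda>_. ennreal c). f x)"
    using scales_density[OF assms] by simp
  then show ?thesis
    using scales_pos[OF assms] by (simp add: integral_density integral_distr)
next
  case False
  then have "\<not> integrable M f" by auto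
  then show ?thesis
    using scales_integrable_iff[OF assms, of f] by (simp add: not_integrable_integral_eq)
qed

lemma scales_compose:
  assumes "scales M \<tau> c" "scales M \<tau>' c'"
  shows "scales M (\<lambda>x. \<tau> (\<tau>' x)) (c * c')"
proof -
  obtain \<rho> where \<rho>: "\<rho> \<in> measurable M M" "\<And>x. \<tau> (\<rho> x) = x" "\<And>x. \<rho> (\<tau> x) = x"
    by (rule scalesE[OF assms(1)]) (rule that)
  obtain \<rho>' where \<rho>': "\<rho>' \<in> measurable M M" "\<And>x. \<tau>' (\<rho>' x) = x" "\<And>x. \<rho>' (\<tau>' x) = x"
    by (rule scalesE[OF assms(2)]) (rule that)
  note [measurable] = scales_measurable[OF assms(1)] scales_measurable[OF assms(2)] \<rho>(1) \<rho>'(1)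
  show ?thesis
  proof (rule scalesI[where \<rho> = "\<lambda>x. \<rho>' (\<rho> x)"])
    fix A assume A: "A \<in> sets M"
    then have "\<tau> -` A \<inter> space M \<in> sets M" by measurable
    then have "emeasure M A = ennreal c * (ennreal c' * emeasure M (\<tau>' -` (\<tau> -` A \<inter> space M) \<inter> space M))"
      using scales_emeasure[OF assms(1) A] scales_emeasure[OF assms(2)] by metis
    also have "\<tau>' -` (\<tau> -` A \<inter> space M) \<inter> space M = (\<lambda>x. \<tau> (\<tau>' x)) -` A \<inter> space M"
      using measurable_space[OF scales_measurable[OF assms(2)]] by auto
    finally show "emeasure M A = ennreal (c * c') * emeasure M ((\<lambda>x. \<tau> (\<tau>' x)) -` A \<inter> space M)"
      using scales_pos[OF assms(1)] scales_pos[OF assms(2)] by (simp add: ennreal_mult mult.assoc)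
  qed (use \<rho> \<rho>' scales_pos[OF assms(1)] scales_pos[OF assms(2)] in auto)
qed

lemma scales_id: "scales M (\<lambda>x. x) 1"
  by (rule scalesI[where \<rho> = "\<lambda>x. x"]) auto

text \<open>Conjugation by a measurable isomorphism keeps the factor. With
  \<open>coord_map G\<close> as \<Phi> it carries facts on Lebesgue measure over to the Haar
  measure.\<close>

lemma scales_distr:
  assumes sc: "scales M \<tau> c" and [measurable]: "\<Phi> \<in> measurable M N" "\<Psi> \<in> measurable N M"
    and inv: "\<And>x. \<Psi> (\<Phi> x) = x" "\<And>y. \<Phi> (\<Psi> y) = y"
  shows "scales (distr M N \<Phi>) (\<lambda>y. \<Phi> (\<tau> (\<Psi> y))) c"
proof -
  obtain \<rho> where \<rho>: "\<rho> \<in> measurable M M" "\<And>x. \<tau> (\<rho> x) = x" "\<And>x. \<rho> (\<tau> x) = x"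
    by (rule scalesE[OF sc]) (rule that)
  note [measurable] = scales_measurable[OF sc] \<rho>(1)
  show ?thesis
  proof (rule scalesI[where \<rho> = "\<lambda>y. \<Phi> (\<rho> (\<Psi> y))"])
    fix A assume "A \<in> sets (distr M N \<Phi>)"
    then have A[measurable]: "A \<in> sets N" by simp
    have 1: "\<Phi> -` A \<inter> space M \<in> sets M" by measurable
    have "(\<lambda>y. \<Phi> (\<tau> (\<Psi> y))) -` A \<inter> space N \<in> sets N" by measurable
    then have "emeasure (distr M N \<Phi>) ((\<lambda>y. \<Phi> (\<tau> (\<Psi> y))) -` A \<inter> space N)
        = emeasure M (\<Phi> -` ((\<lambda>y. \<Phi> (\<tau> (\<Psi> y))) -` A \<inter> space N) \<inter> space M)"
      by (intro emeasure_distr) auto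
    also have "\<Phi> -` ((\<lambda>y. \<Phi> (\<tau> (\<Psi> y))) -` A \<inter> space N) \<inter> space M = \<tau> -` (\<Phi> -` A \<inter> space M) \<inter> space M"
      using inv measurable_space[OF assms(2)] measurable_space[OF scales_measurable[OF sc]] by auto
    finally show "emeasure (distr M N \<Phi>) A =
        ennreal c * emeasure (distr M N \<Phi>) ((\<lambda>y. \<Phi> (\<tau> (\<Psi> y))) -` A \<inter> space (distr M N \<Phi>))"
      using scales_emeasure[OF sc 1] by (simp add: emeasure_distr)
  qed (use inv \<rho> scales_pos[OF sc] in auto)
qed

section \<open>Dilations, translations, shears and products for Lebesgue measure\<close>

lemma scales_lborel_scaleR:
  assumes "s > 0"
  shows "scales lborel (\<lambda>x::'a::euclidean_space. s *\<^sub>R x) (s ^ DIM('a))"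
proof (rule scalesI[where \<rho> = "\<lambda>x. inverse s *\<^sub>R x"])
  fix A :: "'a set" assume A: "A \<in> sets lborel"
  have "emeasure lborel A = emeasure (density (distr lborel borel (\<lambda>x. 0 + s *\<^sub>R x)) (\<lambda>_. ennreal (\<bar>s\<bar> ^ DIM('a)))) A"
    using assms by (subst lborel_affine[of s "0::'a"]) simp_all
  then show "emeasure lborel A = ennreal (s ^ DIM('a)) * emeasure lborel ((*\<^sub>R) s -` A \<inter> space lborel)"
    using A assms by (simp add: emeasure_density_const emeasure_distr)
qed (use assms in auto)

lemma scales_lborel_translation: "scales lborel (\<lambda>x::'a::euclidean_space. t + x) 1"
proof (rule scalesI[where \<rho> = "\<lambda>x. - t + x"])
  fix A :: "'a set" assume A: "A \<in> sets lborel"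
  have "emeasure lborel A = emeasure (distr lborel borel ((+) t)) A"
    by (simp add: lborel_distr_plus)
  then show "emeasure lborel A = ennreal 1 * emeasure lborel ((+) t -` A \<inter> space lborel)"
    using A by (simp add: emeasure_distr)
qed auto

lemma lborel_prod_emeasure:
  fixes A :: "('a::euclidean_space \<times> 'b::euclidean_space) set"
  assumes "A \<in> sets borel"
  shows "emeasure lborel A = (\<integral>\<^sup>+y. (\<integral>\<^sup>+x. indicator A (x, y) \<partial>lborel) \<partial>lborel)"
proof -
  have A: "A \<in> sets (lborel \<Otimes>\<^sub>M lborel)" using assms by (simp only: lborel_prod sets_lborel)
  have "emeasure lborel A = (\<integral>\<^sup>+p. indicator A p \<partial>(lborel \<Otimes>\<^sub>M lborel))"
    using A by (simp add: lborel_prod nn_integral_indicator[OF A, unfolded lborel_prod] del: nn_integral_indicator)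
  also have "\<dots> = (\<integral>\<^sup>+y. (\<integral>\<^sup>+x. indicator A (x, y) \<partial>lborel) \<partial>lborel)"
    by (rule lborel_pair.nn_integral_snd[symmetric]) (use A in measurable)
  finally show ?thesis .
qed

text \<open>On each slice with the second coordinate fixed the shear is a translation, so Tonelli
  and translation invariance give the factor 1.\<close>

lemma scales_lborel_shear:
  fixes h :: "'b::euclidean_space \<Rightarrow> 'a::euclidean_space"
  assumes [measurable]: "h \<in> borel_measurable borel"
  shows "scales lborel (\<lambda>(a, b). (a + h b, b)) 1"
proof (rule scalesI[where \<rho> = "\<lambda>(a, b). (a - h b, b)"])
  show m: "(\<lambda>(a, b). (a + h b, b)) \<in> lborel \<rightarrow>\<^sub>M lborel" "(\<lambda>(a, b). (a - h b, b)) \<in> lborel \<rightarrow>\<^sub>M lborel"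
    by (simp_all only: measurable_lborel2 measurable_lborel1 borel_prod[symmetric]) measurable
  fix A :: "('a \<times> 'b) set" assume A: "A \<in> sets lborel"
  then have A': "A \<in> sets (borel \<Otimes>\<^sub>M borel)" by (simp only: borel_prod sets_lborel)
  have inner: "(\<integral>\<^sup>+x. indicator A (x, y) \<partial>lborel) = (\<integral>\<^sup>+x. indicator A (x + h y, y) \<partial>lborel)" for y
    using scales_nn_integral[OF scales_lborel_translation[of "h y"], of "\<lambda>x. indicator A (x, y)"] A'
    by (simp add: add.commute)
  have "emeasure lborel ((\<lambda>(a, b). (a + h b, b)) -` A \<inter> space lborel)
      = (\<integral>\<^sup>+y. (\<integral>\<^sup>+x. indicator A (x + h y, y) \<partial>lborel) \<partial>lborel)"
    using measurable_sets[OF m(1) A]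
    by (subst lborel_prod_emeasure) (auto simp: indicator_def)
  then show "emeasure lborel A = ennreal 1 * emeasure lborel ((\<lambda>(a, b). (a + h b, b)) -` A \<inter> space lborel)"
    using A by (simp add: lborel_prod_emeasure inner)
qed auto

lemma scales_lborel_prod:
  fixes \<tau>1 :: "'a::euclidean_space \<Rightarrow> 'a" and \<tau>2 :: "'b::euclidean_space \<Rightarrow> 'b"
  assumes s1: "scales lborel \<tau>1 c1" and s2: "scales lborel \<tau>2 c2"
  shows "scales lborel (\<lambda>(a, b). (\<tau>1 a, \<tau>2 b)) (c1 * c2)"
proof -
  obtain \<rho>1 where \<rho>1: "\<rho>1 \<in> measurable lborel lborel" "\<And>x. \<tau>1 (\<rho>1 x) = x" "\<And>x. \<rho>1 (\<tau>1 x) = x"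
    by (rule scalesE[OF s1]) (rule that)
  obtain \<rho>2 where \<rho>2: "\<rho>2 \<in> measurable lborel lborel" "\<And>x. \<tau>2 (\<rho>2 x) = x" "\<And>x. \<rho>2 (\<tau>2 x) = x"
    by (rule scalesE[OF s2]) (rule that)
  have [measurable]: "\<tau>1 \<in> borel_measurable borel" "\<tau>2 \<in> borel_measurable borel"
      "\<rho>1 \<in> borel_measurable borel" "\<rho>2 \<in> borel_measurable borel"
    using scales_measurable[OF s1] scales_measurable[OF s2] \<rho>1(1) \<rho>2(1) by simp_all
  show ?thesis
  proof (rule scalesI[where \<rho> = "\<lambda>(a, b). (\<rho>1 a, \<rho>2 b)"])
    show m: "(\<lambda>(a, b). (\<tau>1 a, \<tau>2 b)) \<in> lborel \<rightarrow>\<^sub>M lborel" "(\<lambda>(a, b). (\<rho>1 a, \<rho>2 b)) \<in> lborel \<rightarrow>\<^sub>M lborel"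
      by (simp_all only: measurable_lborel2 measurable_lborel1 borel_prod[symmetric]) measurable
    fix A :: "('a \<times> 'b) set" assume A: "A \<in> sets lborel"
    then have A': "A \<in> sets (borel \<Otimes>\<^sub>M borel)" by (simp only: borel_prod sets_lborel)
    have [measurable]: "A \<in> sets (lborel \<Otimes>\<^sub>M lborel)" using A by (simp only: lborel_prod)
    have [measurable]: "(\<lambda>y. \<integral>\<^sup>+x. indicator A (x, y) \<partial>lborel) \<in> borel_measurable lborel"
        "(\<lambda>y. \<integral>\<^sup>+x. indicator A (\<tau>1 x, y) \<partial>lborel) \<in> borel_measurable lborel"
        "(\<lambda>y. \<integral>\<^sup>+x. indicator A (\<tau>1 x, \<tau>2 y) \<partial>lborel) \<in> borel_measurable lborel"
      by measurable
    have inner: "(\<integral>\<^sup>+x. indicator A (x, y) \<partial>lborel) = ennreal c1 * (\<integral>\<^sup>+x. indicator A (\<tau>1 x, y) \<partial>lborel)" for y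
      using A' by (intro scales_nn_integral[OF s1]) simp
    have "emeasure lborel A = (\<integral>\<^sup>+y. ennreal c1 * (\<integral>\<^sup>+x. indicator A (\<tau>1 x, y) \<partial>lborel) \<partial>lborel)"
      using A by (simp add: lborel_prod_emeasure inner)
    also have "\<dots> = ennreal c1 * (\<integral>\<^sup>+y. (\<integral>\<^sup>+x. indicator A (\<tau>1 x, y) \<partial>lborel) \<partial>lborel)"
      by (rule nn_integral_cmult) measurable
    also have "(\<integral>\<^sup>+y. (\<integral>\<^sup>+x. indicator A (\<tau>1 x, y) \<partial>lborel) \<partial>lborel)
        = ennreal c2 * (\<integral>\<^sup>+y. (\<integral>\<^sup>+x. indicator A (\<tau>1 x, \<tau>2 y) \<partial>lborel) \<partial>lborel)"
      by (rule scales_nn_integral[OF s2]) measurable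
    also have "(\<integral>\<^sup>+y. (\<integral>\<^sup>+x. indicator A (\<tau>1 x, \<tau>2 y) \<partial>lborel) \<partial>lborel)
        = emeasure lborel ((\<lambda>(a, b). (\<tau>1 a, \<tau>2 b)) -` A \<inter> space lborel)"
      using measurable_sets[OF m(1) A] by (subst lborel_prod_emeasure) (auto simp: indicator_def)
    finally show "emeasure lborel A
        = ennreal (c1 * c2) * emeasure lborel ((\<lambda>(a, b). (\<tau>1 a, \<tau>2 b)) -` A \<inter> space lborel)"
      using scales_pos[OF s1] scales_pos[OF s2] by (simp add: ennreal_mult mult.assoc)
  qed (use \<rho>1 \<rho>2 scales_pos[OF s1] scales_pos[OF s2] in auto)
qed

lemma scales_L2_iff:
  assumes "scales M \<tau> c"
  shows "(\<lambda>x. f (\<tau> x)) \<in> L2 M \<longleftrightarrow> f \<in> L2 M"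
  using scales_borel_measurable_iff[OF assms, of f] scales_integrable_iff[OF assms, of "\<lambda>x. (cmod (f x))\<^sup>2"]
  by (simp add: L2_def)

lemma scales_L2_norm:
  assumes "scales M \<tau> c"
  shows "L2_norm M (\<lambda>x. complex_of_real (sqrt c) * f (\<tau> x)) = L2_norm M f"
  unfolding L2_norm_scale
  using scales_integral[OF assms, of "\<lambda>x. (cmod (f x))\<^sup>2"] scales_pos[OF assms]
  by (simp add: L2_norm_def real_sqrt_mult)

lemma scales_L2_inner:
  assumes "scales M \<tau> c"
  shows "L2_inner M (\<lambda>x. complex_of_real (sqrt c) * f (\<tau> x)) (\<lambda>x. complex_of_real (sqrt c) * g (\<tau> x))
    = L2_inner M f g"
proof -
  have "complex_of_real (sqrt c) * complex_of_real (sqrt c) = complex_of_real c"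
    using scales_pos[OF assms] by (simp flip: of_real_mult)
  then show ?thesis
    using scales_integral[OF assms, of "\<lambda>x. f x * cnj (g x)"]
    by (simp add: L2_inner_scale_left L2_inner_scale_right mult.assoc[symmetric])
       (simp add: L2_inner_def scaleR_conv_of_real)
qed

section \<open>Coordinates on the group\<close>

context nil_setting
begin

abbreviation "br \<equiv> bracket G"

lemma br_bilinear: "bilinear br"
  using lie by (simp add: lie_algebra_def)

lemmas br_simps = bilinear_ladd[OF br_bilinear] bilinear_radd[OF br_bilinear]
  bilinear_lmul[OF br_bilinear] bilinear_rmul[OF br_bilinear]

lemma br_self [simp]: "br x x = 0"
  using lie by (simp add: lie_algebra_def)

lemma br_antisym: "br y x = - br x y"
proof -
  have "br x y + br y x = br (x + y) (x + y)" by (simp only: br_simps) simp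
  then show ?thesis by (simp add: eq_neg_iff_add_eq_0 add.commute)
qed

section \<open>The dual basis and the matrix B(l)\<close>

lemma dual_basis_exists:
  "\<exists>\<kappa>. \<forall>b. linear (\<kappa> b) \<and> (\<forall>b'. \<kappa> b (basis_vec G b') = (if b' = b then 1 else 0 :: real))"
proof (rule choice, rule allI)
  fix b
  obtain h :: "'g \<Rightarrow> real" where "linear h"
    "\<forall>x\<in>range (basis_vec G). h x = (if inv_into UNIV (basis_vec G) x = b then 1 else 0)"
    using linear_independent_extend[OF basis_independent,
        of "\<lambda>x. if inv_into UNIV (basis_vec G) x = b then 1 else 0"] by auto
  then show "\<exists>h. linear h \<and> (\<forall>b'. h (basis_vec G b') = (if b' = b then 1 else 0 :: real))"
    using basis_inj by (intro exI[of _ h]) simp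
qed

definition dual_basis :: "'z + 'd + 'd \<Rightarrow> 'g \<Rightarrow> real" where
  "dual_basis = (SOME \<kappa>. \<forall>b. linear (\<kappa> b) \<and> (\<forall>b'. \<kappa> b (basis_vec G b') = (if b' = b then 1 else 0)))"

lemma linear_dual_basis: "linear (dual_basis b)"
  and dual_basis_basis_vec: "dual_basis b (basis_vec G b') = (if b' = b then 1 else 0)"
  using someI_ex[OF dual_basis_exists] unfolding dual_basis_def by auto

lemma dual_basis_simps [simp]:
  "dual_basis b (Zvec G k) = (if b = Inl k then 1 else 0)"
  "dual_basis b (Yvec G i) = (if b = Inr (Inl i) then 1 else 0)"
  "dual_basis b (Xvec G i) = (if b = Inr (Inr i) then 1 else 0)"
  using dual_basis_basis_vec[of b "Inl k"] dual_basis_basis_vec[of b "Inr (Inl i)"]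
    dual_basis_basis_vec[of b "Inr (Inr i)"] by (auto simp: basis_vec_def)

lemma range_basis_vec: "range (basis_vec G) = range (Zvec G) \<union> range (Yvec G) \<union> range (Xvec G)"
  unfolding basis_vec_def UNIV_sum image_Un image_image by (simp add: Un_assoc)

lemma linear_eq_on_basis:
  fixes h h' :: "'g \<Rightarrow> 'v::real_vector"
  assumes "linear h" "linear h'" "\<And>k. h (Zvec G k) = h' (Zvec G k)"
    "\<And>i. h (Yvec G i) = h' (Yvec G i)" "\<And>i. h (Xvec G i) = h' (Xvec G i)"
  shows "h = h'"
proof
  fix x
  show "h x = h' x"
    by (rule linear_eq_on_span[OF assms(1,2), of "range (basis_vec G)"])
       (use assms(3-5) basis_span in \<open>auto simp: range_basis_vec\<close>)
qed

lemma linear_sum_dual: "linear (\<lambda>v. \<Sum>k\<in>A. l k * dual_basis (f k) v)"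
  by (intro linear_compose_sum ballI linear_compose[OF linear_dual_basis, unfolded o_def])
     (auto intro: linearI simp: algebra_simps)

text \<open>A linear map is determined by its values on the basis, so exactly one map fits the
  description in \<open>functional\<close>. Written with the dual basis, its linear dependence on l
  becomes visible.\<close>

lemma functional_eq: "functional G l = (\<lambda>v. \<Sum>k\<in>UNIV. l $ k * dual_basis (Inl k) v)"
  unfolding functional_def
proof (rule the_equality)
  show "linear (\<lambda>v. \<Sum>k\<in>UNIV. l $ k * dual_basis (Inl k) v) \<and>
      (\<forall>k. (\<Sum>k'\<in>UNIV. l $ k' * dual_basis (Inl k') (Zvec G k)) = l $ k) \<and>
      (\<forall>i. (\<Sum>k\<in>UNIV. l $ k * dual_basis (Inl k) (Yvec G i)) = 0) \<and>
      (\<forall>i. (\<Sum>k\<in>UNIV. l $ k * dual_basis (Inl k) (Xvec G i)) = 0)"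
    by (auto simp: linear_sum_dual if_distrib cong: if_cong)
qed (rule linear_eq_on_basis, auto simp: linear_sum_dual if_distrib cong: if_cong)

lemma Bmat_eq: "Bmat G l $ i $ j = (\<Sum>k\<in>UNIV. l $ k * dual_basis (Inl k) (br (Xvec G i) (Yvec G j)))"
  by (simp add: Bmat_def functional_eq)

lemma Bmat_scale: "Bmat G (c *\<^sub>R l) = c *\<^sub>R Bmat G l"
  by (simp add: vec_eq_iff Bmat_eq sum_distrib_left mult.assoc)

text \<open>Each of the d rows contributes one factor c. Hence \<open>Sigma_set G\<close> is
  invariant under nonzero dilations, and the density of the Plancherel measure is homogeneous of
  degree d under positive ones.\<close>

lemma det_Bmat_scale: "det (Bmat G (c *\<^sub>R l)) = c ^ CARD('d) * det (Bmat G l)"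
proof -
  have "Bmat G (c *\<^sub>R l) = (\<chi> i. c *s (Bmat G l $ i))"
    by (simp add: Bmat_scale vec_eq_iff)
  then show ?thesis by (simp add: det_rows_mul[of "\<lambda>_. c" "\<lambda>i. Bmat G l $ i"])
qed

lemma det_Bmat_measurable [measurable]: "(\<lambda>l. det (Bmat G l)) \<in> borel_measurable borel"
  unfolding det_def Bmat_eq
  by (intro borel_measurable_continuous_onI continuous_intros)

lemma Sigma_set_measurable [measurable]: "Sigma_set G \<in> sets borel"
proof -
  have "Sigma_set G = (\<lambda>l. det (Bmat G l)) -` (- {0}) \<inter> space borel"
    by (auto simp: Sigma_set_def)
  also have "\<dots> \<in> sets borel" by measurable
  finally show ?thesis .
qed

lemma Sigma_set_scale: "c \<noteq> 0 \<Longrightarrow> c *\<^sub>R l \<in> Sigma_set G \<longleftrightarrow> l \<in> Sigma_set G"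
  by (simp add: Sigma_set_def det_Bmat_scale)

text \<open>Index types are nonempty, so the determinant is homogeneous of positive degree and
  vanishes at 0. Points of \<open>Sigma_set G\<close> thus have positive maximum norm, which gives
  them a dyadic index.\<close>

lemma zero_notin_Sigma_set: "0 \<notin> Sigma_set G"
proof -
  have "CARD('d) \<noteq> 0" by simp
  then show ?thesis using det_Bmat_scale[of 0 0] by (simp add: Sigma_set_def power_0_left)
qed

section \<open>The group law in coordinates\<close>

definition zpart :: "(real, 'z) vec \<Rightarrow> 'g" where "zpart z = (\<Sum>l\<in>UNIV. z $ l *\<^sub>R Zvec G l)"
definition ypart :: "(real, 'd) vec \<Rightarrow> 'g" where "ypart y = (\<Sum>l\<in>UNIV. y $ l *\<^sub>R Yvec G l)"
definition xpart :: "(real, 'd) vec \<Rightarrow> 'g" where "xpart x = (\<Sum>l\<in>UNIV. x $ l *\<^sub>R Xvec G l)"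

lemma linear_parts: "linear zpart" "linear ypart" "linear xpart"
  unfolding zpart_def ypart_def xpart_def
  by (auto intro!: linearI simp: scaleR_add_left sum.distrib scaleR_sum_right)

lemma parts_in_span:
  "zpart z \<in> span (range (Zvec G))" "ypart y \<in> span (range (Yvec G))" "xpart x \<in> span (range (Xvec G))"
  unfolding zpart_def ypart_def xpart_def by (auto intro!: span_sum span_scale intro: span_base)

lemma parts_in_za:
  "zpart z \<in> span (range (Zvec G) \<union> range (Yvec G))" "ypart y \<in> span (range (Zvec G) \<union> range (Yvec G))"
  using parts_in_span(1)[of z] parts_in_span(2)[of y]
    span_mono[of "range (Zvec G)" "range (Zvec G) \<union> range (Yvec G)"]
    span_mono[of "range (Yvec G)" "range (Zvec G) \<union> range (Yvec G)"] by auto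

lemma br_zpart [simp]: "br (zpart z) v = 0" "br v (zpart z) = 0"
proof -
  have "zpart z \<in> lie_center br" using parts_in_span(1) by (simp add: center)
  then show "br (zpart z) v = 0" "br v (zpart z) = 0"
    using br_antisym[of "zpart z" v] by (simp_all add: lie_center_def)
qed

lemma br_ypart_ypart [simp]: "br (ypart y) (ypart y') = 0"
  using za_commutative parts_in_za by (simp add: lie_commutative_on_def)

lemma br_xpart_xpart [simp]: "br (xpart x) (xpart x') = 0"
  using b_commutative parts_in_span(3) by (simp add: lie_commutative_on_def)

definition algebra_coords :: "'g \<Rightarrow> ((real, 'z) vec) \<times> ((real, 'd) vec) \<times> ((real, 'd) vec)" where
  "algebra_coords v = ((\<chi> k. dual_basis (Inl k) v), (\<chi> i. dual_basis (Inr (Inl i)) v),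
     (\<chi> i. dual_basis (Inr (Inr i)) v))"

lemma dual_parts [simp]:
  "dual_basis b (zpart z) = (case b of Inl k \<Rightarrow> z $ k | _ \<Rightarrow> 0)"
  "dual_basis b (ypart y) = (case b of Inr (Inl k) \<Rightarrow> y $ k | _ \<Rightarrow> 0)"
  "dual_basis b (xpart x) = (case b of Inr (Inr k) \<Rightarrow> x $ k | _ \<Rightarrow> 0)"
  unfolding zpart_def ypart_def xpart_def
  by (auto simp: linear_sum[OF linear_dual_basis] linear_cmul[OF linear_dual_basis]
      if_distrib split: sum.splits cong: if_cong)

lemma algebra_coords_parts: "algebra_coords (zpart z + ypart y + xpart x) = (z, y, x)"
  by (simp add: algebra_coords_def linear_add[OF linear_dual_basis] vec_eq_iff)

lemma linear_algebra_coords: "linear algebra_coords"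
  unfolding algebra_coords_def
  by (intro linearI) (simp_all add: linear_add[OF linear_dual_basis] linear_cmul[OF linear_dual_basis] vec_eq_iff)

lemma parts_algebra_coords:
  "algebra_coords v = (z, y, x) \<Longrightarrow> zpart z + ypart y + xpart x = v"
proof -
  let ?h = "\<lambda>v. case algebra_coords v of (z, y, x) \<Rightarrow> zpart z + ypart y + xpart x"
  have "?h = (\<lambda>v. v)"
  proof (rule linear_eq_on_basis)
    have h: "?h = (\<lambda>v. zpart (fst (algebra_coords v)) + ypart (fst (snd (algebra_coords v)))
        + xpart (snd (snd (algebra_coords v))))"
      by (simp add: case_prod_unfold)
    show "linear ?h" unfolding h
      by (intro linear_compose_add linear_compose[OF _ linear_parts(1), unfolded o_def]
          linear_compose[OF _ linear_parts(2), unfolded o_def] linear_compose[OF _ linear_parts(3), unfolded o_def]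
          linear_compose[OF _ linear_fst, unfolded o_def] linear_compose[OF _ linear_snd, unfolded o_def]
          linear_algebra_coords)
  qed (auto intro: linear_id[unfolded id_def] simp: algebra_coords_def zpart_def ypart_def xpart_def
       if_distrib[of "\<lambda>c. c *\<^sub>R _"] cong: if_cong)
  then show "algebra_coords v = (z, y, x) \<Longrightarrow> zpart z + ypart y + xpart x = v"
    by (auto dest!: fun_cong[of _ _ v])
qed

text \<open>The bracket of the X-part with the Y-part, in Z-coordinates. Up to sign it is the only
  bracket that survives the commutation relations, and it is the cocycle of the group law.\<close>

definition twist :: "(real, 'd) vec \<Rightarrow> (real, 'd) vec \<Rightarrow> (real, 'z) vec" where
  "twist x y = fst (algebra_coords (br (xpart x) (ypart y)))"

lemma bilinear_twist: "bilinear twist"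
  unfolding bilinear_def twist_def
proof (intro conjI allI)
  fix x
  show "linear (\<lambda>y. fst (algebra_coords (br (xpart x) (ypart y))))"
    by (intro linear_compose[OF _ linear_fst, unfolded o_def] linear_compose[OF _ linear_algebra_coords, unfolded o_def]
        linear_compose[OF linear_parts(2), unfolded o_def])
       (use br_bilinear in \<open>auto simp: bilinear_def\<close>)
next
  fix y
  show "linear (\<lambda>x. fst (algebra_coords (br (xpart x) (ypart y))))"
    by (intro linear_compose[OF _ linear_fst, unfolded o_def] linear_compose[OF _ linear_algebra_coords, unfolded o_def]
        linear_compose[OF linear_parts(3), unfolded o_def])
       (use br_bilinear in \<open>auto simp: bilinear_def\<close>)
qed

lemmas twist_simps = bilinear_ladd[OF bilinear_twist] bilinear_radd[OF bilinear_twist]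
  bilinear_lmul[OF bilinear_twist] bilinear_rmul[OF bilinear_twist]

lemma zpart_surj: "v \<in> span (range (Zvec G)) \<Longrightarrow> zpart (fst (algebra_coords v)) = v"
proof -
  assume v: "v \<in> span (range (Zvec G))"
  have "dual_basis (Inr b) v = 0" for b
    by (rule linear_eq_0_on_span[OF linear_dual_basis _ v]) auto
  then have "algebra_coords v = (fst (algebra_coords v), 0, 0)"
    by (simp add: algebra_coords_def vec_eq_iff)
  from parts_algebra_coords[OF this] show ?thesis
    by (simp add: linear_0[OF linear_parts(2)] linear_0[OF linear_parts(3)])
qed

lemma zpart_twist: "zpart (twist x y) = br (xpart x) (ypart y)"
proof -
  have "br (ypart y) (xpart x) \<in> span (range (Zvec G))"
    using ab_central[OF parts_in_span(2) parts_in_span(3)] by (simp add: center)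
  then have "- br (ypart y) (xpart x) \<in> span (range (Zvec G))" by (rule span_neg)
  then show ?thesis
    unfolding twist_def using zpart_surj br_antisym[of "xpart x" "ypart y"] by simp
qed

lemma continuous_on_twist: "continuous_on UNIV (\<lambda>p. twist (f p) (h p))"
  if "continuous_on UNIV f" "continuous_on UNIV h"
  using bounded_bilinear.continuous_on[OF bilinear_twist[unfolded bilinear_conv_bounded_bilinear] that] .

text \<open>Two uses of Baker-Campbell-Hausdorff give exp(z) exp(y) exp(x) = exp(z + y + x +
  [y,x]/2) for central z, and [y,x] is the negative of the bracket recorded by
  \<open>twist\<close>.\<close>

lemma coord_map_eq: "coord_map G (z, y, x) = expo G (zpart (z - (1/2) *\<^sub>R twist x y) + ypart y + xpart x)"
proof -
  have "coord_map G (z, y, x) = expo G (zpart z + ypart y + (1/2) *\<^sub>R br (zpart z) (ypart y) + xpart x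
      + (1/2) *\<^sub>R br (zpart z + ypart y + (1/2) *\<^sub>R br (zpart z) (ypart y)) (xpart x))"
    by (simp only: coord_map_def prod.case BCH zpart_def[symmetric] ypart_def[symmetric] xpart_def[symmetric])
  also have "br (ypart y) (xpart x) = - zpart (twist x y)"
    using br_antisym[of "ypart y" "xpart x"] by (simp add: zpart_twist)
  then have "zpart z + ypart y + (1/2) *\<^sub>R br (zpart z) (ypart y) + xpart x
      + (1/2) *\<^sub>R br (zpart z + ypart y + (1/2) *\<^sub>R br (zpart z) (ypart y)) (xpart x)
      = zpart (z - (1/2) *\<^sub>R twist x y) + ypart y + xpart x"
    by (simp add: br_simps linear_diff[OF linear_parts(1)] linear_cmul[OF linear_parts(1)])
  finally show ?thesis .
qed

definition expo_inv :: "'n \<Rightarrow> 'g" where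
  "expo_inv = (SOME lg. homeomorphism UNIV UNIV (expo G) lg)"

lemma expo_inv: "homeomorphism UNIV UNIV (expo G) expo_inv"
  unfolding expo_inv_def using expo_homeomorphism by (rule someI_ex)

lemma expo_inv_simps [simp]: "expo_inv (expo G v) = v" "expo G (expo_inv m) = m"
  using expo_inv by (auto simp: homeomorphism_def)

text \<open>Take the logarithm, read off linear coordinates and add the half bracket back. This
  explicit inverse of \<open>coord_map G\<close> makes the continuity of \<open>coords G\<close>
  accessible.\<close>

definition coords' :: "'n \<Rightarrow> ((real, 'z) vec) \<times> ((real, 'd) vec) \<times> ((real, 'd) vec)" where
  "coords' m = (case algebra_coords (expo_inv m) of (z, y, x) \<Rightarrow> (z + (1/2) *\<^sub>R twist x y, y, x))"

lemma coords'_coord_map: "coords' (coord_map G p) = p"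
  by (cases p) (simp add: coords'_def coord_map_eq algebra_coords_parts)

lemma coord_map_coords': "coord_map G (coords' m) = m"
  by (simp add: coords'_def coord_map_eq parts_algebra_coords split: prod.split)

lemma coords_eq: "coords G = coords'"
  unfolding coords_def
  by (rule ext, rule inv_into_f_eq)
     (auto simp: coord_map_coords' intro: inj_on_inverseI[of _ coords'] coords'_coord_map)

lemma coords_coord_map [simp]: "coords G (coord_map G p) = p"
  by (simp add: coords_eq coords'_coord_map)

lemma coord_map_coords [simp]: "coord_map G (coords G m) = m"
  by (simp add: coords_eq coord_map_coords')

lemma coord_map_measurable [measurable]: "coord_map G \<in> borel \<rightarrow>\<^sub>M borel"
proof (rule borel_measurable_continuous_onI)
  have eq: "coord_map G = (\<lambda>p. expo G (zpart (fst p - (1/2) *\<^sub>R twist (snd (snd p)) (fst (snd p)))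
      + ypart (fst (snd p)) + xpart (snd (snd p))))"
    by (auto simp: coord_map_eq)
  have lin: "continuous_on S zpart" "continuous_on T ypart" "continuous_on T xpart" for S T
    using linear_parts by (auto intro: linear_continuous_on simp: linear_conv_bounded_linear)
  have "continuous_on UNIV (expo G)" using expo_inv by (simp add: homeomorphism_def)
  then show "continuous_on UNIV (coord_map G)"
    unfolding eq
    by (rule continuous_on_compose2)
       (auto intro!: continuous_intros continuous_on_twist continuous_on_compose2[OF lin(1)]
         continuous_on_compose2[OF lin(2)] continuous_on_compose2[OF lin(3)])
qed

lemma coords_measurable [measurable]: "coords G \<in> borel \<rightarrow>\<^sub>M borel"
proof (rule borel_measurable_continuous_onI)
  have eq: "coords G = (\<lambda>m. (fst (algebra_coords (expo_inv m)) + (1/2) *\<^sub>R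
      twist (snd (snd (algebra_coords (expo_inv m)))) (fst (snd (algebra_coords (expo_inv m)))),
      snd (algebra_coords (expo_inv m))))"
    by (auto simp: coords_eq coords'_def split: prod.split)
  have "continuous_on UNIV expo_inv" using expo_inv by (simp add: homeomorphism_def)
  moreover have "continuous_on UNIV algebra_coords"
    using linear_algebra_coords by (auto intro: linear_continuous_on simp: linear_conv_bounded_linear)
  ultimately have "continuous_on UNIV (\<lambda>m. algebra_coords (expo_inv m))"
    by (auto intro: continuous_on_compose2)
  then show "continuous_on UNIV (coords G)"
    unfolding eq by (auto intro!: continuous_intros continuous_on_twist)
qed

text \<open>In the product only moving exp(x) past exp(y') costs anything, and the cost is the
  central bracket [x,y'].\<close>

lemma coord_map_mult:
  "coord_map G (z, y, x) \<otimes> coord_map G (z', y', x') = coord_map G (z + z' + twist x y', y + y', x + x')"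
proof -
  have "br (ypart y) (xpart x') = - zpart (twist x' y)"
    using br_antisym[of "ypart y" "xpart x'"] by (simp add: zpart_twist)
  then have b: "br (zpart a + ypart y + xpart x) (zpart a' + ypart y' + xpart x')
      = zpart (twist x y' - twist x' y)" for a a'
    unfolding br_simps linear_diff[OF linear_parts(1)] by (simp add: zpart_twist)
  \<comment> \<open>With the half bracket named, the full one is q + q, and the remaining identity
    is one in an abelian group.\<close>
  define q where "q = (1/2) *\<^sub>R twist x y'"
  have q: "twist x y' = q + q"
    unfolding q_def by (simp flip: scaleR_add_left)
  have z: "z - (1/2) *\<^sub>R twist x y + (z' - (1/2) *\<^sub>R twist x' y') + (1/2) *\<^sub>R (twist x y' - twist x' y)
     = z + z' + twist x y' - (1/2) *\<^sub>R twist (x + x') (y + y')"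
    unfolding twist_simps scaleR_add_right scaleR_diff_right q_def[symmetric] q by simp
  have "coord_map G (z, y, x) \<otimes> coord_map G (z', y', x')
     = expo G (zpart (z - (1/2) *\<^sub>R twist x y + (z' - (1/2) *\<^sub>R twist x' y') + (1/2) *\<^sub>R (twist x y' - twist x' y))
         + ypart (y + y') + xpart (x + x'))"
    unfolding coord_map_eq BCH b
    by (simp only: linear_add[OF linear_parts(1)] linear_add[OF linear_parts(2)] linear_add[OF linear_parts(3)]
        linear_cmul[OF linear_parts(1)] ac_simps)
  then show ?thesis unfolding z by (simp only: coord_map_eq)
qed

lemma coords_mult:
  "coords G m = (z, y, x) \<Longrightarrow> coords G m' = (z', y', x') \<Longrightarrow>
    coords G (m \<otimes> m') = (z + z' + twist x y', y + y', x + x')"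
  using coord_map_mult[of z y x z' y' x'] by (metis coord_map_coords coords_coord_map)

text \<open>In invariant terms, l([x,y]) = x . B(l) y. This matches the cocycle of the group with
  the phases of the representation.\<close>

lemma inner_twist: "l \<bullet> twist x y = x \<bullet> (Bmat G l *v y)"
proof -
  have "br (xpart x) (ypart y) = (\<Sum>i\<in>UNIV. \<Sum>j\<in>UNIV. (x $ i * y $ j) *\<^sub>R br (Xvec G i) (Yvec G j))"
    unfolding xpart_def ypart_def bilinear_sum[OF br_bilinear] sum.cartesian_product
    by (simp add: br_simps mult.commute case_prod_unfold)
  then have "twist x y $ k = (\<Sum>i\<in>UNIV. \<Sum>j\<in>UNIV. x $ i * y $ j * dual_basis (Inl k) (br (Xvec G i) (Yvec G j)))" for k
    by (simp add: twist_def algebra_coords_def linear_sum[OF linear_dual_basis] linear_cmul[OF linear_dual_basis])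
  then have "l \<bullet> twist x y = (\<Sum>k\<in>UNIV. \<Sum>i\<in>UNIV. \<Sum>j\<in>UNIV.
      l $ k * (x $ i * y $ j * dual_basis (Inl k) (br (Xvec G i) (Yvec G j))))"
    by (simp add: inner_vec_def sum_distrib_left)
  also have "\<dots> = (\<Sum>i\<in>UNIV. \<Sum>j\<in>UNIV. \<Sum>k\<in>UNIV.
      l $ k * (x $ i * y $ j * dual_basis (Inl k) (br (Xvec G i) (Yvec G j))))"
    by (subst sum.swap, rule sum.cong[OF refl], subst sum.swap, rule refl)
  also have "\<dots> = x \<bullet> (Bmat G l *v y)"
    by (simp add: inner_vec_def matrix_vector_mult_def Bmat_eq sum_distrib_left sum_distrib_right mult_ac)
  finally show ?thesis .
qed

text \<open>Since 'z indexes n - 2d vectors, this turns the exponent n - d in \<open>dil_op\<close>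
  into \<open>CARD('z) + CARD('d)\<close>.\<close>

lemma dim_eq: "DIM('g) = CARD('z) + 2 * CARD('d)"
proof -
  have "card (range (basis_vec G)) = dim (UNIV :: 'g set)"
    using dim_span_eq_card_independent[OF basis_independent] by (simp add: basis_span)
  then show ?thesis by (simp add: card_image[OF basis_inj])
qed

section \<open>Haar measure, dilations and the Plancherel measure\<close>

lemma haar_sets [simp, measurable_cong]: "sets (haar G) = sets borel"
  by (simp add: haar_def)

lemma haar_space [simp]: "space (haar G) = UNIV"
  by (simp add: haar_def)

lemma scales_haar:
  assumes "scales lborel \<tau> c"
  shows "scales (haar G) (\<lambda>m. coord_map G (\<tau> (coords G m))) c"
  unfolding haar_def by (rule scales_distr[OF assms]) auto

text \<open>In coordinates, left multiplication is a shear of z by \<open>twist x0 y\<close>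
  followed by a translation, and both preserve Lebesgue measure.\<close>

lemma scales_haar_left: "scales (haar G) (\<lambda>m. m0 \<otimes> m) 1"
proof -
  obtain z0 y0 x0 where c: "coords G m0 = (z0, y0, x0)" by (metis prod.exhaust)
  have "(\<lambda>p. twist x0 (fst p)) \<in> borel_measurable borel"
    by (intro borel_measurable_continuous_onI continuous_on_twist continuous_intros)
  from scales_compose[OF scales_lborel_translation[of "(z0, y0, x0)"]
      scales_lborel_shear[OF this]]
  have "scales (haar G) (\<lambda>m. coord_map G ((z0, y0, x0) +
      (case coords G m of (a, b) \<Rightarrow> (a + twist x0 (fst b), b)))) 1"
    by (intro scales_haar) simp
  also have "(\<lambda>m. coord_map G ((z0, y0, x0) + (case coords G m of (a, b) \<Rightarrow> (a + twist x0 (fst b), b))))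
      = (\<lambda>m. m0 \<otimes> m)"
  proof
    fix m
    obtain z y x where m: "coords G m = (z, y, x)" by (metis prod.exhaust)
    show "coord_map G ((z0, y0, x0) + (case coords G m of (a, b) \<Rightarrow> (a + twist x0 (fst b), b))) = m0 \<otimes> m"
      using arg_cong[OF coords_mult[OF c m], of "coord_map G"] by (simp add: m add.assoc)
  qed
  finally show ?thesis .
qed

text \<open>Embeds A in a family that is multiplicative in the real number s, so that A^j is the
  member with s = 2^j for negative j as well.\<close>

definition dil_real :: "real \<Rightarrow> 'n \<Rightarrow> 'n" where
  "dil_real s m = (case coords G m of (z, y, x) \<Rightarrow> coord_map G (s *\<^sub>R z, s *\<^sub>R y, x))"

lemma coords_dil_real: "coords G m = (z, y, x) \<Longrightarrow> coords G (dil_real s m) = (s *\<^sub>R z, s *\<^sub>R y, x)"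
  by (simp add: dil_real_def)

lemma dil_real_dil_real: "dil_real s (dil_real s' m) = dil_real (s * s') m"
  by (simp add: dil_real_def split: prod.split)

lemma dil_real_1 [simp]: "dil_real 1 m = m"
  by (simp add: dil_real_def split: prod.split)

text \<open>The n - 2d central coordinates and the d Y-coordinates are stretched, the X-coordinates
  are not, which makes n - d in total.\<close>

lemma scales_dil_real:
  assumes "s > 0"
  shows "scales (haar G) (dil_real s) (s ^ (CARD('z) + CARD('d)))"
proof -
  have "scales (haar G) (\<lambda>m. coord_map G (case coords G m of (a, b) \<Rightarrow>
      (s *\<^sub>R a, case b of (b, c) \<Rightarrow> (s *\<^sub>R b, c)))) (s ^ DIM((real, 'z) vec) * (s ^ DIM((real, 'd) vec) * 1))"
    using assms by (intro scales_haar scales_lborel_prod scales_lborel_scaleR scales_id)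
  also have "(\<lambda>m. coord_map G (case coords G m of (a, b) \<Rightarrow>
      (s *\<^sub>R a, case b of (b, c) \<Rightarrow> (s *\<^sub>R b, c)))) = dil_real s"
    by (auto simp: dil_real_def split: prod.split)
  finally show ?thesis by (simp add: power_add)
qed

lemma int_iterate_dil: "int_iterate (dil G) j = dil_real (2 powi j)"
proof -
  have dil: "dil G = dil_real 2" by (auto simp: dil_def dil_real_def)
  have inv: "inv_into UNIV (dil G) = dil_real (1/2)"
  proof (rule inv_unique_comp)
    show "dil G \<circ> dil_real (1/2) = id" "dil_real (1/2) \<circ> dil G = id"
      by (auto simp: dil dil_real_dil_real)
  qed
  have pow: "(dil_real s ^^ k) m = dil_real (s ^ k) m" for s k m
    by (induction k) (simp_all add: dil_real_dil_real)
  show ?thesis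
  proof (cases "0 \<le> j")
    case True
    then show ?thesis by (auto simp: int_iterate_def dil pow power_int_def)
  next
    case False
    then show ?thesis by (auto simp: int_iterate_def inv pow power_int_def power_divide field_simps)
  qed
qed

text \<open>The normalising constant is the square root of the Jacobian of A^(-j), so
  \<open>dil_op\<close> has the form sqrt c (f o \<tau>) of a unitary change of variables.\<close>

lemma dil_op_eq:
  "dil_op G j f = (\<lambda>m. complex_of_real (sqrt ((2 powi (- j)) ^ (CARD('z) + CARD('d)))) * f (dil_real (2 powi (- j)) m))"
proof -
  have dims: "real DIM('g) - real CARD('d) = real (CARD('z) + CARD('d))"
    unfolding dim_eq by simp
  have "2 powr (- real_of_int j * (real DIM('g) - real CARD('d)) / 2)
      = sqrt ((2 powi (- j)) ^ (CARD('z) + CARD('d)))"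
    unfolding dims
    by (simp add: powr_half_sqrt[symmetric] powr_real_of_int'[symmetric] powr_powr
        powr_realpow[symmetric] del: of_nat_add)
  then show ?thesis by (auto simp: dil_op_def int_iterate_dil)
qed

text \<open>Lebesgue measure contributes n - 2d to the exponent and the homogeneity of the
  determinant d. The sum is the exponent that \<open>dil_real\<close> has for the Haar
  measure.\<close>

lemma scales_plancherel:
  assumes "s > 0"
  shows "scales (plancherel_measure G) (\<lambda>l. s *\<^sub>R l) (s ^ (CARD('z) + CARD('d)))"
proof (rule scalesI[where \<rho> = "\<lambda>l. inverse s *\<^sub>R l"])
  fix A assume "A \<in> sets (plancherel_measure G)"
  then have [measurable]: "A \<in> sets borel" by (simp add: plancherel_measure_def)
  have [measurable]: "(*\<^sub>R) s -` A \<in> sets borel"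
    using measurable_sets[of "(*\<^sub>R) s" borel borel A] by simp
  have "emeasure (plancherel_measure G) A = (\<integral>\<^sup>+l. ennreal \<bar>det (Bmat G l)\<bar> * indicator A l \<partial>lborel)"
    by (simp add: plancherel_measure_def emeasure_density)
  also have "\<dots> = ennreal (s ^ CARD('z)) * (\<integral>\<^sup>+l. ennreal \<bar>det (Bmat G (s *\<^sub>R l))\<bar> * indicator A (s *\<^sub>R l) \<partial>lborel)"
    using scales_nn_integral[OF scales_lborel_scaleR[OF assms, where 'a = "(real, 'z) vec"],
        of "\<lambda>l. ennreal \<bar>det (Bmat G l)\<bar> * indicator A l"] by simp
  also have "\<dots> = ennreal (s ^ CARD('z)) * (\<integral>\<^sup>+l. ennreal (s ^ CARD('d)) *
      (ennreal \<bar>det (Bmat G l)\<bar> * indicator ((*\<^sub>R) s -` A) l) \<partial>lborel)"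
    using assms by (simp add: det_Bmat_scale abs_mult ennreal_mult mult.assoc indicator_def)
  also have "\<dots> = ennreal (s ^ CARD('z)) * (ennreal (s ^ CARD('d)) * emeasure (plancherel_measure G) ((*\<^sub>R) s -` A))"
    by (simp add: nn_integral_cmult plancherel_measure_def emeasure_density)
  finally show "emeasure (plancherel_measure G) A = ennreal (s ^ (CARD('z) + CARD('d))) *
      emeasure (plancherel_measure G) ((*\<^sub>R) s -` A \<inter> space (plancherel_measure G))"
    using assms by (simp add: power_add ennreal_mult mult.assoc plancherel_measure_def)
qed (use assms in \<open>auto simp: plancherel_measure_def\<close>)

end

section \<open>The representations and the Fourier transform\<close>

lemma cis_mult_left: "cis a * (cis b * p) = cis (a + b) * p"
  by (simp only: mult.assoc[symmetric] cis_mult)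

context nil_setting
begin

lemma rep_eq:
  assumes "coords G m = (z, y, x)"
  shows "rep G l m \<phi> = (\<lambda>t. cis (2 * pi * (l \<bullet> z - t \<bullet> (Bmat G l *v y))) * \<phi> (t - x))"
  by (rule ext)
     (simp add: rep_def assms rep_Z_def rep_Y_def rep_X_def cis_mult_left right_diff_distrib)

text \<open>Moving the translation by x through the phase of y' leaves the phase x . B(l) y', which
  is l applied to the cocycle \<open>twist x y'\<close>.\<close>

lemma rep_mult: "rep G l m (rep G l m' \<phi>) = rep G l (m \<otimes> m') \<phi>"
proof -
  obtain z y x where m: "coords G m = (z, y, x)" by (metis prod.exhaust)
  obtain z' y' x' where m': "coords G m' = (z', y', x')" by (metis prod.exhaust)
  show ?thesis
    unfolding rep_eq[OF m] rep_eq[OF m'] rep_eq[OF coords_mult[OF m m']]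
    by (rule ext) (simp add: cis_mult_left inner_add_right inner_diff_left inner_twist
        matrix_vector_right_distrib diff_diff_eq right_diff_distrib[symmetric] distrib_left[symmetric],
        simp add: algebra_simps)
qed

lemma coords_one: "coords G \<one> = (0, 0, 0)"
proof -
  obtain z y x where c: "coords G \<one> = (z, y, x)" by (metis prod.exhaust)
  have "\<one> \<otimes> \<one> = \<one>" by (simp add: carrier_UNIV)
  then have "(z + z + twist x y, y + y, x + x) = (z, y, x)"
    using coords_mult[OF c c] c by metis
  then have "x = 0" "y = 0" "z + twist x y = 0" by auto
  moreover from this have "z = 0" using bilinear_lzero[OF bilinear_twist, of 0] by simp
  ultimately show ?thesis using c by simp
qed

lemma rep_one: "rep G l \<one> \<phi> = \<phi>"
  unfolding rep_eq[OF coords_one] by simp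

text \<open>The parameter enters only through l . z and B(l) y. Both are bilinear, so the factor s
  moves from z and y to l.\<close>

lemma rep_dil_real: "rep G l (dil_real s m) = rep G (s *\<^sub>R l) m"
proof -
  obtain z y x where m: "coords G m = (z, y, x)" by (metis prod.exhaust)
  have "Bmat G l *v (s *\<^sub>R y) = s *\<^sub>R (Bmat G l *v y)"
    by (rule matrix_vector_mult_scaleR)
  moreover have "Bmat G (s *\<^sub>R l) *v y = s *\<^sub>R (Bmat G l *v y)"
    by (simp add: Bmat_scale scaleR_matrix_vector_assoc)
  ultimately show ?thesis
    by (auto simp: rep_eq[OF coords_dil_real[OF m]] rep_eq[OF m])
qed

lemma rep_L2:
  assumes "\<phi> \<in> L2 lborel"
  shows "rep G l m \<phi> \<in> L2 lborel"
proof -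
  obtain z y x where m: "coords G m = (z, y, x)" by (metis prod.exhaust)
  have sh: "(\<lambda>t. \<phi> (t - x)) \<in> L2 lborel"
    using scales_L2_iff[OF scales_lborel_translation[of "- x"], of \<phi>] assms by simp
  have [measurable]: "(\<lambda>t. \<phi> (t - x)) \<in> borel_measurable borel"
    using L2_lborel_measurable[OF sh] .
  have [measurable]: "(\<lambda>t. cis (2 * pi * (l \<bullet> z - t \<bullet> (Bmat G l *v y)))) \<in> borel_measurable borel"
    by (intro borel_measurable_continuous_onI continuous_intros)
  show ?thesis
    unfolding rep_eq[OF m]
    by (rule L2_bounded_by[OF _ L2_integrable[OF sh]]) (auto simp: norm_mult)
qed

lemma rep_inner:
  "L2_inner lborel (rep G l m \<phi>) (rep G l m \<psi>) = L2_inner lborel \<phi> \<psi>"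
proof -
  obtain z y x where m: "coords G m = (z, y, x)" by (metis prod.exhaust)
  have unit: "cis a * p * cnj (cis a * q) = p * cnj q" for a p q
  proof -
    have "cis a * p * cnj (cis a * q) = (cis a * cnj (cis a)) * (p * cnj q)" by simp
    then show ?thesis by (simp add: cis_cnj cis_mult)
  qed
  show ?thesis
    unfolding L2_inner_def rep_eq[OF m] unit
    using scales_integral[OF scales_lborel_translation[of "- x"], of "\<lambda>t. \<phi> t * cnj (\<psi> t)"] by simp
qed

lemma rep_norm: "L2_norm lborel (rep G l m \<phi>) = L2_norm lborel \<phi>"
proof -
  have "complex_of_real ((L2_norm lborel (rep G l m \<phi>))\<^sup>2) = complex_of_real ((L2_norm lborel \<phi>)\<^sup>2)"
    using rep_inner[of l m \<phi> \<phi>] by (simp only: L2_inner_self)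
  then show ?thesis by (simp only: of_real_eq_iff power2_eq_iff_nonneg L2_norm_nonneg)
qed

lemma L2_linear_rep: "L2_linear (rep G l m)"
proof -
  obtain z y x where m: "coords G m = (z, y, x)" by (metis prod.exhaust)
  show ?thesis
    unfolding L2_linear_def
  proof (intro conjI ballI allI impI)
    fix f g :: "(real, 'd) vec \<Rightarrow> complex"
    assume "AE t in lborel. f t = g t"
    from scales_AE[OF scales_lborel_translation[of "- x"] this]
    show "AE t in lborel. rep G l m f t = rep G l m g t"
      by (auto simp: rep_eq[OF m])
  next
    fix f g a b
    show "AE t in lborel. rep G l m (\<lambda>s. a * f s + b * g s) t = a * rep G l m f t + b * rep G l m g t"
      by (simp add: rep_eq[OF m] algebra_simps)
  qed (fact rep_L2)
qed

lemma rep_adjoint: "L2_inner lborel (rep G l m \<phi>) \<psi> = L2_inner lborel \<phi> (rep G l (inv m) \<psi>)"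
proof -
  have "rep G l m (rep G l (inv m) \<psi>) = \<psi>"
    by (simp add: rep_mult carrier_UNIV rep_one)
  then show ?thesis using rep_inner[of l m \<phi> "rep G l (inv m) \<psi>"] by simp
qed

section \<open>Weak Fourier transforms and truncation\<close>

lemma is_fourier_unique:
  assumes S: "is_fourier G f l S" and T: "is_fourier G f l T"
  shows "oper_eq S T"
  unfolding oper_eq_def
proof
  fix \<phi> :: "(real, 'd) vec \<Rightarrow> complex" assume \<phi>: "\<phi> \<in> L2 lborel"
  have SL: "S \<phi> \<in> L2 lborel" and TL: "T \<phi> \<in> L2 lborel"
    using S T \<phi> by (auto simp: is_fourier_def L2_linear_def)
  let ?d = "\<lambda>t. S \<phi> t - T \<phi> t"
  have d: "?d \<in> L2 lborel" by (intro L2_diff SL TL)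
  \<comment> \<open>The weak definition may be tested against the difference itself, which then has
    norm 0.\<close>
  have "L2_inner lborel (S \<phi>) ?d = L2_inner lborel (T \<phi>) ?d"
    using S T \<phi> d by (auto simp: is_fourier_def)
  then have "L2_inner lborel ?d ?d = 0"
    using L2_inner_diff_left[OF SL TL d] by simp
  then have "L2_norm lborel ?d = 0"
    unfolding L2_inner_self of_real_eq_0_iff by simp
  from L2_norm_zero_AE[OF d this] show "AE t in lborel. S \<phi> t = T \<phi> t" by simp
qed

lemma L2_linear_cmult: "L2_linear T \<Longrightarrow> L2_linear (\<lambda>v t. a * T v t)"
  using L2_linear_combination[of T T a 0] by simp

text \<open>Substitution in the Haar integral costs 1 / c, which together with the normalisation
  sqrt c leaves 1 / sqrt c. It also shifts the dilation to the representation, where it becomes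
  division of the parameter by s.\<close>

lemma is_fourier_dil:
  fixes s :: real
  assumes T: "is_fourier G f (inverse s *\<^sub>R l) T" and s: "s > 0"
  defines "c \<equiv> s ^ (CARD('z) + CARD('d))"
  shows "is_fourier G (\<lambda>m. complex_of_real (sqrt c) * f (dil_real s m)) l
           (\<lambda>v t. complex_of_real (1 / sqrt c) * T v t)"
  unfolding is_fourier_def
proof (intro conjI ballI)
  show "L2_linear (\<lambda>v t. complex_of_real (1 / sqrt c) * T v t)"
    using T by (intro L2_linear_cmult) (simp add: is_fourier_def)
  fix \<phi> \<psi> :: "(real, 'd) vec \<Rightarrow> complex" assume \<phi>: "\<phi> \<in> L2 lborel" and \<psi>: "\<psi> \<in> L2 lborel"
  have c: "c > 0" using s by (simp add: c_def)
  have sc: "scales (haar G) (dil_real s) c" unfolding c_def by (rule scales_dil_real[OF s])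
  have rep: "rep G (inverse s *\<^sub>R l) (dil_real s m) = rep G l m" for m
    using s by (simp add: rep_dil_real)
  have "L2_inner lborel (T \<phi>) \<psi> = (LINT m|haar G. f m * L2_inner lborel (rep G (inverse s *\<^sub>R l) m \<phi>) \<psi>)"
    using T \<phi> \<psi> by (simp add: is_fourier_def)
  also have "\<dots> = c *\<^sub>R (LINT m|haar G. f (dil_real s m) * L2_inner lborel (rep G l m \<phi>) \<psi>)"
    by (subst scales_integral[OF sc]) (simp add: rep)
  finally have "L2_inner lborel (\<lambda>t. complex_of_real (1 / sqrt c) * T \<phi> t) \<psi>
      = complex_of_real (1 / sqrt c * c) * (LINT m|haar G. f (dil_real s m) * L2_inner lborel (rep G l m \<phi>) \<psi>)"
    unfolding L2_inner_scale_left by (simp add: scaleR_conv_of_real)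
  also have "1 / sqrt c * c = sqrt c" using c by (simp add: real_div_sqrt)
  finally show "L2_inner lborel (\<lambda>t. complex_of_real (1 / sqrt c) * T \<phi> t) \<psi>
      = (LINT m|haar G. complex_of_real (sqrt c) * f (dil_real s m) * L2_inner lborel (rep G l m \<phi>) \<psi>)"
    by (simp add: mult.assoc)
qed

text \<open>Invariance of the Haar measure moves m0 into the representation, where it splits off as
  a factor on the left. The second factor u of a rank-one operator is thereby left alone.\<close>

lemma is_fourier_left_transl:
  assumes T: "is_fourier G f l T"
  shows "is_fourier G (left_transl G m0 f) l (\<lambda>v. rep G l m0 (T v))"
  unfolding is_fourier_def
proof (intro conjI ballI)
  show "L2_linear (\<lambda>v. rep G l m0 (T v))"
    using T by (intro L2_linear_compose[OF L2_linear_rep]) (simp add: is_fourier_def)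
  fix \<phi> \<psi> :: "(real, 'd) vec \<Rightarrow> complex" assume \<phi>: "\<phi> \<in> L2 lborel" and \<psi>: "\<psi> \<in> L2 lborel"
  have "L2_inner lborel (rep G l m0 (T \<phi>)) \<psi> = L2_inner lborel (T \<phi>) (rep G l (inv m0) \<psi>)"
    by (rule rep_adjoint)
  also have "\<dots> = (LINT m|haar G. f m * L2_inner lborel (rep G l m \<phi>) (rep G l (inv m0) \<psi>))"
    using T \<phi> rep_L2[OF \<psi>] by (simp add: is_fourier_def)
  also have "\<dots> = (LINT m|haar G. f m * L2_inner lborel (rep G l (m0 \<otimes> m) \<phi>) \<psi>)"
    by (simp add: rep_adjoint[symmetric] rep_mult)
  also have "\<dots> = (LINT m|haar G. f (inv m0 \<otimes> m) * L2_inner lborel (rep G l m \<phi>) \<psi>)"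
    by (subst scales_integral[OF scales_haar_left[of "inv m0"]])
       (simp add: m_assoc[symmetric] carrier_UNIV)
  finally show "L2_inner lborel (rep G l m0 (T \<phi>)) \<psi>
      = (LINT m|haar G. left_transl G m0 f m * L2_inner lborel (rep G l m \<phi>) \<psi>)"
    by (simp add: left_transl_def)
qed

text \<open>The cut-offs are to balls in the coordinates, which have finite Haar measure. Dominated
  convergence with the bound |f|^2 gives the limit.\<close>

lemma L2_truncation:
  assumes f: "f \<in> L2 (haar G)"
  obtains h where "\<And>k::nat. h k \<in> L2 (haar G)" "\<And>k. integrable (haar G) (h k)"
    "(\<lambda>k. (L2_norm (haar G) (\<lambda>m. f m - h k m))\<^sup>2) \<longlonglongrightarrow> 0"
proof -
  define B where "B k = coords G -` cball 0 (real k)" for k :: nat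
  define h where "h k m = (if m \<in> B k then f m else 0)" for k m
  have [measurable]: "f \<in> borel_measurable borel" using L2_measurable[OF f] by simp
  have "coords G -` cball 0 (real k) \<inter> space borel \<in> sets borel" for k
    by (rule measurable_sets[OF coords_measurable]) simp
  then have [measurable]: "B k \<in> sets borel" for k by (simp add: B_def)
  have [measurable]: "h k \<in> borel_measurable borel" for k unfolding h_def by measurable
  have L2: "h k \<in> L2 (haar G)" for k
    by (rule L2_bounded_by[OF _ L2_integrable[OF f]]) (auto simp: h_def)
  have fin: "emeasure (haar G) (B k) < \<infinity>" for k
  proof -
    have "emeasure (haar G) (B k) = emeasure lborel (coord_map G -` B k)"
      unfolding haar_def by (simp add: emeasure_distr)
    also have "coord_map G -` B k = cball 0 (real k)" by (auto simp: B_def)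
    finally show ?thesis using emeasure_bounded_finite[OF bounded_cball, of "0 :: (real, 'z) vec \<times> (real, 'd) vec \<times> (real, 'd) vec" "real k"] by simp
  qed
  have int: "integrable (haar G) (h k)" for k
  proof (rule Bochner_Integration.integrable_bound)
    show "integrable (haar G) (\<lambda>m. (cmod (f m))\<^sup>2 + indicator (B k) m)"
      using L2_integrable[OF f] fin[of k] by (intro Bochner_Integration.integrable_add) auto
    show "h k \<in> borel_measurable (haar G)" by measurable
    \<comment> \<open>On a set of finite measure this makes a square-integrable function
      integrable.\<close>
    have "cmod p \<le> (cmod p)\<^sup>2 + 1" for p
      using sum_squares_bound[of "cmod p" 1] norm_ge_zero[of p] unfolding power2_eq_square one_power2 by linarith
    then show "AE m in haar G. norm (h k m) \<le> norm ((cmod (f m))\<^sup>2 + indicator (B k) m :: real)"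
      by (auto simp: h_def indicator_def)
  qed
  have "(\<lambda>k. LINT m|haar G. (cmod (f m - h k m))\<^sup>2) \<longlonglongrightarrow> (LINT m|haar G. 0)"
  proof (rule integral_dominated_convergence[where w = "\<lambda>m. (cmod (f m))\<^sup>2"])
    show "integrable (haar G) (\<lambda>m. (cmod (f m))\<^sup>2)" by (rule L2_integrable[OF f])
    show "AE m in haar G. (\<lambda>k. (cmod (f m - h k m))\<^sup>2) \<longlonglongrightarrow> 0"
    proof (rule AE_I2)
      fix m
      obtain k0 :: nat where "norm (coords G m) \<le> real k0" using real_arch_simple by blast
      then have "\<forall>\<^sub>F k in sequentially. (cmod (f m - h k m))\<^sup>2 = 0"
        by (intro eventually_sequentiallyI[of k0]) (auto simp: h_def B_def)
      then show "(\<lambda>k. (cmod (f m - h k m))\<^sup>2) \<longlonglongrightarrow> 0" by (rule tendsto_eventually)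
    qed
  qed (auto simp: h_def)
  then have "(\<lambda>k. (L2_norm (haar G) (\<lambda>m. f m - h k m))\<^sup>2) \<longlonglongrightarrow> 0"
    by (simp add: L2_norm_square)
  then show thesis using that L2 int by blast
qed

end

section \<open>The Plancherel transform\<close>

text \<open>The infimum over k has integral 0 and so vanishes almost everywhere. This takes the
  place of an almost everywhere convergent subsequence: one good index for each point and each
  \<epsilon> is enough.\<close>

lemma AE_small_if_integrals_tendsto_0:
  fixes F :: "nat \<Rightarrow> 'a \<Rightarrow> ennreal"
  assumes [measurable]: "\<And>k. F k \<in> borel_measurable M"
    and lim: "(\<lambda>k. \<integral>\<^sup>+x. F k x \<partial>M) \<longlonglongrightarrow> 0"
  shows "AE x in M. \<forall>\<epsilon>>0. \<exists>k. F k x < \<epsilon>"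
proof -
  have "(\<integral>\<^sup>+x. (INF k. F k x) \<partial>M) \<le> (\<integral>\<^sup>+x. F k x \<partial>M)" for k
    by (intro nn_integral_mono INF_lower) auto
  then have "(\<integral>\<^sup>+x. (INF k. F k x) \<partial>M) \<le> 0"
    by (intro LIMSEQ_le_const[OF lim]) auto
  then have "(\<integral>\<^sup>+x. (INF k. F k x) \<partial>M) = 0" by simp
  then have "AE x in M. (INF k. F k x) = 0"
    by (subst (asm) nn_integral_0_iff_AE) auto
  then show ?thesis
    by eventually_elim (metis INF_less_iff UNIV_I)
qed

locale nil_plancherel = nil_setting G
  for G :: "('n::t2_space, 'g::euclidean_space, 'z::{finite,linorder}, 'd::{finite,linorder}) nil_group"
    (structure) +
  fixes P :: "('n \<Rightarrow> complex) \<Rightarrow> (real, 'z) vec \<Rightarrow> (real, 'd) vec oper"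
  assumes plancherel: "plancherel_transform G P"
begin

abbreviation "\<mu> \<equiv> plancherel_measure G"
abbreviation "LG \<equiv> L2 (haar G)"
abbreviation "norm2 f \<equiv> (L2_norm (haar G) f)\<^sup>2"

lemma sets_\<mu> [simp, measurable_cong]: "sets \<mu> = sets borel"
  by (simp add: plancherel_measure_def)

lemma space_\<mu> [simp]: "space \<mu> = UNIV"
  by (simp add: plancherel_measure_def)

lemma AE_\<mu>_Sigma: "AE l in \<mu>. l \<in> Sigma_set G"
  unfolding plancherel_measure_def by (subst AE_density) (auto simp: Sigma_set_def)

lemma P_direct_integral: "f \<in> LG \<Longrightarrow> P f \<in> direct_integral G"
  using plancherel by (simp add: plancherel_transform_def)

lemma P_linear: "f \<in> LG \<Longrightarrow> L2_linear (P f l)"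
  using P_direct_integral by (simp add: direct_integral_def hilbert_schmidt_def)

lemma P_closed: "f \<in> LG \<Longrightarrow> v \<in> L2 lborel \<Longrightarrow> P f l v \<in> L2 lborel"
  using P_linear L2_linear_closed by blast

lemma P_hs_measurable: "f \<in> LG \<Longrightarrow> (\<lambda>l. hs_norm2 (P f l)) \<in> borel_measurable borel"
  using P_direct_integral by (simp add: direct_integral_def)

lemma P_lincomb:
  "f \<in> LG \<Longrightarrow> g \<in> LG \<Longrightarrow>
    AE l in \<mu>. oper_eq (P (\<lambda>x. a * f x + b * g x) l) (\<lambda>v t. a * P f l v t + b * P g l v t)"
  using plancherel unfolding plancherel_transform_def field_eq_def by blast

lemma P_diff:
  "f \<in> LG \<Longrightarrow> g \<in> LG \<Longrightarrow>
    AE l in \<mu>. oper_eq (P (\<lambda>x. f x - g x) l) (\<lambda>v t. P f l v t - P g l v t)"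
  using P_lincomb[of f g 1 "-1"] by simp

lemma P_norm: "f \<in> LG \<Longrightarrow> (\<integral>\<^sup>+l. hs_norm2 (P f l) \<partial>\<mu>) = ennreal (norm2 f)"
  using plancherel by (simp add: plancherel_transform_def)

lemma P_surj: "T \<in> direct_integral G \<Longrightarrow> \<exists>f\<in>LG. AE l in \<mu>. oper_eq (P f l) (T l)"
  using plancherel unfolding plancherel_transform_def field_eq_def by blast

lemma P_fourier: "f \<in> LG \<Longrightarrow> integrable (haar G) f \<Longrightarrow> AE l in \<mu>. is_fourier G f l (P f l)"
  using plancherel by (simp add: plancherel_transform_def)

text \<open>A relation between Fourier transforms of integrable functions passes to the Plancherel
  transform by continuity, because truncations are integrable and dense.\<close>

lemma P_intertwine:
  fixes R :: "(real, 'z) vec \<Rightarrow> (real, 'd) vec oper" and a :: complex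
  assumes \<tau>: "scales (haar G) \<tau> c" and \<sigma>: "scales \<mu> \<sigma> c'"
    and R: "\<And>l. L2_linear (R l)" "\<And>l v. L2_norm lborel (R l v) = L2_norm lborel v"
    and fourier: "\<And>f l T. is_fourier G f (\<sigma> l) T \<Longrightarrow>
        is_fourier G (\<lambda>m. complex_of_real (sqrt c) * f (\<tau> m)) l (\<lambda>v t. a * R l (T v) t)"
    and f: "f \<in> LG"
  shows "AE l in \<mu>. oper_eq (P (\<lambda>m. complex_of_real (sqrt c) * f (\<tau> m)) l) (\<lambda>v t. a * R l (P f (\<sigma> l) v) t)"
proof -
  define U where "U f = (\<lambda>m. complex_of_real (sqrt c) * f (\<tau> m))" for f :: "'n \<Rightarrow> complex"
  have U_L2: "U f \<in> LG" if "f \<in> LG" for f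
    unfolding U_def using that by (intro L2_scale) (simp add: scales_L2_iff[OF \<tau>])
  have U_norm: "norm2 (U f) = norm2 f" for f
    unfolding U_def by (simp add: scales_L2_norm[OF \<tau>])
  have U_int: "integrable (haar G) (U f)" if "integrable (haar G) f" for f
    unfolding U_def using that by (simp add: scales_integrable_iff[OF \<tau>])
  have U_diff: "U (\<lambda>m. f m - h m) = (\<lambda>m. U f m - U h m)" for f h
    by (simp add: U_def algebra_simps)
  obtain h where h: "\<And>k::nat. h k \<in> LG" "\<And>k. integrable (haar G) (h k)"
    "(\<lambda>k. norm2 (\<lambda>m. f m - h k m)) \<longlonglongrightarrow> 0"
    by (rule L2_truncation[OF f]) (rule that)
  define e where "e k = (\<lambda>m. f m - h k m)" for k
  have e: "e k \<in> LG" for k unfolding e_def by (intro L2_diff f h)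
  have Ue: "U (e k) = (\<lambda>m. U f m - U (h k) m)" for k unfolding e_def by (rule U_diff)
  \<comment> \<open>For every k this will bound the Hilbert-Schmidt defect of the claimed identity
    at l: the identity is exact for \<open>h k\<close>, so only the errors of \<open>e k\<close>
    contribute.\<close>
  define F where "F k l = 2 * hs_norm2 (P (U (e k)) l) + 2 * (ennreal ((cmod a)\<^sup>2) * hs_norm2 (P (e k) (\<sigma> l)))" for k l
  note [measurable] = P_hs_measurable[OF e] P_hs_measurable[OF U_L2[OF e]]
  have \<sigma>m [measurable]: "\<sigma> \<in> borel_measurable borel"
    using scales_measurable[OF \<sigma>] by (simp add: measurable_cong_sets[OF sets_\<mu> sets_\<mu>])
  have c': "c' > 0" by (rule scales_pos[OF \<sigma>])
  \<comment> \<open>Changing the parameter in the isometry costs 1 / c', a factor independent of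
    k.\<close>
  have int\<sigma>: "(\<integral>\<^sup>+l. hs_norm2 (P (e k) (\<sigma> l)) \<partial>\<mu>) = ennreal (norm2 (e k) / c')" for k
  proof -
    have "ennreal (norm2 (e k)) = ennreal c' * (\<integral>\<^sup>+l. hs_norm2 (P (e k) (\<sigma> l)) \<partial>\<mu>)"
      unfolding P_norm[OF e, symmetric] by (rule scales_nn_integral[OF \<sigma>]) simp
    then have "ennreal (1 / c') * ennreal (norm2 (e k)) =
        ennreal (1 / c') * ennreal c' * (\<integral>\<^sup>+l. hs_norm2 (P (e k) (\<sigma> l)) \<partial>\<mu>)"
      by (simp add: mult.assoc)
    then show ?thesis using c' by (simp flip: ennreal_mult)
  qed
  have F_int: "(\<integral>\<^sup>+l. F k l \<partial>\<mu>) = ennreal ((2 + 2 * (cmod a)\<^sup>2 / c') * norm2 (e k))" for k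
  proof -
    have "(\<integral>\<^sup>+l. F k l \<partial>\<mu>) = 2 * ennreal (norm2 (e k)) + 2 * (ennreal ((cmod a)\<^sup>2) * ennreal (norm2 (e k) / c'))"
      unfolding F_def
      by (simp add: nn_integral_add nn_integral_cmult int\<sigma> P_norm[OF U_L2[OF e]] U_norm)
    also have "\<dots> = ennreal (2 * norm2 (e k) + 2 * ((cmod a)\<^sup>2 * (norm2 (e k) / c')))"
    proof -
      have "2 * ennreal x + 2 * (ennreal y * ennreal z) = ennreal (2 * x + 2 * (y * z))"
        if "x \<ge> 0" "y \<ge> 0" "z \<ge> 0" for x y z
        using that by (simp add: ennreal_plus ennreal_mult)
      then show ?thesis using c' by simp
    qed
    also have "2 * norm2 (e k) + 2 * ((cmod a)\<^sup>2 * (norm2 (e k) / c')) = (2 + 2 * (cmod a)\<^sup>2 / c') * norm2 (e k)"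
      by (simp add: algebra_simps)
    finally show ?thesis .
  qed
  have "(\<lambda>k. ennreal ((2 + 2 * (cmod a)\<^sup>2 / c') * norm2 (e k))) \<longlonglongrightarrow> ennreal ((2 + 2 * (cmod a)\<^sup>2 / c') * 0)"
    using h(3) unfolding e_def by (intro tendsto_ennrealI tendsto_mult_left)
  then have "(\<lambda>k. \<integral>\<^sup>+l. F k l \<partial>\<mu>) \<longlonglongrightarrow> 0" unfolding F_int by simp
  moreover have "F k \<in> borel_measurable \<mu>" for k unfolding F_def by measurable
  ultimately have small: "AE l in \<mu>. \<forall>\<epsilon>>0. \<exists>k. F k l < \<epsilon>"
    by (intro AE_small_if_integrals_tendsto_0)
  \<comment> \<open>The exceptional sets depend on k, but countably many of them still have a null
    union.\<close>
  have "AE l in \<mu>. \<forall>k. is_fourier G (h k) (\<sigma> l) (P (h k) (\<sigma> l))"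
    by (subst AE_all_countable) (intro allI scales_AE[OF \<sigma>] P_fourier h)
  moreover have "AE l in \<mu>. \<forall>k. is_fourier G (U (h k)) l (P (U (h k)) l)"
    by (subst AE_all_countable) (intro allI P_fourier U_L2 U_int h)
  moreover have "AE l in \<mu>. \<forall>k. oper_eq (P (U (e k)) l) (\<lambda>v t. P (U f) l v t - P (U (h k)) l v t)"
    unfolding Ue by (subst AE_all_countable) (intro allI P_diff U_L2 h f)
  moreover have "AE l in \<mu>. \<forall>k. oper_eq (P (e k) (\<sigma> l)) (\<lambda>v t. P f (\<sigma> l) v t - P (h k) (\<sigma> l) v t)"
    unfolding e_def by (subst AE_all_countable) (intro allI scales_AE[OF \<sigma>] P_diff h f)
  ultimately have "AE l in \<mu>. oper_eq (P (U f) l) (\<lambda>v t. a * R l (P f (\<sigma> l) v) t)"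
    using small
  proof eventually_elim
    case (elim l)
    have W: "L2_linear (\<lambda>v t. a * R l (P g (\<sigma> l) v) t)" if "g \<in> LG" for g
      by (intro L2_linear_cmult L2_linear_compose[OF R(1)] P_linear that)
    have bound: "hs_norm2 (\<lambda>v t. P (U f) l v t - a * R l (P f (\<sigma> l) v) t) \<le> F k l" for k
    proof -
      \<comment> \<open>Both operators are weak Fourier transforms of \<open>U (h k)\<close> at l,
        the first by the defining property of \<open>P\<close> and the second by the assumed
        relation \<open>fourier\<close>.\<close>
      have mid: "oper_eq (P (U (h k)) l) (\<lambda>v t. a * R l (P (h k) (\<sigma> l) v) t)"
      proof (rule is_fourier_unique)
        show "is_fourier G (U (h k)) l (P (U (h k)) l)" using elim by blast
        show "is_fourier G (U (h k)) l (\<lambda>v t. a * R l (P (h k) (\<sigma> l) v) t)"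
          unfolding U_def by (intro fourier) (use elim in blast)
      qed
      define A where "A v t = P (U (e k)) l v t" for v t
      define B where "B v t = (- a) * R l (P (e k) (\<sigma> l) v) t" for v t
      have A: "A v \<in> L2 lborel" if "v \<in> L2 lborel" for v
        unfolding A_def using P_closed[OF U_L2[OF e] that] by simp
      have B: "B v \<in> L2 lborel" if "v \<in> L2 lborel" for v
        unfolding B_def by (intro L2_scale L2_linear_closed[OF R(1)] P_closed e that)
      have "hs_norm2 (\<lambda>v t. P (U f) l v t - a * R l (P f (\<sigma> l) v) t) = hs_norm2 (\<lambda>v t. A v t + B v t)"
      proof (rule hs_norm2_cong)
        show "oper_eq (\<lambda>v t. P (U f) l v t - a * R l (P f (\<sigma> l) v) t) (\<lambda>v t. A v t + B v t)"
          unfolding oper_eq_def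
        proof
          fix v :: "(real, 'd) vec \<Rightarrow> complex" assume v: "v \<in> L2 lborel"
          have 1: "AE t in lborel. A v t = P (U f) l v t - P (U (h k)) l v t"
            using elim v unfolding A_def oper_eq_def by blast
          have 2: "AE t in lborel. P (U (h k)) l v t = a * R l (P (h k) (\<sigma> l) v) t"
            using mid v unfolding oper_eq_def by blast
          have "AE t in lborel. P (e k) (\<sigma> l) v t = 1 * P f (\<sigma> l) v t + (-1) * P (h k) (\<sigma> l) v t"
            using elim v unfolding oper_eq_def by simp
          \<comment> \<open>\<open>R l\<close> is linear only up to null sets, so the splitting of
            the error passes through it in two moves: exchange of the argument here, then
            linearity.\<close>
          then have 3: "AE t in lborel. R l (P (e k) (\<sigma> l) v) t
              = R l (\<lambda>t. 1 * P f (\<sigma> l) v t + (-1) * P (h k) (\<sigma> l) v t) t"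
            by (intro L2_linear_cong[OF R(1)] P_closed e v L2_lincomb f h)
          have 4: "AE t in lborel. R l (\<lambda>t. 1 * P f (\<sigma> l) v t + (-1) * P (h k) (\<sigma> l) v t) t
              = 1 * R l (P f (\<sigma> l) v) t + (-1) * R l (P (h k) (\<sigma> l) v) t"
            by (intro L2_linear_lincomb[OF R(1)] P_closed f h v)
          from 3 4 have 5: "AE t in lborel. R l (P (e k) (\<sigma> l) v) t = R l (P f (\<sigma> l) v) t - R l (P (h k) (\<sigma> l) v) t"
            by eventually_elim simp
          show "AE t in lborel. P (U f) l v t - a * R l (P f (\<sigma> l) v) t = A v t + B v t"
            using 1 2 5 by eventually_elim (simp add: B_def right_diff_distrib)
        qed
      next
        fix v :: "(real, 'd) vec \<Rightarrow> complex" assume v: "v \<in> L2 lborel"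
        show "(\<lambda>t. P (U f) l v t - a * R l (P f (\<sigma> l) v) t) \<in> L2 lborel"
          by (rule L2_diff[OF P_closed[OF U_L2[OF f] v] L2_linear_closed[OF W[OF f] v]])
        show "(\<lambda>t. A v t + B v t) \<in> L2 lborel" by (rule L2_add[OF A[OF v] B[OF v]])
      qed
      also have "\<dots> \<le> 2 * hs_norm2 A + 2 * hs_norm2 B"
        by (rule hs_norm2_add_le) (use A B in auto)
      also have "hs_norm2 B = ennreal ((cmod a)\<^sup>2) * hs_norm2 (\<lambda>v. R l (P (e k) (\<sigma> l) v))"
        unfolding B_def using hs_norm2_scale[of "- a" "\<lambda>v. R l (P (e k) (\<sigma> l) v)"] by simp
      also have "hs_norm2 (\<lambda>v. R l (P (e k) (\<sigma> l) v)) = hs_norm2 (P (e k) (\<sigma> l))"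
        by (rule hs_norm2_cong_norm) (simp add: R(2))
      also have "hs_norm2 A = hs_norm2 (P (U (e k)) l)"
        unfolding A_def ..
      finally show ?thesis by (simp add: F_def)
    qed
    show ?case
    proof (rule oper_eq_approx[OF P_linear[OF U_L2[OF f]] W[OF f]])
      fix \<epsilon> :: real assume "\<epsilon> > 0"
      then obtain k where "F k l < ennreal \<epsilon>" using elim(5)[rule_format, of "ennreal \<epsilon>"] by auto
      with bound[of k] show "hs_norm2 (\<lambda>v t. P (U f) l v t - a * R l (P f (\<sigma> l) v) t) < ennreal \<epsilon>"
        by (rule le_less_trans)
    qed
  qed
  then show ?thesis by (simp add: U_def)
qed

section \<open>Covariance of the Plancherel transform under translations and dilations\<close>

lemma left_transl_eq: "left_transl G m f = (\<lambda>x. complex_of_real (sqrt 1) * f (inv m \<otimes> x))"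
  by (simp add: left_transl_def)

lemma left_transl_L2: "f \<in> LG \<Longrightarrow> left_transl G m f \<in> LG"
  using scales_L2_iff[OF scales_haar_left[of "inv m"], of f] by (simp add: left_transl_def)

text \<open>An instance of \<open>P_intertwine\<close> in which the parameter stays fixed, both
  scaling factors are 1 and the isometry is \<open>rep G l m\<close>; \<open>sqrt 1\<close> is kept
  to match its form.\<close>

lemma P_left_transl:
  assumes "f \<in> LG"
  shows "AE l in \<mu>. oper_eq (P (left_transl G m f) l) (\<lambda>v. rep G l m (P f l v))"
proof -
  have "AE l in \<mu>. oper_eq (P (\<lambda>x. complex_of_real (sqrt 1) * f (inv m \<otimes> x)) l) (\<lambda>v t. 1 * rep G l m (P f l v) t)"
  proof (rule P_intertwine[OF scales_haar_left scales_id L2_linear_rep rep_norm _ assms])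
    fix f l T assume "is_fourier G f l T"
    from is_fourier_left_transl[OF this, of m]
    show "is_fourier G (\<lambda>x. complex_of_real (sqrt 1) * f (inv m \<otimes> x)) l (\<lambda>v t. 1 * rep G l m (T v) t)"
      unfolding left_transl_eq by simp
  qed
  then show ?thesis unfolding left_transl_eq by simp
qed

text \<open>The Jacobian of A^j on the group, and equally the factor of the Plancherel measure under
  multiplication of l by 2^j.\<close>

definition dil_factor :: "int \<Rightarrow> real" where "dil_factor j = (2 powi j) ^ (CARD('z) + CARD('d))"

lemma scales_dil: "scales (haar G) (dil_real (2 powi j)) (dil_factor j)"
  unfolding dil_factor_def by (rule scales_dil_real) simp

lemma dil_op_dil_factor: "dil_op G j f = (\<lambda>m. complex_of_real (sqrt (dil_factor (- j))) * f (dil_real (2 powi (- j)) m))"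
  by (simp add: dil_op_eq dil_factor_def)

lemma dil_op_L2: "f \<in> LG \<Longrightarrow> dil_op G j f \<in> LG"
  unfolding dil_op_dil_factor by (intro L2_scale) (simp add: scales_L2_iff[OF scales_dil])

lemma dil_op_inner: "L2_inner (haar G) (dil_op G j f) (dil_op G j g) = L2_inner (haar G) f g"
  unfolding dil_op_dil_factor by (rule scales_L2_inner[OF scales_dil])

lemma dil_op_norm: "L2_norm (haar G) (dil_op G j f) = L2_norm (haar G) f"
  unfolding dil_op_dil_factor by (rule scales_L2_norm[OF scales_dil])

lemma dil_op_inverse: "dil_op G j (dil_op G (- j) f) = f"
proof -
  have "sqrt (dil_factor (- j)) * sqrt (dil_factor j) = 1"
    by (simp add: dil_factor_def real_sqrt_mult[symmetric] power_mult_distrib[symmetric] power_int_add[symmetric])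
  then have "complex_of_real (sqrt (dil_factor (- j))) * complex_of_real (sqrt (dil_factor j)) = 1"
    by (simp flip: of_real_mult)
  moreover have "2 powi j * 2 powi (- j) = (1::real)"
    by (simp add: power_int_add[symmetric])
  ultimately show ?thesis
    by (simp add: dil_op_dil_factor dil_real_dil_real mult.assoc[symmetric])
qed

text \<open>Here \<tau> is A^(-j), \<sigma> is multiplication by 2^j and the isometry is the
  identity. The constant equals 2^(j(n-d)/2) and compensates the change of variables in l.\<close>

lemma P_dil_op:
  assumes "f \<in> LG"
  shows "AE l in \<mu>. oper_eq (P (dil_op G j f) l)
    (\<lambda>v t. complex_of_real (1 / sqrt (dil_factor (- j))) * P f ((2 powi j) *\<^sub>R l) v t)"
  unfolding dil_op_dil_factor
proof (rule P_intertwine[OF scales_dil scales_plancherel[of "2 powi j"] _ _ _ assms, where R = "\<lambda>l v. v"])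
  fix f l T assume "is_fourier G f ((2 powi j) *\<^sub>R l) T"
  then have "is_fourier G f (inverse (2 powi (- j)) *\<^sub>R l) T"
    by (simp add: power_int_minus)
  from is_fourier_dil[OF this]
  show "is_fourier G (\<lambda>m. complex_of_real (sqrt (dil_factor (- j))) * f (dil_real (2 powi (- j)) m)) l
      (\<lambda>v t. complex_of_real (1 / sqrt (dil_factor (- j))) * T v t)"
    by (simp add: dil_factor_def)
qed (auto simp: L2_linear_def)

end

section \<open>Spaces of rank-one fields\<close>

lemma L2_norm_minus_commute: "L2_norm M (\<lambda>x. f x - g x) = L2_norm M (\<lambda>x. g x - f x)"
  by (simp add: L2_norm_def norm_minus_commute)

locale nil_unit_vector = nil_plancherel G P
  for G :: "('n::t2_space, 'g::euclidean_space, 'z::{finite,linorder}, 'd::{finite,linorder}) nil_group"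
    (structure)
  and P :: "('n \<Rightarrow> complex) \<Rightarrow> (real, 'z) vec \<Rightarrow> (real, 'd) vec oper" +
  fixes u :: "(real, 'd) vec \<Rightarrow> complex"
  assumes u: "u \<in> L2 lborel" "L2_norm lborel u = 1"
begin

definition fibre :: "(real, 'z) vec set \<Rightarrow> (real, 'z) vec \<Rightarrow> (real, 'd) vec oper \<Rightarrow> bool" where
  "fibre S l T \<longleftrightarrow> (if l \<in> S then T \<in> tensor_vec u else oper_eq T (\<lambda>v t. 0))"

text \<open>The \<open>H_E\<close> and their direct sum are all of this form, with S a tile or
  \<open>Sigma_set G\<close>, so closedness and invariance are shown once for every S.\<close>

definition V :: "(real, 'z) vec set \<Rightarrow> ('n \<Rightarrow> complex) set" where
  "V S = {f \<in> LG. AE l in \<mu>. fibre S l (P f l)}"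

lemma plancherel_preimage_eq_V:
  "plancherel_preimage G P (direct_integral_on G S (\<lambda>l. tensor_vec u)) = V S"
  using P_direct_integral
  by (auto simp: plancherel_preimage_def direct_integral_on_def V_def fibre_def)

lemma V_L2: "f \<in> V S \<Longrightarrow> f \<in> LG"
  by (simp add: V_def)

lemma V_fibre: "f \<in> V S \<Longrightarrow> AE l in \<mu>. fibre S l (P f l)"
  by (simp add: V_def)

lemma fibre_cong: "fibre S l T \<Longrightarrow> oper_eq T' T \<Longrightarrow> L2_linear T' \<Longrightarrow> fibre S l T'"
  unfolding fibre_def using tensor_vec_cong[of T u T'] oper_eq_trans[of T' T] by (auto split: if_splits)

lemma fibre_zero: "fibre S l (\<lambda>v t. 0)"
  by (simp add: fibre_def)

lemma fibre_mono:
  assumes "fibre S l T" "S \<subseteq> S'" "L2_linear T"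
  shows "fibre S' l T"
  using assms tensor_vec_cong[OF tensor_vec_zero, of T u] by (auto simp: fibre_def split: if_splits)

text \<open>Both cases of the fibre condition say that the operator annihilates a set of vectors.\<close>

lemma fibre_iff:
  assumes "L2_linear T"
  shows "fibre S l T \<longleftrightarrow>
    (\<forall>v\<in>L2 lborel. (l \<in> S \<longrightarrow> L2_inner lborel v u = 0) \<longrightarrow> (AE t in lborel. T v t = 0))"
  using tensor_vec_iff[OF u assms] by (auto simp: fibre_def oper_eq_def)

lemma fibre_lincomb:
  assumes "L2_linear S" "L2_linear T" "fibre A l S" "fibre A l T"
  shows "fibre A l (\<lambda>v t. a * S v t + b * T v t)"
  unfolding fibre_iff[OF L2_linear_combination[OF assms(1,2)]]
proof (intro ballI impI)
  fix v :: "(real, 'd) vec \<Rightarrow> complex" assume "v \<in> L2 lborel" "l \<in> A \<longrightarrow> L2_inner lborel v u = 0"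
  then have "AE t in lborel. S v t = 0" "AE t in lborel. T v t = 0"
    using assms(3)[unfolded fibre_iff[OF assms(1)]] assms(4)[unfolded fibre_iff[OF assms(2)]] by blast+
  then show "AE t in lborel. a * S v t + b * T v t = 0" by eventually_elim simp
qed

lemma fibre_approx:
  assumes T: "L2_linear T"
    and small: "\<And>\<epsilon>::real. \<epsilon> > 0 \<Longrightarrow> \<exists>S. L2_linear S \<and> fibre A l S \<and> hs_norm2 (\<lambda>w t. T w t - S w t) < ennreal \<epsilon>"
  shows "fibre A l T"
  unfolding fibre_iff[OF T]
proof (intro ballI impI L2_linear_approx_zero[OF T])
  fix v :: "(real, 'd) vec \<Rightarrow> complex" and \<epsilon> :: real
  assume v: "v \<in> L2 lborel" "l \<in> A \<longrightarrow> L2_inner lborel v u = 0" and "\<epsilon> > 0"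
  obtain S where S: "L2_linear S" "fibre A l S" "hs_norm2 (\<lambda>w t. T w t - S w t) < ennreal \<epsilon>"
    using small[OF \<open>\<epsilon> > 0\<close>] by (elim exE conjE) (rule that)
  have "AE t in lborel. S v t = 0"
    using S(2)[unfolded fibre_iff[OF S(1)]] v by blast
  with S(1,3) show "\<exists>S. L2_linear S \<and> (AE t in lborel. S v t = 0) \<and>
      hs_norm2 (\<lambda>w t. T w t - S w t) < ennreal \<epsilon>"
    by (intro exI[of _ S] conjI)
qed

lemma V_lincomb:
  assumes "f \<in> V S" "g \<in> V S"
  shows "(\<lambda>x. a * f x + b * g x) \<in> V S"
proof -
  have L: "(\<lambda>x. a * f x + b * g x) \<in> LG" using assms by (intro L2_lincomb V_L2)
  have "AE l in \<mu>. fibre S l (P (\<lambda>x. a * f x + b * g x) l)"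
    using V_fibre[OF assms(1)] V_fibre[OF assms(2)] P_lincomb[OF V_L2[OF assms(1)] V_L2[OF assms(2)], of a b]
  proof eventually_elim
    case (elim l)
    show ?case
      by (rule fibre_cong[OF fibre_lincomb elim(3) P_linear[OF L]])
         (use elim assms in \<open>auto intro: P_linear V_L2\<close>)
  qed
  with L show ?thesis by (simp add: V_def)
qed

lemma V_zero: "(\<lambda>x. 0) \<in> V S"
proof -
  have "AE l in \<mu>. oper_eq (P (\<lambda>x. 0) l) (\<lambda>v t. 0)"
    using P_lincomb[OF L2_zero L2_zero, of 0 0] by simp
  then have "AE l in \<mu>. fibre S l (P (\<lambda>x. 0) l)"
    by eventually_elim (rule fibre_cong[OF fibre_zero _ P_linear[OF L2_zero]])
  then show ?thesis by (simp add: V_def)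
qed

lemma V_sum: "(\<And>i. i \<in> F \<Longrightarrow> g i \<in> V S) \<Longrightarrow> (\<lambda>x. \<Sum>i\<in>F. g i x) \<in> V S"
proof (induction F rule: infinite_finite_induct)
  case (insert i F)
  then show ?case using V_lincomb[of "g i" S "\<lambda>x. \<Sum>i\<in>F. g i x" 1 1] by simp
qed (simp_all add: V_zero)

lemma V_mono: "S \<subseteq> S' \<Longrightarrow> V S \<subseteq> V S'"
proof
  fix f assume "S \<subseteq> S'" and f: "f \<in> V S"
  from V_fibre[OF f] have "AE l in \<mu>. fibre S' l (P f l)"
    by eventually_elim (rule fibre_mono[OF _ \<open>S \<subseteq> S'\<close> P_linear[OF V_L2[OF f]]])
  with f show "f \<in> V S'" by (simp add: V_def)
qed

text \<open>By the isometry the L2 error is an integral of Hilbert-Schmidt errors. At almost every l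
  the operator \<open>P f l\<close> is thus approximated by operators satisfying the fibre
  condition, which is a closed one.\<close>

lemma V_limit:
  assumes s: "\<And>k::nat. s k \<in> V S" and f: "f \<in> LG"
    and lim: "(\<lambda>k. L2_norm (haar G) (\<lambda>x. s k x - f x)) \<longlonglongrightarrow> 0"
  shows "f \<in> V S"
proof -
  have e: "(\<lambda>x. f x - s k x) \<in> LG" for k by (intro L2_diff f V_L2[OF s])
  define F where "F k l = hs_norm2 (P (\<lambda>x. f x - s k x) l)" for k l
  have "(\<lambda>k. ennreal (norm2 (\<lambda>x. f x - s k x))) \<longlonglongrightarrow> ennreal (0\<^sup>2)"
    unfolding L2_norm_minus_commute[of _ f] by (intro tendsto_ennrealI tendsto_power lim)
  then have "(\<lambda>k. \<integral>\<^sup>+l. F k l \<partial>\<mu>) \<longlonglongrightarrow> 0" by (simp add: F_def P_norm[OF e])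
  moreover have "F k \<in> borel_measurable \<mu>" for k
    unfolding F_def using P_hs_measurable[OF e] by simp
  ultimately have small: "AE l in \<mu>. \<forall>\<epsilon>>0. \<exists>k. F k l < \<epsilon>"
    by (intro AE_small_if_integrals_tendsto_0)
  have "AE l in \<mu>. \<forall>k. fibre S l (P (s k) l)"
    by (subst AE_all_countable) (intro allI V_fibre s)
  moreover have "AE l in \<mu>. \<forall>k. oper_eq (P (\<lambda>x. f x - s k x) l) (\<lambda>v t. P f l v t - P (s k) l v t)"
    by (subst AE_all_countable) (intro allI P_diff f V_L2[OF s])
  ultimately have "AE l in \<mu>. fibre S l (P f l)"
    using small
  proof eventually_elim
    case (elim l)
    show ?case
    proof (rule fibre_approx[OF P_linear[OF f]])
      fix \<epsilon> :: real assume "\<epsilon> > 0"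
      then obtain k where k: "F k l < ennreal \<epsilon>" using elim(3)[rule_format, of "ennreal \<epsilon>"] by auto
      have "hs_norm2 (\<lambda>v t. P f l v t - P (s k) l v t) = F k l"
        unfolding F_def
      proof (rule hs_norm2_cong)
        show "oper_eq (\<lambda>v t. P f l v t - P (s k) l v t) (P (\<lambda>x. f x - s k x) l)"
          by (rule oper_eq_sym) (use elim in blast)
      qed (intro L2_diff P_closed f V_L2[OF s] e; assumption)+
      with k have "hs_norm2 (\<lambda>v t. P f l v t - P (s k) l v t) < ennreal \<epsilon>" by simp
      then show "\<exists>T. L2_linear T \<and> fibre S l T \<and> hs_norm2 (\<lambda>w t. P f l w t - T w t) < ennreal \<epsilon>"
        using elim(1) P_linear[OF V_L2[OF s[of k]], of l] by (intro exI[of _ "P (s k) l"] conjI) auto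
    qed
  qed
  with f show ?thesis by (simp add: V_def)
qed

lemma V_closed_subspace: "L2_closed_subspace (haar G) (V S)"
  unfolding L2_closed_subspace_def
proof (intro conjI allI ballI impI)
  show "V S \<subseteq> LG" by (auto simp: V_def)
  fix f g c assume f: "f \<in> V S"
  show "(\<lambda>x. c * f x) \<in> V S" using V_lincomb[OF f f, of c 0] by simp
  show "(\<lambda>x. f x + g x) \<in> V S" if "g \<in> V S" using V_lincomb[OF f that, of 1 1] by simp
next
  fix s f assume s: "f \<in> LG" "\<forall>k. s k \<in> V S" "(\<lambda>k. L2_norm (haar G) (\<lambda>x. s k x - f x)) \<longlonglongrightarrow> 0"
  show "f \<in> V S" by (rule V_limit[OF spec[OF s(2)] s(1,3)])
qed (fact V_zero)

text \<open>At almost every parameter at most one of the two transforms is nonzero, so the squared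
  Hilbert-Schmidt norms add for f + c g. Integration gives Pythagoras for every unimodular
  c.\<close>

lemma V_orthogonal:
  assumes f: "f \<in> V S" and g: "g \<in> V S'" and disj: "S \<inter> S' = {}"
  shows "L2_inner (haar G) f g = 0"
proof (rule L2_orthogonal_if_pythagoras[OF V_L2[OF f] V_L2[OF g]])
  fix c :: complex assume c: "cmod c = 1"
  define h where "h = (\<lambda>x. 1 * f x + c * g x)"
  have h: "h \<in> LG" unfolding h_def by (intro L2_lincomb V_L2[OF f] V_L2[OF g])
  note fL = V_L2[OF f] and gL = V_L2[OF g]
  have "ennreal (norm2 h) = (\<integral>\<^sup>+l. hs_norm2 (P h l) \<partial>\<mu>)" by (rule P_norm[OF h, symmetric])
  also have "\<dots> = (\<integral>\<^sup>+l. hs_norm2 (P f l) + hs_norm2 (P g l) \<partial>\<mu>)"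
  proof (rule nn_integral_cong_AE)
    show "AE l in \<mu>. hs_norm2 (P h l) = hs_norm2 (P f l) + hs_norm2 (P g l)"
      using V_fibre[OF f] V_fibre[OF g] P_lincomb[OF fL gL, of 1 c]
    proof eventually_elim
      case (elim l)
      have zero: "hs_norm2 (P k l) = 0" if "k \<in> LG" "oper_eq (P k l) (\<lambda>v t. 0)" for k
        using hs_norm2_cong[OF that(2)] P_closed[OF that(1)] by simp
      have hv: "AE t in lborel. P h l v t = P f l v t + c * P g l v t" if "v \<in> L2 lborel" for v
        using elim(3) that by (simp add: oper_eq_def h_def)
      show ?case
      proof (cases "l \<in> S")
        case True
        then have "l \<notin> S'" using disj by blast
        then have g0: "oper_eq (P g l) (\<lambda>v t. 0)" using elim(2) by (simp add: fibre_def)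
        have "oper_eq (P h l) (P f l)"
          unfolding oper_eq_def
        proof
          fix v :: "(real, 'd) vec \<Rightarrow> complex" assume v: "v \<in> L2 lborel"
          have "AE t in lborel. P g l v t = 0" using g0 v by (simp add: oper_eq_def)
          with hv[OF v] show "AE t in lborel. P h l v t = P f l v t" by eventually_elim simp
        qed
        then have "hs_norm2 (P h l) = hs_norm2 (P f l)"
          by (rule hs_norm2_cong) (rule P_closed[OF h] P_closed[OF fL]; assumption)+
        then show ?thesis using zero[OF gL g0] by simp
      next
        case False
        then have f0: "oper_eq (P f l) (\<lambda>v t. 0)" using elim(1) by (auto simp: fibre_def)
        have "oper_eq (P h l) (\<lambda>v t. c * P g l v t)"
          unfolding oper_eq_def
        proof
          fix v :: "(real, 'd) vec \<Rightarrow> complex" assume v: "v \<in> L2 lborel"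
          have "AE t in lborel. P f l v t = 0" using f0 v by (simp add: oper_eq_def)
          with hv[OF v] show "AE t in lborel. P h l v t = c * P g l v t" by eventually_elim simp
        qed
        then have "hs_norm2 (P h l) = hs_norm2 (\<lambda>v t. c * P g l v t)"
          by (rule hs_norm2_cong) (rule P_closed[OF h] L2_scale[OF P_closed[OF gL]]; assumption)+
        then show ?thesis using zero[OF fL f0] c by (simp add: hs_norm2_scale)
      qed
    qed
  qed
  also have "\<dots> = ennreal (norm2 f) + ennreal (norm2 g)"
    using P_hs_measurable[OF fL] P_hs_measurable[OF gL] by (simp add: nn_integral_add P_norm[OF fL] P_norm[OF gL])
  finally have "ennreal (norm2 h) = ennreal (norm2 f + norm2 g)" by simp
  then have "norm2 h = norm2 f + norm2 g" by (simp del: ennreal_plus)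
  then show "norm2 (\<lambda>x. f x + c * g x) = norm2 f + norm2 g" by (simp add: h_def)
qed

text \<open>An isometry applied after an operator keeps the vectors that the operator annihilates,
  and the fibre condition concerns these alone.\<close>

lemma V_left_transl:
  assumes f: "f \<in> V S"
  shows "left_transl G m f \<in> V S"
proof -
  have L: "left_transl G m f \<in> LG" by (intro left_transl_L2 V_L2[OF f])
  have "AE l in \<mu>. fibre S l (P (left_transl G m f) l)"
    using V_fibre[OF f] P_left_transl[OF V_L2[OF f], of m]
  proof eventually_elim
    case (elim l)
    have lin: "L2_linear (\<lambda>v. rep G l m (P f l v))"
      by (intro L2_linear_compose[OF L2_linear_rep] P_linear V_L2[OF f])
    have "fibre S l (\<lambda>v. rep G l m (P f l v))"
      unfolding fibre_iff[OF lin]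
    proof (intro ballI impI)
      fix v :: "(real, 'd) vec \<Rightarrow> complex" assume v: "v \<in> L2 lborel" "l \<in> S \<longrightarrow> L2_inner lborel v u = 0"
      then have "AE t in lborel. P f l v t = 0"
        using elim(1)[unfolded fibre_iff[OF P_linear[OF V_L2[OF f]]]] by blast
      then have "L2_norm lborel (rep G l m (P f l v)) = 0"
        by (simp add: rep_norm L2_norm_eq_0_AE)
      then show "AE t in lborel. rep G l m (P f l v) t = 0"
        by (rule L2_norm_zero_AE[OF rep_L2[OF P_closed[OF V_L2[OF f] v(1)]]])
    qed
    then show ?case by (rule fibre_cong[OF _ elim(2) P_linear[OF L]])
  qed
  with L show ?thesis by (simp add: V_def)
qed

lemma V_dil_op:
  assumes f: "f \<in> V S"
  shows "dil_op G j f \<in> V {l. (2 powi j) *\<^sub>R l \<in> S}"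
proof -
  note fL = V_L2[OF f]
  have L: "dil_op G j f \<in> LG" by (intro dil_op_L2 fL)
  \<comment> \<open>Dilations preserve the null sets of the Plancherel measure, so the condition may
    be evaluated at 2^j l.\<close>
  have "AE l in \<mu>. fibre S ((2 powi j) *\<^sub>R l) (P f ((2 powi j) *\<^sub>R l))"
    by (rule scales_AE[OF scales_plancherel V_fibre[OF f]]) simp
  with P_dil_op[OF fL, of j]
  have "AE l in \<mu>. fibre {l. (2 powi j) *\<^sub>R l \<in> S} l (P (dil_op G j f) l)"
  proof eventually_elim
    case (elim l)
    define c where "c = complex_of_real (1 / sqrt (dil_factor (- j)))"
    have "fibre S ((2 powi j) *\<^sub>R l) (\<lambda>v t. c * P f ((2 powi j) *\<^sub>R l) v t)"
      using fibre_lincomb[OF P_linear[OF fL] P_linear[OF fL] elim(2) elim(2), of c 0] by simp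
    then have "fibre S ((2 powi j) *\<^sub>R l) (P (dil_op G j f) l)"
      by (rule fibre_cong[OF _ _ P_linear[OF L]]) (use elim(1) in \<open>simp add: c_def\<close>)
    then show ?case by (simp add: fibre_def)
  qed
  with L show ?thesis by (simp add: V_def)
qed

section \<open>Parts of a function over sets of parameters\<close>

definition restricts :: "('n \<Rightarrow> complex) \<Rightarrow> (real, 'z) vec set \<Rightarrow> ('n \<Rightarrow> complex) \<Rightarrow> bool" where
  "restricts h S g \<longleftrightarrow> g \<in> LG \<and> (AE l in \<mu>. oper_eq (P g l) (if l \<in> S then P h l else (\<lambda>v t. 0)))"

text \<open>Surjectivity of \<open>P\<close> is applied to the field of h cut off outside S. The
  part obtained is unique only almost everywhere, hence a relation instead of a function.\<close>

lemma restricts_exists: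
  assumes h: "h \<in> LG" and [measurable]: "S \<in> sets borel"
  shows "\<exists>g. restricts h S g"
proof -
  define T where "T l = (if l \<in> S then P h l else (\<lambda>v t. 0))" for l
  note Ph = P_direct_integral[OF h, unfolded direct_integral_def, simplified]
  have hs: "hs_norm2 (T l) = (if l \<in> S then hs_norm2 (P h l) else 0)" for l
    by (simp add: T_def)
  have [measurable]: "(\<lambda>l. hs_norm2 (P h l)) \<in> borel_measurable borel" by (rule P_hs_measurable[OF h])
  have "T \<in> direct_integral G"
    unfolding direct_integral_def
  proof (intro CollectI conjI allI ballI)
    show "hilbert_schmidt (T l)" for l
      using Ph by (auto simp: T_def hilbert_schmidt_def)
    show "(\<lambda>l. L2_inner lborel (T l f) g) \<in> borel_measurable borel" if "f \<in> L2 lborel" "g \<in> L2 lborel" for f g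
    proof -
      have [measurable]: "(\<lambda>l. L2_inner lborel (P h l f) g) \<in> borel_measurable borel"
        using Ph that by blast
      have "(\<lambda>l. L2_inner lborel (T l f) g) = (\<lambda>l. if l \<in> S then L2_inner lborel (P h l f) g else 0)"
        by (auto simp: T_def L2_inner_def)
      then show ?thesis by simp
    qed
    show "(\<lambda>l. hs_norm2 (T l)) \<in> borel_measurable borel" unfolding hs by measurable
    have "(\<integral>\<^sup>+l. hs_norm2 (T l) \<partial>\<mu>) \<le> (\<integral>\<^sup>+l. hs_norm2 (P h l) \<partial>\<mu>)"
      by (intro nn_integral_mono) (simp add: hs)
    then show "(\<integral>\<^sup>+l. hs_norm2 (T l) \<partial>\<mu>) < \<infinity>"
      by (simp add: P_norm[OF h] order_le_less_trans)
  qed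
  from P_surj[OF this] show ?thesis by (auto simp: restricts_def T_def)
qed

lemma restricts_V:
  assumes g: "restricts h S g" and h: "h \<in> V S'" and sub: "S \<inter> S' \<subseteq> S''"
  shows "g \<in> V S''"
proof -
  have gL: "g \<in> LG" using g by (simp add: restricts_def)
  have "AE l in \<mu>. oper_eq (P g l) (if l \<in> S then P h l else (\<lambda>v t. 0))"
    using g by (simp add: restricts_def)
  then have "AE l in \<mu>. fibre S'' l (P g l)"
    using V_fibre[OF h]
  proof eventually_elim
    case (elim l)
    have lin: "L2_linear (if l \<in> S then P h l else (\<lambda>v t. 0))"
      using P_linear[OF V_L2[OF h]] by simp
    have "fibre (S \<inter> S') l (if l \<in> S then P h l else (\<lambda>v t. 0))"
      using elim(2) by (auto simp: fibre_def)
    then have "fibre S'' l (if l \<in> S then P h l else (\<lambda>v t. 0))"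
      by (rule fibre_mono[OF _ sub lin])
    then show ?case by (rule fibre_cong[OF _ elim(1) P_linear[OF gL]])
  qed
  with gL show ?thesis by (simp add: V_def)
qed

text \<open>The spectral measure of h for the projections that cut the transform down to sets of
  parameters.\<close>

definition spectral_measure :: "('n \<Rightarrow> complex) \<Rightarrow> (real, 'z) vec measure" where
  "spectral_measure h = density \<mu> (\<lambda>l. hs_norm2 (P h l))"

lemma sets_spectral_measure [simp, measurable_cong]: "sets (spectral_measure h) = sets borel"
  by (simp add: spectral_measure_def)

lemma space_spectral_measure [simp]: "space (spectral_measure h) = UNIV"
  by (simp add: spectral_measure_def)

lemma emeasure_spectral_measure:
  assumes g: "restricts h S g" and h: "h \<in> LG" and S [measurable]: "S \<in> sets borel"
  shows "emeasure (spectral_measure h) S = ennreal (norm2 g)"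
proof -
  have gL: "g \<in> LG" using g by (simp add: restricts_def)
  have [measurable]: "(\<lambda>l. hs_norm2 (P h l)) \<in> borel_measurable borel" by (rule P_hs_measurable[OF h])
  have "AE l in \<mu>. oper_eq (P g l) (if l \<in> S then P h l else (\<lambda>v t. 0))"
    using g by (simp add: restricts_def)
  then have "AE l in \<mu>. hs_norm2 (P h l) * indicator S l = hs_norm2 (P g l)"
  proof eventually_elim
    case (elim l)
    have "hs_norm2 (P g l) = hs_norm2 (if l \<in> S then P h l else (\<lambda>v t. 0))"
      by (rule hs_norm2_cong[OF elim]) (use P_closed[OF gL] P_closed[OF h] in \<open>auto split: if_splits\<close>)
    then show ?case by simp
  qed
  then have "(\<integral>\<^sup>+l. hs_norm2 (P h l) * indicator S l \<partial>\<mu>) = (\<integral>\<^sup>+l. hs_norm2 (P g l) \<partial>\<mu>)"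
    by (rule nn_integral_cong_AE)
  then show ?thesis
    by (simp add: spectral_measure_def emeasure_density P_norm[OF gL])
qed

lemma restricts_UNIV: "h \<in> LG \<Longrightarrow> restricts h UNIV h"
  by (simp add: restricts_def)

lemma finite_spectral_measure: "h \<in> LG \<Longrightarrow> finite_measure (spectral_measure h)"
  by (rule finite_measureI) (simp add: emeasure_spectral_measure[OF restricts_UNIV])

lemma measure_spectral_measure:
  "restricts h S g \<Longrightarrow> h \<in> LG \<Longrightarrow> S \<in> sets borel \<Longrightarrow> measure (spectral_measure h) S = norm2 g"
  by (simp add: measure_def emeasure_spectral_measure)

lemma restricts_diff:
  assumes h: "h \<in> LG" and a: "restricts h A a" and b: "restricts h B b" and "B \<subseteq> A"
  shows "restricts h (A - B) (\<lambda>x. a x - b x)"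
proof -
  have aL: "a \<in> LG" and bL: "b \<in> LG" using a b by (auto simp: restricts_def)
  have 1: "AE l in \<mu>. oper_eq (P a l) (if l \<in> A then P h l else (\<lambda>v t. 0))"
    and 2: "AE l in \<mu>. oper_eq (P b l) (if l \<in> B then P h l else (\<lambda>v t. 0))"
    using a b by (auto simp: restricts_def)
  have "AE l in \<mu>. oper_eq (P (\<lambda>x. a x - b x) l) (if l \<in> A - B then P h l else (\<lambda>v t. 0))"
    using 1 2 P_diff[OF aL bL]
  proof eventually_elim
    case (elim l)
    show ?case
      unfolding oper_eq_def
    proof
      fix v :: "(real, 'd) vec \<Rightarrow> complex" assume v: "v \<in> L2 lborel"
      have "AE t in lborel. P a l v t = (if l \<in> A then P h l else (\<lambda>v t. 0)) v t"
        "AE t in lborel. P b l v t = (if l \<in> B then P h l else (\<lambda>v t. 0)) v t"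
        "AE t in lborel. P (\<lambda>x. a x - b x) l v t = P a l v t - P b l v t"
        using elim v by (auto simp: oper_eq_def)
      then show "AE t in lborel. P (\<lambda>x. a x - b x) l v t = (if l \<in> A - B then P h l else (\<lambda>v t. 0)) v t"
        by eventually_elim (use \<open>B \<subseteq> A\<close> in auto)
    qed
  qed
  then show ?thesis using L2_diff[OF aL bL] by (simp add: restricts_def)
qed

text \<open>The parts are removed one at a time; disjointness ensures that each set still lies in
  what remains.\<close>

lemma restricts_sum:
  assumes h: "h \<in> LG" and g: "\<And>i. restricts h (S i) (g i)" and disj: "disjoint_family S" and "finite F"
  shows "restricts h (- (\<Union>i\<in>F. S i)) (\<lambda>x. h x - (\<Sum>i\<in>F. g i x))"
  using \<open>finite F\<close>
proof (induction F)
  case empty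
  then show ?case using restricts_UNIV[OF h] by simp
next
  case (insert i F)
  have "S i \<subseteq> - (\<Union>i\<in>F. S i)"
    using disjoint_family_onD[OF disj, of i] insert(2) by fastforce
  from restricts_diff[OF h insert(3) g this]
  show ?case using insert(1,2) by (simp add: algebra_simps Diff_eq Compl_Un Int_commute)
qed

section \<open>The dyadic decomposition\<close>

definition tile :: "int \<Rightarrow> (real, 'z) vec set" where
  "tile j = (\<lambda>l. (2 powi (- j)) *\<^sub>R l) ` E_set G"

lemma tile_iff: "l \<in> tile j \<longleftrightarrow> (2 powi j) *\<^sub>R l \<in> E_set G"
proof
  assume "l \<in> tile j"
  then obtain k where "k \<in> E_set G" "l = (2 powi (- j)) *\<^sub>R k" by (auto simp: tile_def)
  then show "(2 powi j) *\<^sub>R l \<in> E_set G" by (simp add: power_int_add[symmetric])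
next
  assume "(2 powi j) *\<^sub>R l \<in> E_set G"
  moreover have "l = (2 powi (- j)) *\<^sub>R ((2 powi j) *\<^sub>R l)" by (simp add: power_int_add[symmetric])
  ultimately show "l \<in> tile j" unfolding tile_def by blast
qed

lemma tile_measurable [measurable]: "tile j \<in> sets borel"
proof -
  have "E_set G \<in> sets borel" unfolding E_set_def by measurable
  then have "(\<lambda>l. (2 powi j) *\<^sub>R l) -` E_set G \<inter> space borel \<in> sets borel"
    by (rule measurable_sets[rotated]) simp
  also have "(\<lambda>l. (2 powi j) *\<^sub>R l) -` E_set G \<inter> space borel = tile j"
    by (auto simp: tile_iff)
  finally show ?thesis .
qed

text \<open>The cubes that define E are balls of this norm, so E is the shell of radii in (1/4,
  1/2], and powers of 2 act on the radii.\<close>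

definition maxnorm :: "(real, 'z) vec \<Rightarrow> real" where
  "maxnorm l = Max (range (\<lambda>k. \<bar>l $ k\<bar>))"

lemma maxnorm_le_iff: "maxnorm l \<le> r \<longleftrightarrow> l \<in> cbox (vec (- r)) (vec r)"
proof -
  have "\<bar>x\<bar> \<le> r \<longleftrightarrow> - r \<le> x \<and> x \<le> r" for x :: real by linarith
  then show ?thesis by (simp add: maxnorm_def mem_box_cart)
qed

lemma maxnorm_scale: "c > 0 \<Longrightarrow> maxnorm (c *\<^sub>R l) = c * maxnorm l"
proof -
  assume "c > 0"
  have "Max ((\<lambda>r. c * r) ` range (\<lambda>k. \<bar>l $ k\<bar>)) = c * Max (range (\<lambda>k. \<bar>l $ k\<bar>))"
    by (rule mono_Max_commute[symmetric]) (use \<open>c > 0\<close> in \<open>auto intro: monoI\<close>)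
  then show ?thesis using \<open>c > 0\<close> by (simp add: maxnorm_def image_image abs_mult)
qed

lemma maxnorm_pos: "l \<noteq> 0 \<Longrightarrow> maxnorm l > 0"
proof (rule ccontr)
  assume "l \<noteq> 0" "\<not> maxnorm l > 0"
  then have "l \<in> cbox (vec (- 0)) (vec 0)" using maxnorm_le_iff[of l 0] by simp
  then have "l = 0" by (auto simp: mem_box_cart vec_eq_iff intro: antisym)
  with \<open>l \<noteq> 0\<close> show False by simp
qed

lemma E_set_iff: "l \<in> E_set G \<longleftrightarrow> l \<in> Sigma_set G \<and> 1/4 < maxnorm l \<and> maxnorm l \<le> 1/2"
  using maxnorm_le_iff[of l "1/2"] maxnorm_le_iff[of l "1/4"] by (auto simp: E_set_def)

text \<open>If the norm of l is 2^(-1-q), membership in tile j reads 2^(-2) < 2^(j-1-q) \<le>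
  2^(-1), that is j \<le> q < j + 1. The half-open shell yields exactly one index, hence
  disjointness and covering at once.\<close>

lemma tile_iff_floor:
  "l \<in> tile j \<longleftrightarrow> l \<in> Sigma_set G \<and> j = \<lfloor>log 2 (1 / (2 * maxnorm l))\<rfloor>"
proof (cases "l \<in> Sigma_set G")
  case True
  then have "l \<noteq> 0" using zero_notin_Sigma_set by auto
  then have pos: "maxnorm l > 0" by (rule maxnorm_pos)
  define q where "q = log 2 (1 / (2 * maxnorm l))"
  have q: "1 / (2 * maxnorm l) = 2 powr q" using pos by (simp add: q_def)
  have M: "maxnorm l = 2 powr (- 1 - q)"
    using q pos by (simp add: powr_diff powr_minus field_simps)
  have "maxnorm ((2 powi j) *\<^sub>R l) = 2 powr (real_of_int j - 1 - q)"
    by (simp add: maxnorm_scale M powr_real_of_int'[symmetric] powr_add[symmetric] add_diff_eq)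
  then have "l \<in> tile j \<longleftrightarrow> 1/4 < 2 powr (real_of_int j - 1 - q) \<and> 2 powr (real_of_int j - 1 - q) \<le> 1/2"
    using True by (simp add: tile_iff E_set_iff Sigma_set_scale)
  also have "(1/4::real) = 2 powr (-2)" by (simp add: powr_minus)
  also have "(1/2::real) = 2 powr (-1)" by (simp add: powr_minus)
  finally have "l \<in> tile j \<longleftrightarrow> - 2 < real_of_int j - 1 - q \<and> real_of_int j - 1 - q \<le> - 1"
    by (simp only: powr_less_cancel_iff powr_le_cancel_iff one_less_numeral_iff semiring_norm)
  also have "\<dots> \<longleftrightarrow> j = \<lfloor>q\<rfloor>" by linarith
  finally show ?thesis using True by (simp add: q_def)
qed (simp add: tile_iff E_set_iff Sigma_set_scale)

lemma disjoint_tiles: "disjoint_family tile"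
  by (auto simp: disjoint_family_on_def tile_iff_floor)

lemma Union_tiles: "(\<Union>j. tile j) = Sigma_set G"
  by (auto simp: tile_iff_floor)

lemma V_tile_subset: "V (tile j) \<subseteq> V (Sigma_set G)"
  by (rule V_mono) (use Union_tiles in blast)

lemma H_E_eq: "H_E G P u j = V (tile j)"
  by (simp add: H_E_def plancherel_preimage_eq_V tile_def)

lemma dil_op_tile: "f \<in> V (tile i) \<Longrightarrow> dil_op G j f \<in> V (tile (i + j))"
proof -
  have "{l. (2 powi j) *\<^sub>R l \<in> tile i} = tile (i + j)"
    by (rule Set.set_eqI) (simp add: tile_iff power_int_add)
  then show "f \<in> V (tile i) \<Longrightarrow> dil_op G j f \<in> V (tile (i + j))" using V_dil_op[of f "tile i" j] by simp
qed

text \<open>The tail is the part of h off finitely many tiles. Along symmetric intervals of indices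
  these complements decrease to the complement of \<open>Sigma_set G\<close>, a null set, so their
  spectral mass tends to 0 by continuity from above.\<close>

lemma tail_tendsto_0:
  assumes h: "h \<in> LG" and g: "\<And>j. restricts h (tile j) (g j)"
  shows "((\<lambda>F. norm2 (\<lambda>x. h x - (\<Sum>j\<in>F. g j x))) \<longlongrightarrow> 0) (finite_subsets_at_top UNIV)"
proof -
  interpret N: finite_measure "spectral_measure h" by (rule finite_spectral_measure[OF h])
  define C where "C F = - (\<Union>j\<in>F. tile j)" for F :: "int set"
  have C [measurable]: "C F \<in> sets borel" if "finite F" for F
    unfolding C_def using that by (intro borel_comp sets.finite_UN) auto
  have norm: "norm2 (\<lambda>x. h x - (\<Sum>j\<in>F. g j x)) = measure (spectral_measure h) (C F)" if "finite F" for F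
    unfolding C_def
    by (rule measure_spectral_measure[OF restricts_sum[OF h g disjoint_tiles that] h, symmetric])
       (use C[OF that] in \<open>simp add: C_def\<close>)
  have "(\<lambda>n. measure (spectral_measure h) (C {- int n..int n})) \<longlonglongrightarrow> measure (spectral_measure h) (\<Inter>n. C {- int n..int n})"
    by (rule N.finite_Lim_measure_decseq) (auto simp: decseq_def C_def intro!: C[unfolded C_def])
  also have "(\<Inter>n. C {- int n..int n}) = - Sigma_set G"
  proof -
    have "(\<Inter>n. C {- int n..int n}) = - (\<Union>j\<in>(\<Union>n. {- int n..int n}). tile j)"
      by (simp only: C_def UN_UN_flatten Compl_UN)
    also have "(\<Union>n. {- int n..int n}) = UNIV"
    proof (intro equalityI subsetI)
      fix j :: int
      have "j \<in> {- int (nat \<bar>j\<bar>)..int (nat \<bar>j\<bar>)}" by auto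
      then show "j \<in> (\<Union>n. {- int n..int n})" by blast
    qed simp
    finally show ?thesis by (simp only: Union_tiles)
  qed
  also have "measure (spectral_measure h) (- Sigma_set G) = 0"
  proof -
    have "- Sigma_set G \<in> null_sets \<mu>"
      using AE_\<mu>_Sigma by (subst AE_iff_null_sets) (auto intro: borel_comp)
    then have "emeasure (spectral_measure h) (- Sigma_set G) = 0"
      unfolding spectral_measure_def using P_hs_measurable[OF h]
      by (subst emeasure_density) (auto simp: null_setsD2 intro!: nn_integral_null_set)
    then show ?thesis by (simp add: measure_def)
  qed
  finally have lim: "(\<lambda>n. measure (spectral_measure h) (C {- int n..int n})) \<longlonglongrightarrow> 0" .
  show ?thesis
  proof (rule tendstoI)
    fix e :: real assume "e > 0"
    \<comment> \<open>One interval of small mass is enough: enlarging the finite set only lowers the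
      mass, which carries the limit from the sequence to the net of finite sets.\<close>
    obtain n where n: "measure (spectral_measure h) (C {- int n..int n}) < e"
      using eventually_happens'[OF sequentially_bot order_tendstoD(2)[OF lim \<open>e > 0\<close>]] by blast
    show "\<forall>\<^sub>F F in finite_subsets_at_top UNIV. dist (norm2 (\<lambda>x. h x - (\<Sum>j\<in>F. g j x))) 0 < e"
      unfolding eventually_finite_subsets_at_top
    proof (intro exI[of _ "{- int n..int n}"] conjI allI impI)
      fix F assume F: "finite F \<and> {- int n..int n} \<subseteq> F \<and> F \<subseteq> UNIV"
      then have "measure (spectral_measure h) (C F) \<le> measure (spectral_measure h) (C {- int n..int n})"
        by (intro N.finite_measure_mono) (auto simp: C_def intro!: C[unfolded C_def])
      with n show "dist (norm2 (\<lambda>x. h x - (\<Sum>j\<in>F. g j x))) 0 < e" using norm F by simp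
    qed auto
  qed
qed

text \<open>A partial sum is the spectral mass of finitely many tiles, that is, the total mass less
  that of the tail.\<close>

lemma norm2_has_sum:
  assumes h: "h \<in> LG" and g: "\<And>j. restricts h (tile j) (g j)"
  shows "((\<lambda>j. norm2 (g j)) has_sum norm2 h) UNIV"
proof -
  interpret N: finite_measure "spectral_measure h" by (rule finite_spectral_measure[OF h])
  have "(\<Sum>j\<in>F. norm2 (g j)) = norm2 h - norm2 (\<lambda>x. h x - (\<Sum>j\<in>F. g j x))" if F: "finite F" for F
  proof -
    have m: "(\<Union>j\<in>F. tile j) \<in> sets borel" using F by (intro sets.finite_UN) auto
    have "(\<Sum>j\<in>F. norm2 (g j)) = (\<Sum>j\<in>F. measure (spectral_measure h) (tile j))"
      by (simp add: measure_spectral_measure[OF g h])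
    also have "\<dots> = measure (spectral_measure h) (\<Union>j\<in>F. tile j)"
      using disjoint_tiles F
      by (intro N.finite_measure_finite_Union[symmetric]) (auto simp: disjoint_family_on_def)
    also have "\<dots> = measure (spectral_measure h) UNIV - measure (spectral_measure h) (- (\<Union>j\<in>F. tile j))"
      using N.finite_measure_compl[of "\<Union>j\<in>F. tile j"] m by (simp add: Compl_eq_Diff_UNIV)
    also have "\<dots> = norm2 h - norm2 (\<lambda>x. h x - (\<Sum>j\<in>F. g j x))"
      using measure_spectral_measure[OF restricts_UNIV[OF h] h]
        measure_spectral_measure[OF restricts_sum[OF h g disjoint_tiles F] h] m
        borel_comp[OF m] by simp
    finally show ?thesis .
  qed
  then have ev: "\<forall>\<^sub>F F in finite_subsets_at_top UNIV.
      norm2 h - norm2 (\<lambda>x. h x - (\<Sum>j\<in>F. g j x)) = (\<Sum>j\<in>F. norm2 (g j))"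
    by (auto intro!: eventually_finite_subsets_at_top_weakI)
  have "((\<lambda>F. norm2 h - norm2 (\<lambda>x. h x - (\<Sum>j\<in>F. g j x))) \<longlongrightarrow> norm2 h - 0) (finite_subsets_at_top UNIV)"
    by (intro tendsto_diff tendsto_const tail_tendsto_0[OF h g])
  then show ?thesis
    unfolding has_sum_def using ev by (simp add: tendsto_cong)
qed

section \<open>The direct sum, its multiplicity and the frame\<close>

lemma L2_direct_sum_eq: "L2_direct_sum (haar G) (H_E G P u) = V (Sigma_set G)"
proof
  show "V (Sigma_set G) \<subseteq> L2_direct_sum (haar G) (H_E G P u)"
  proof
    fix h assume h: "h \<in> V (Sigma_set G)"
    note hL = V_L2[OF h]
    \<comment> \<open>The summands are the parts of h over the tiles.\<close>
    have "\<forall>j. \<exists>g. restricts h (tile j) g" by (intro allI restricts_exists[OF hL]) simp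
    from choice[OF this] obtain g where g: "\<And>j. restricts h (tile j) (g j)" by blast
    have "((\<lambda>F. sqrt (norm2 (\<lambda>x. h x - (\<Sum>j\<in>F. g j x)))) \<longlongrightarrow> sqrt 0) (finite_subsets_at_top UNIV)"
      by (intro tendsto_real_sqrt tail_tendsto_0[OF hL g])
    then have "((\<lambda>F. L2_norm (haar G) (\<lambda>x. h x - (\<Sum>j\<in>F. g j x))) \<longlongrightarrow> 0) (finite_subsets_at_top UNIV)"
      by simp
    moreover have "g j \<in> H_E G P u j" for j
      unfolding H_E_eq by (rule restricts_V[OF g h]) auto
    ultimately show "h \<in> L2_direct_sum (haar G) (H_E G P u)"
      unfolding L2_direct_sum_def using hL by blast
  qed
  show "L2_direct_sum (haar G) (H_E G P u) \<subseteq> V (Sigma_set G)"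
  proof
    fix h assume "h \<in> L2_direct_sum (haar G) (H_E G P u)"
    then obtain g where hL: "h \<in> LG" and g: "\<And>j. g j \<in> V (tile j)"
      and lim: "((\<lambda>F. L2_norm (haar G) (\<lambda>x. h x - (\<Sum>j\<in>F. g j x))) \<longlongrightarrow> 0) (finite_subsets_at_top UNIV)"
      unfolding L2_direct_sum_def H_E_eq by blast
    have gS: "g j \<in> V (Sigma_set G)" for j
      using g V_tile_subset by blast
    \<comment> \<open>\<open>V_limit\<close> is about sequences, while the direct sum is a limit
      over finite sets; symmetric intervals form a sequence cofinal among these.\<close>
    have "filterlim (\<lambda>n. {- int n..int n}) (finite_subsets_at_top UNIV) sequentially"
      unfolding filterlim_finite_subsets_at_top
    proof (intro allI impI)
      fix X :: "int set" assume X: "finite X \<and> X \<subseteq> UNIV"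
      then obtain b where b: "\<And>j. j \<in> X \<Longrightarrow> \<bar>j\<bar> \<le> b"
        by (meson Max_ge finite_imageI imageI)
      show "\<forall>\<^sub>F n in sequentially. finite {- int n..int n} \<and> X \<subseteq> {- int n..int n} \<and> {- int n..int n} \<subseteq> UNIV"
        using b by (intro eventually_sequentiallyI[of "nat b"]) force
    qed
    from filterlim_compose[OF lim this]
    have l: "(\<lambda>n. L2_norm (haar G) (\<lambda>x. (\<Sum>j\<in>{- int n..int n}. g j x) - h x)) \<longlonglongrightarrow> 0"
      by (subst L2_norm_minus_commute)
    have "(\<lambda>x. \<Sum>j\<in>{- int n..int n}. g j x) \<in> V (Sigma_set G)" for n by (intro V_sum gS)
    from V_limit[OF this hL l] show "h \<in> V (Sigma_set G)" .
  qed
qed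

lemma orthogonal_family: "L2_orthogonal_family (haar G) (H_E G P u)"
  unfolding L2_orthogonal_family_def H_E_eq
  using disjoint_tiles V_closed_subspace V_orthogonal by (auto simp: disjoint_family_on_def)

text \<open>The constant field of projections onto the line of u does it: the range consists of
  multiples of u, so its tensor space is L2 tensor u. Surjectivity of \<open>P\<close> puts the
  whole direct integral into the image.\<close>

lemma multiplicity_free_V: "multiplicity_free G P (V (Sigma_set G))"
  unfolding multiplicity_free_def
proof (intro conjI exI[of _ "\<lambda>l. rank_one_oper u u"] ballI)
  let ?Q = "rank_one_oper u u"
  have uu: "L2_inner lborel u u = 1" using u by (simp add: L2_inner_self)
  \<comment> \<open>An equality of functions and not merely almost everywhere, so u itself lies in
    the range.\<close>
  have Qu: "?Q u = u" by (simp add: rank_one_oper_def uu)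
  show "L2_closed_subspace (haar G) (V (Sigma_set G))" by (rule V_closed_subspace)
  show "left_transl G m f \<in> V (Sigma_set G)" if "f \<in> V (Sigma_set G)" for m f
    by (rule V_left_transl[OF that])
  have "L2_projection ?Q"
    unfolding L2_projection_def
  proof (intro conjI ballI)
    show "L2_linear ?Q" by (rule rank_one_linear[OF u(1) u(1)])
    show "oper_eq (\<lambda>f. ?Q (?Q f)) ?Q"
      by (simp add: oper_eq_def rank_one_oper_def L2_inner_scale_left uu)
    fix f g :: "(real, 'd) vec \<Rightarrow> complex"
    show "L2_inner lborel (?Q f) g = L2_inner lborel f (?Q g)"
      using L2_inner_commute[of lborel g u]
      by (simp add: rank_one_oper_def L2_inner_scale_left L2_inner_scale_right)
  qed
  moreover have "has_rank_one ?Q"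
    unfolding has_rank_one_def
  proof (intro bexI[of _ u] conjI ballI)
    show "\<not> (AE t in lborel. u t = 0)" using L2_norm_eq_0_AE[of u lborel] u by auto
    show "\<exists>c. AE t in lborel. ?Q f t = c * u t" for f by (auto simp: rank_one_oper_def)
    show "u \<in> ?Q ` L2 lborel" using Qu u(1) by (metis image_eqI)
  qed
  ultimately show "AE l in \<mu>. L2_projection ?Q \<and> has_rank_one ?Q" by simp
  let ?W = "?Q ` L2 lborel"
  have W: "u \<in> ?W" "\<And>w. w \<in> ?W \<Longrightarrow> \<exists>c. w = (\<lambda>t. c * u t)"
    using Qu u(1) by (metis image_eqI) (auto simp: rank_one_oper_def)
  have DI: "direct_integral_on G (Sigma_set G) (\<lambda>l. tensor_space ?W)
      = {T \<in> direct_integral G. AE l in \<mu>. fibre (Sigma_set G) l (T l)}"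
    using tensor_space_line[OF u _ W]
    by (auto simp: direct_integral_on_def fibre_def direct_integral_def)
  show "plancherel_image G P (V (Sigma_set G)) = direct_integral_on G (Sigma_set G) (\<lambda>l. tensor_space ?W)"
    unfolding DI
  proof (intro equalityI subsetI)
    fix T assume "T \<in> plancherel_image G P (V (Sigma_set G))"
    then obtain f where T: "T \<in> direct_integral G" and f: "f \<in> V (Sigma_set G)"
      and eq: "AE l in \<mu>. oper_eq (P f l) (T l)"
      by (auto simp: plancherel_image_def field_eq_def)
    have lin: "L2_linear (T l)" for l using T by (auto simp: direct_integral_def hilbert_schmidt_def)
    from eq V_fibre[OF f] have "AE l in \<mu>. fibre (Sigma_set G) l (T l)"
      by eventually_elim (rule fibre_cong[OF _ oper_eq_sym lin])
    with T show "T \<in> {T \<in> direct_integral G. AE l in \<mu>. fibre (Sigma_set G) l (T l)}" by simp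
  next
    fix T assume "T \<in> {T \<in> direct_integral G. AE l in \<mu>. fibre (Sigma_set G) l (T l)}"
    then have T: "T \<in> direct_integral G" and fib: "AE l in \<mu>. fibre (Sigma_set G) l (T l)" by auto
    from P_surj[OF T] obtain f where f: "f \<in> LG" and eq: "AE l in \<mu>. oper_eq (P f l) (T l)" by blast
    from eq fib have "AE l in \<mu>. fibre (Sigma_set G) l (P f l)"
      by eventually_elim (rule fibre_cong[OF _ _ P_linear[OF f]])
    with f have "f \<in> V (Sigma_set G)" by (simp add: V_def)
    with T eq show "T \<in> plancherel_image G P (V (Sigma_set G))"
      by (auto simp: plancherel_image_def field_eq_def)
  qed
qed simp

text \<open>The system dilated to tile j sees only the part of h over that tile.
  \<open>dil_op G (- j)\<close> takes this part to tile 0 with the same norm, where the given frame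
  measures it.\<close>

lemma parseval_frame_dilations:
  assumes frame: "parseval_frame (haar G) (V (tile 0)) \<Gamma> (\<lambda>\<gamma>. left_transl G \<gamma> f)"
  shows "parseval_frame (haar G) (V (Sigma_set G)) (\<Gamma> \<times> (UNIV :: int set))
    (\<lambda>(\<gamma>, j). dil_op G j (left_transl G \<gamma> f))"
  unfolding parseval_frame_def
proof (intro conjI ballI)
  have fr: "left_transl G \<gamma> f \<in> V (tile 0)" if "\<gamma> \<in> \<Gamma>" for \<gamma>
    using frame that by (simp add: parseval_frame_def)
  have D: "dil_op G j (left_transl G \<gamma> f) \<in> V (tile j)" if "\<gamma> \<in> \<Gamma>" for \<gamma> j
    using dil_op_tile[OF fr[OF that], of j] by simp
  show "countable (\<Gamma> \<times> (UNIV :: int set))"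
    using frame by (auto simp: parseval_frame_def)
  show "(case i of (\<gamma>, j) \<Rightarrow> dil_op G j (left_transl G \<gamma> f)) \<in> V (Sigma_set G)"
    if "i \<in> \<Gamma> \<times> UNIV" for i
    using that D[THEN subsetD[OF V_tile_subset]] by auto
  fix h assume h: "h \<in> V (Sigma_set G)"
  note hL = V_L2[OF h]
  have "\<forall>j. \<exists>g. restricts h (tile j) g" by (intro allI restricts_exists[OF hL]) simp
  from choice[OF this] obtain g where g: "\<And>j. restricts h (tile j) (g j)" by blast
  have gV: "g j \<in> V (tile j)" for j by (rule restricts_V[OF g h]) auto
  define a where "a = (\<lambda>(j, \<gamma>). (cmod (L2_inner (haar G) h (dil_op G j (left_transl G \<gamma> f))))\<^sup>2)"
  have "L2_inner (haar G) h (dil_op G j (left_transl G \<gamma> f))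
      = L2_inner (haar G) (dil_op G (- j) (g j)) (left_transl G \<gamma> f)" if "\<gamma> \<in> \<Gamma>" for j \<gamma>
  proof -
    let ?x = "dil_op G j (left_transl G \<gamma> f)"
    \<comment> \<open>The rest of h lives over \<open>Sigma_set G\<close> without the tile and is
      orthogonal to all functions over the tile.\<close>
    have "restricts h (UNIV - tile j) (\<lambda>x. h x - g j x)"
      by (rule restricts_diff[OF hL restricts_UNIV[OF hL] g]) simp
    then have r: "(\<lambda>x. h x - g j x) \<in> V (Sigma_set G - tile j)"
      by (rule restricts_V[OF _ h]) auto
    have "L2_inner (haar G) (\<lambda>x. h x - g j x) ?x = 0"
      by (rule V_orthogonal[OF r D[OF that]]) auto
    then have "L2_inner (haar G) h ?x = L2_inner (haar G) (g j) ?x"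
      using L2_inner_diff_left[OF hL V_L2[OF gV[of j]] V_L2[OF D[OF that]]] by simp
    also have "\<dots> = L2_inner (haar G) (dil_op G j (dil_op G (- j) (g j))) ?x"
      by (simp add: dil_op_inverse)
    also have "\<dots> = L2_inner (haar G) (dil_op G (- j) (g j)) (left_transl G \<gamma> f)"
      by (rule dil_op_inner)
    finally show ?thesis .
  qed
  moreover have "((\<lambda>\<gamma>. (cmod (L2_inner (haar G) (dil_op G (- j) (g j)) (left_transl G \<gamma> f)))\<^sup>2)
      has_sum norm2 (g j)) \<Gamma>" for j
  proof -
    have "\<forall>k\<in>V (tile 0). ((\<lambda>\<gamma>. (cmod (L2_inner (haar G) k (left_transl G \<gamma> f)))\<^sup>2) has_sum norm2 k) \<Gamma>"
      using frame by (simp add: parseval_frame_def)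
    moreover have "dil_op G (- j) (g j) \<in> V (tile 0)"
      using dil_op_tile[OF gV[of j], of "- j"] by simp
    ultimately have "((\<lambda>\<gamma>. (cmod (L2_inner (haar G) (dil_op G (- j) (g j)) (left_transl G \<gamma> f)))\<^sup>2)
        has_sum norm2 (dil_op G (- j) (g j))) \<Gamma>" by (rule bspec)
    then show ?thesis unfolding dil_op_norm .
  qed
  ultimately have inner: "((\<lambda>\<gamma>. a (j, \<gamma>)) has_sum norm2 (g j)) \<Gamma>" for j
    by (simp add: a_def cong: has_sum_cong)
  have outer: "((\<lambda>j. norm2 (g j)) has_sum norm2 h) UNIV" by (rule norm2_has_sum[OF hL g])
  \<comment> \<open>The terms are nonnegative, so summable inner sums give summability on the
    product. Pairs are taken as (j, \<gamma>) in order to sum over \<gamma> with j fixed, and are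
    swapped afterwards.\<close>
  have "a summable_on (UNIV \<times> \<Gamma>)"
    by (rule summable_on_SigmaI[OF inner]) (use outer in \<open>auto simp: a_def summable_on_def\<close>)
  then have "(a has_sum norm2 h) (UNIV \<times> \<Gamma>)"
    by (rule has_sum_SigmaI[OF inner outer])
  then have "((\<lambda>p. a (prod.swap p)) has_sum norm2 h) (\<Gamma> \<times> UNIV)"
    by (subst has_sum_reindex_bij_betw[where g = prod.swap and B = "UNIV \<times> \<Gamma>"])
       (auto intro!: bij_betwI[where g = prod.swap])
  then show "((\<lambda>i. (cmod (L2_inner (haar G) h (case i of (\<gamma>, j) \<Rightarrow> dil_op G j (left_transl G \<gamma> f))))\<^sup>2)
      has_sum norm2 h) (\<Gamma> \<times> UNIV)"
    by (simp add: a_def case_prod_unfold)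
qed

end

theorem theorem23:
  fixes G :: "('n::t2_space, 'g::euclidean_space, 'z::{finite,linorder}, 'd::{finite,linorder}) nil_group"
    and P :: "('n \<Rightarrow> complex) \<Rightarrow> real^'z::{finite,linorder} \<Rightarrow> (real^'d::{finite,linorder}) oper"
    and u :: "real^'d::{finite,linorder} \<Rightarrow> complex"
    and f :: "'n \<Rightarrow> complex"
  assumes "nil_setting G"
    and "plancherel_transform G P"
    and "u \<in> L2 lborel" and "L2_norm lborel u = 1"
    and "parseval_frame (haar G) (H_E G P u 0) (Gamma_set G) (\<lambda>\<gamma>. left_transl G \<gamma> f)"
  shows "L2_orthogonal_family (haar G) (H_E G P u)
    \<and> L2_direct_sum (haar G) (H_E G P u) =
        plancherel_preimage G P (direct_integral_on G (Sigma_set G) (\<lambda>l. tensor_vec u))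
    \<and> multiplicity_free G P (L2_direct_sum (haar G) (H_E G P u))
    \<and> parseval_frame (haar G) (L2_direct_sum (haar G) (H_E G P u)) (Gamma_set G \<times> (UNIV :: int set))
        (\<lambda>(\<gamma>, j). dil_op G j (left_transl G \<gamma> f))"
proof -
  interpret nil_unit_vector G P u
    using assms by (auto simp: nil_unit_vector_def nil_unit_vector_axioms_def nil_plancherel_def
        nil_plancherel_axioms_def)
  from assms(5) have "parseval_frame (haar G) (V (tile 0)) (Gamma_set G) (\<lambda>\<gamma>. left_transl G \<gamma> f)"
    by (simp add: H_E_eq)
  then show ?thesis
    unfolding L2_direct_sum_eq plancherel_preimage_eq_V
    by (intro conjI refl orthogonal_family multiplicity_free_V parseval_frame_dilations)
qed

end
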